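(* Let $p \in \{a,e\}^*$ be a pattern. (1) If $p \preceq e^*a$, then $\mathrm{p\text{-}FD}(E_1^{\ge}p) \subseteq \mathrm{para\text{-}AC}^0$. (2) If $aa \preceq p$ or $ae \preceq p$, then $\mathrm{p\text{-}FD}(E_1^{\ge}p)$ contains a $\mathrm{W}[1]$-hard problem. Both items also hold with $\mathrm{p\text{-}FD}(E_1^{\ge}p)$ replaced by $\mathrm{p\text{-}FD}_{\mathrm{undirected}}(E_1^{\ge}p)$.
   Context: Vocabularies contain only relation symbols; all structures are finite. A pattern is a word $p\in\{a,e\}^*$. For $\bowtie\in\{=,\le,\ge\}$, a formula with pattern $E_1^{\bowtie}p$ is a sentence $\exists^{\bowtie}X\,\varphi(X)$ where $X$ is a unary second-order variable and $\varphi(X)$ is a first-order formula (with equality) in prenex normal form whose quantifier prefix, writing $a$ for $\forall$ and $e$ for $\exists$, is $p$. For a structure $\mathcal S$ with universe $U$ and $k\in\mathbb N$: $(\mathcal S,k)\models\exists^{\ge}X\,\varphi(X)$ iff there is $C\subseteq U$ with $|C|\ge k$ and $\mathcal S\models\varphi(C)$ (analogously $\le$, $=$). $\mathrm{p\text{-}models}(\psi)=\{(\mathcal S,k)\mid(\mathcal S,k)\models\psi\}$, parameter $k$. $\mathrm{p\text{-}FD}(E_1^{\bowtie}p)$ is the class of all $\mathrm{p\text{-}models}(\psi)$ for $\psi$ of pattern $E_1^{\bowtie}p$ over arbitrary vocabularies. Graphs are structures over $\{\sim\}$ ($\sim$ binary); undirected graphs: $\sim$ symmetric, self-loops allowed;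 $\mathrm{p\text{-}FD}_{\mathrm{undirected}}(E_1^{\bowtie}p)$ is the class of problems $\mathrm{p\text{-}models}(\psi)$ restricted to undirected graphs, for $\psi$ over $\{\sim\}$ with that pattern. $p\preceq q$ means $p$ is a subsequence of $q$; "$p\preceq e^*a$" means $p\preceq e^ma$ for some $m$. $\mathrm{para\text{-}AC}^0$: parameterized problems decided by constant-depth unbounded fan-in circuit families of size $f(k)n^{O(1)}$, $f$ computable. *)

theory Defs
  imports Main "HOL-Library.Sublist"
begin

section \<open>Finite relational structures\<close>

text \<open>A vocabulary is given by the list of the arities of its relation symbols; the symbols
  themselves are the positions in this list. As usual for structures that serve as inputs of
  algorithms, universes are initial segments \<open>{..<n}\<close> of the natural numbers; every finite
  structure is isomorphic to such a structure.\<close>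

type_synonym vocabulary = "nat list"

definition vocabulary :: "vocabulary \<Rightarrow> bool" where
  "vocabulary V \<longleftrightarrow> (\<forall>r\<in>set V. 0 < r)"

record relstruct =
  card_univ :: nat
  rels :: "nat list set list"

definition univ :: "relstruct \<Rightarrow> nat set" where
  "univ S = {..<card_univ S}"

definition tuples :: "relstruct \<Rightarrow> nat \<Rightarrow> nat list set" where
  "tuples S r = {t. length t = r \<and> set t \<subseteq> univ S}"

definition structures :: "vocabulary \<Rightarrow> relstruct set" where
  "structures V = {S. univ S \<noteq> {} \<and> length (rels S) = length V \<and>
     (\<forall>i<length V. rels S ! i \<subseteq> tuples S (V ! i))}"

definition expand :: "relstruct \<Rightarrow> nat list set \<Rightarrow> relstruct" where
  "expand S C = S\<lparr>rels := rels S @ [C]\<rparr>"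

abbreviation graph_voc :: vocabulary where
  "graph_voc \<equiv> [2]"

definition undirected_graphs :: "relstruct set" where
  "undirected_graphs = {G \<in> structures graph_voc.
     \<forall>u v. [u, v] \<in> rels G ! 0 \<longrightarrow> [v, u] \<in> rels G ! 0}"


section \<open>First-order formulas in prenex normal form\<close>

datatype quantifier = QAll | QEx

type_synonym pattern = "quantifier list"

text \<open>A prenex formula is a pair of a quantifier prefix and a quantifier-free matrix. The
  \<open>i\<close>-th quantifier of the prefix (counted from the left, starting with \<open>0\<close>) binds variable \<open>i\<close>.\<close>

datatype qf_formula =
    Falsum
  | Equal nat nat
  | Atom nat "nat list"
  | Neg qf_formula
  | Conj qf_formula qf_formula
  | Disj qf_formula qf_formula

type_synonym prenex = "pattern \<times> qf_formula"

primrec wf_qf :: "vocabulary \<Rightarrow> nat \<Rightarrow> qf_formula \<Rightarrow> bool" where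
  "wf_qf V m Falsum \<longleftrightarrow> True"
| "wf_qf V m (Equal x y) \<longleftrightarrow> x < m \<and> y < m"
| "wf_qf V m (Atom R xs) \<longleftrightarrow> R < length V \<and> length xs = V ! R \<and> (\<forall>x\<in>set xs. x < m)"
| "wf_qf V m (Neg a) \<longleftrightarrow> wf_qf V m a"
| "wf_qf V m (Conj a b) \<longleftrightarrow> wf_qf V m a \<and> wf_qf V m b"
| "wf_qf V m (Disj a b) \<longleftrightarrow> wf_qf V m a \<and> wf_qf V m b"

definition sentence :: "vocabulary \<Rightarrow> prenex \<Rightarrow> bool" where
  "sentence V \<phi> \<longleftrightarrow> wf_qf V (length (fst \<phi>)) (snd \<phi>)"

primrec holds_qf :: "relstruct \<Rightarrow> nat list \<Rightarrow> qf_formula \<Rightarrow> bool" where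
  "holds_qf S env Falsum \<longleftrightarrow> False"
| "holds_qf S env (Equal x y) \<longleftrightarrow> env ! x = env ! y"
| "holds_qf S env (Atom R xs) \<longleftrightarrow> map (\<lambda>x. env ! x) xs \<in> rels S ! R"
| "holds_qf S env (Neg a) \<longleftrightarrow> \<not> holds_qf S env a"
| "holds_qf S env (Conj a b) \<longleftrightarrow> holds_qf S env a \<and> holds_qf S env b"
| "holds_qf S env (Disj a b) \<longleftrightarrow> holds_qf S env a \<or> holds_qf S env b"

fun holds :: "relstruct \<Rightarrow> nat list \<Rightarrow> prenex \<Rightarrow> bool" where
  "holds S env ([], a) \<longleftrightarrow> holds_qf S env a"
| "holds S env (QAll # p, a) \<longleftrightarrow> (\<forall>u\<in>univ S. holds S (env @ [u]) (p, a))"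
| "holds S env (QEx # p, a) \<longleftrightarrow> (\<exists>u\<in>univ S. holds S (env @ [u]) (p, a))"


section \<open>Weighted Fagin-definable problems\<close>

text \<open>The formula \<open>\<phi>(X)\<close> is a sentence over the vocabulary \<open>V @ [s]\<close>, whose last symbol is the
  second-order variable \<open>X\<close> of arity \<open>s\<close>. For \<open>s = 1\<close> the relation \<open>C\<close> is a set of one-element
  lists, that is, a subset of the universe. The relation \<open>cmp\<close> is one of \<open>(=)\<close>, \<open>(\<le>)\<close>, \<open>(\<ge>)\<close>.\<close>

definition so_models ::
  "(nat \<Rightarrow> nat \<Rightarrow> bool) \<Rightarrow> nat \<Rightarrow> relstruct \<Rightarrow> nat \<Rightarrow> prenex \<Rightarrow> bool" where
  "so_models cmp s S k \<phi> \<longleftrightarrow>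
     (\<exists>C \<subseteq> tuples S s. cmp (card C) k \<and> holds (expand S C) [] \<phi>)"

definition p_models ::
  "(nat \<Rightarrow> nat \<Rightarrow> bool) \<Rightarrow> nat \<Rightarrow> vocabulary \<Rightarrow> prenex \<Rightarrow> (relstruct \<times> nat) set" where
  "p_models cmp s V \<phi> = {(S, k). S \<in> structures V \<and> so_models cmp s S k \<phi>}"

text \<open>A parameterized problem is a set of pairs of an input string and a parameter value.\<close>

type_synonym pproblem = "(bool list \<times> nat) set"

text \<open>The binary encoding of a structure: the size of the universe in unary, followed by the
  truth tables of the relations, the tuples being listed lexicographically.\<close>

definition encode :: "vocabulary \<Rightarrow> relstruct \<Rightarrow> bool list" where
  "encode V S = replicate (card_univ S) True @ False #
     concat (map (\<lambda>(r, R). map (\<lambda>t. t \<in> R) (product_lists (replicate r [0..<card_univ S])))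
       (zip V (rels S)))"

definition encode_problem :: "vocabulary \<Rightarrow> (relstruct \<times> nat) set \<Rightarrow> pproblem" where
  "encode_problem V Q = {(encode V S, k) |S k. (S, k) \<in> Q}"

definition p_FD :: "(nat \<Rightarrow> nat \<Rightarrow> bool) \<Rightarrow> pattern \<Rightarrow> pproblem set" where
  "p_FD cmp p = {encode_problem V (p_models cmp 1 V (p, a)) |V a.
     vocabulary V \<and> sentence (V @ [1]) (p, a)}"

definition p_FD_undirected :: "(nat \<Rightarrow> nat \<Rightarrow> bool) \<Rightarrow> pattern \<Rightarrow> pproblem set" where
  "p_FD_undirected cmp p =
     {encode_problem graph_voc (p_models cmp 1 graph_voc (p, a) \<inter> undirected_graphs \<times> UNIV) |a.
       sentence (graph_voc @ [1]) (p, a)}"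


section \<open>Computations\<close>

text \<open>Programs operate on finitely many stacks of bits; every elementary operation takes one
  time step. Since a tape is a pair of stacks, this is a structured version of deterministic
  multitape Turing machines, with the same running times up to constant factors.\<close>

datatype prog =
    Push nat bool
  | Pop nat
  | Seq prog prog
  | Branch nat prog prog prog
  | Loop nat prog

type_synonym stacks = "nat \<Rightarrow> bool list"

text \<open>\<open>Branch r P0 P1 P2\<close> continues with \<open>P0\<close>, \<open>P1\<close> or \<open>P2\<close> if stack \<open>r\<close> is empty, has \<open>False\<close> on
  top or has \<open>True\<close> on top, respectively; \<open>Loop r P\<close> iterates \<open>P\<close> as long as stack \<open>r\<close> is nonempty.
  \<open>run P s t s'\<close> says that \<open>P\<close> started on \<open>s\<close> halts after exactly \<open>t\<close> steps with result \<open>s'\<close>.\<close>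

inductive run :: "prog \<Rightarrow> stacks \<Rightarrow> nat \<Rightarrow> stacks \<Rightarrow> bool" where
  push: "run (Push r b) s 1 (s(r := b # s r))"
| pop: "run (Pop r) s 1 (s(r := tl (s r)))"
| seq: "run P s t s' \<Longrightarrow> run P' s' t' s'' \<Longrightarrow> run (Seq P P') s (t + t') s''"
| branch_empty: "s r = [] \<Longrightarrow> run P0 s t s' \<Longrightarrow> run (Branch r P0 P1 P2) s (Suc t) s'"
| branch_False: "s r = False # w \<Longrightarrow> run P1 s t s' \<Longrightarrow> run (Branch r P0 P1 P2) s (Suc t) s'"
| branch_True: "s r = True # w \<Longrightarrow> run P2 s t s' \<Longrightarrow> run (Branch r P0 P1 P2) s (Suc t) s'"
| loop_end: "s r = [] \<Longrightarrow> run (Loop r P) s 1 s"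
| loop_step: "s r \<noteq> [] \<Longrightarrow> run P s t s' \<Longrightarrow> run (Loop r P) s' t' s'' \<Longrightarrow>
    run (Loop r P) s (Suc (t + t')) s''"

inductive_cases run_PushE: "run (Push r b) s t s'"
inductive_cases run_PopE: "run (Pop r) s t s'"
inductive_cases run_SeqE: "run (Seq P P') s t s'"
inductive_cases run_BranchE: "run (Branch r P0 P1 P2) s t s'"
inductive_cases run_LoopE: "run (Loop r P) s t s'"

lemma run_deterministic:
  "run P s t s' \<Longrightarrow> run P s u s'' \<Longrightarrow> t = u \<and> s' = s''"
proof (induction arbitrary: u s'' rule: run.induct)
  case (push r b s)
  then show ?case by (auto elim: run_PushE)
next
  case (pop r s)
  then show ?case by (auto elim: run_PopE)
next
  case (seq P s t s1 P' t' s2)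
  from seq.prems show ?case by (rule run_SeqE) (use seq.IH in blast)
next
  case (branch_empty s r P0 t s' P1 P2)
  from branch_empty.prems have "\<exists>v. u = Suc v \<and> run P0 s v s''"
    by (rule run_BranchE) (simp_all add: branch_empty.hyps)
  then show ?case using branch_empty.IH by blast
next
  case (branch_False s r w P1 t s' P0 P2)
  from branch_False.prems have "\<exists>v. u = Suc v \<and> run P1 s v s''"
    by (rule run_BranchE) (simp_all add: branch_False.hyps)
  then show ?case using branch_False.IH by blast
next
  case (branch_True s r w P2 t s' P0 P1)
  from branch_True.prems have "\<exists>v. u = Suc v \<and> run P2 s v s''"
    by (rule run_BranchE) (simp_all add: branch_True.hyps)
  then show ?case using branch_True.IH by blast
next
  case (loop_end s r P)
  from loop_end.prems show ?case by (rule run_LoopE) (simp_all add: loop_end.hyps)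
next
  case (loop_step s r P t s' t' s2)
  from loop_step.prems show ?case
  proof (rule run_LoopE)
    assume "s r = []"
    then show ?thesis using loop_step.hyps by simp
  next
    fix v v' s1
    assume "u = Suc (v + v')" "run P s v s1" "run (Loop r P) s1 v' s''"
    then show ?thesis using loop_step.IH by blast
  qed
qed

text \<open>Input and output: the string is on stack \<open>0\<close>, the number is on stack \<open>1\<close> in unary.\<close>

definition load :: "bool list \<Rightarrow> nat \<Rightarrow> stacks" where
  "load x k = (\<lambda>_. [])(0 := x, 1 := replicate k True)"

definition computable :: "(nat \<Rightarrow> nat) \<Rightarrow> bool" where
  "computable f \<longleftrightarrow> (\<exists>P. \<forall>n. \<exists>t s. run P (load [] n) t s \<and> s 1 = replicate (f n) True)"


section \<open>W[1]-hardness\<close>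

definition fpt_reducible :: "pproblem \<Rightarrow> pproblem \<Rightarrow> bool" where
  "fpt_reducible Q Q' \<longleftrightarrow> (\<exists>P f g c. computable f \<and> computable g \<and>
     (\<forall>x k. \<exists>t s k'. run P (load x k) t s \<and> s 1 = replicate k' True \<and>
        t \<le> f k * (length x + 1) ^ c \<and> k' \<le> g k \<and>
        ((x, k) \<in> Q \<longleftrightarrow> (s 0, k') \<in> Q')))"

text \<open>W[1] as defined by Flum and Grohe (Parameterized Complexity Theory, Chapter 5): the closure
  under fpt-reductions of the problems p-WD-\<open>\<phi>\<close> for \<open>\<phi>(X) \<in> \<Pi>\<^sub>1\<close>, where \<open>X\<close> is a relation
  variable of arbitrary arity and the task is to find a solution with exactly \<open>k\<close> tuples.\<close>

definition p_WD_Pi1 :: "pproblem set" where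
  "p_WD_Pi1 = {encode_problem V (p_models (=) s V (replicate l QAll, a)) |V s l a.
     vocabulary V \<and> 0 < s \<and> sentence (V @ [s]) (replicate l QAll, a)}"

definition W1 :: "pproblem set" where
  "W1 = {Q. \<exists>Q'\<in>p_WD_Pi1. fpt_reducible Q Q'}"

definition W1_hard :: "pproblem \<Rightarrow> bool" where
  "W1_hard Q \<longleftrightarrow> (\<forall>Q'\<in>W1. fpt_reducible Q' Q)"


section \<open>Circuits and para-\<open>AC\<^sup>0\<close>\<close>

text \<open>A circuit is a directed acyclic graph, given as a topologically sorted list of gates that
  refer to their predecessors by position; the last gate is the output.\<close>

datatype gate = GInput nat | GNot nat | GAnd "nat list" | GOr "nat list"

type_synonym circuit = "gate list"

primrec wf_gate :: "nat \<Rightarrow> nat \<Rightarrow> gate \<Rightarrow> bool" where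
  "wf_gate n i (GInput j) \<longleftrightarrow> j < n"
| "wf_gate n i (GNot j) \<longleftrightarrow> j < i"
| "wf_gate n i (GAnd js) \<longleftrightarrow> (\<forall>j\<in>set js. j < i)"
| "wf_gate n i (GOr js) \<longleftrightarrow> (\<forall>j\<in>set js. j < i)"

definition wf_circuit :: "nat \<Rightarrow> circuit \<Rightarrow> bool" where
  "wf_circuit n c \<longleftrightarrow> c \<noteq> [] \<and> (\<forall>i<length c. wf_gate n i (c ! i))"

primrec gate_val :: "bool list \<Rightarrow> bool list \<Rightarrow> gate \<Rightarrow> bool" where
  "gate_val x v (GInput j) = x ! j"
| "gate_val x v (GNot j) = (\<not> v ! j)"
| "gate_val x v (GAnd js) = (\<forall>j\<in>set js. v ! j)"
| "gate_val x v (GOr js) = (\<exists>j\<in>set js. v ! j)"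

definition gate_vals :: "bool list \<Rightarrow> circuit \<Rightarrow> bool list" where
  "gate_vals x c = foldl (\<lambda>v g. v @ [gate_val x v g]) [] c"

definition accepts :: "circuit \<Rightarrow> bool list \<Rightarrow> bool" where
  "accepts c x \<longleftrightarrow> last (gate_vals x c)"

primrec gate_depth :: "nat list \<Rightarrow> gate \<Rightarrow> nat" where
  "gate_depth d (GInput j) = 0"
| "gate_depth d (GNot j) = Suc (d ! j)"
| "gate_depth d (GAnd js) = Suc (Max (insert 0 ((!) d ` set js)))"
| "gate_depth d (GOr js) = Suc (Max (insert 0 ((!) d ` set js)))"

definition gate_depths :: "circuit \<Rightarrow> nat list" where
  "gate_depths c = foldl (\<lambda>d g. d @ [gate_depth d g]) [] c"

definition depth :: "circuit \<Rightarrow> nat" where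
  "depth c = Max (set (gate_depths c))"

definition para_AC0 :: "pproblem set" where
  "para_AC0 = {Q. \<exists>Cs f c d. computable f \<and>
     (\<forall>n k. wf_circuit n (Cs n k) \<and> length (Cs n k) \<le> f k * (n + 1) ^ c \<and>
        depth (Cs n k) \<le> d) \<and>
     (\<forall>x k. (x, k) \<in> Q \<longleftrightarrow> accepts (Cs (length x) k) x)}"

end

theory Submission
  imports Defs
begin

text \<open>Membership in para-\<open>AC\<^sup>0\<close>. For a prefix \<open>e\<^sup>ma\<close> guess the existentially quantified elements and which
  of them are in \<open>X\<close>. Every other element can then decide independently of the others whether it may be in
  \<open>X\<close> and whether it may be outside \<open>X\<close>, so it remains to test that no element is left without a choice and
  that at least \<open>k\<close> elements may be in \<open>X\<close>. The latter is a threshold test: \<open>k\<close> distinct numbers are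
  separated by \<open>k\<close> of their bits, and \<open>(log n)\<^sup>k \<le> k\<^sup>k \<cdot> 2n\<close>.

  Hardness. Let \<open>\<phi>(X)\<close> be universal, with \<open>X\<close> occurring fewer than \<open>D\<close> times. For a set of tuples
  \<open>c\<^sub>0, \<dots>, c\<^sub>k\<^sub>-\<^sub>1\<close> the number of assignments that satisfy the matrix is a sum of \<open>(k + 1)\<^sup>D\<close> weighted counts, each
  of which depends on at most \<open>D\<close> of the \<open>c\<^sub>i\<close>, because the arithmetized matrix is affine in each occurrence
  of \<open>X\<close>. The tuples of \<open>c\<^sub>i\<close> relevant for a summand, together with the partial sum before it, are the vertices of a
  graph of polynomial size, whose independent sets of size \<open>(k + 1)\<^sup>D\<close> are the correct computations of the
  total. This is a polynomial time reduction to the independent set problem, which is expressible with the pattern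
  \<open>aa\<close> and, on incidence graphs, with the pattern \<open>ae\<close>. Running times are obtained from a language of
  terms over unary numbers whose values are bounded polynomially.\<close>

section \<open>Stack programs with running time bounds\<close>

text \<open>The class \<open>W1\<close> is generated by all universal \<open>\<phi>(X)\<close> with
  \<open>X\<close> of any arity, so hardness has to be derived from an arbitrary such formula and
  not from one known complete problem. The obstacle is that the truth of \<open>\<phi>\<close> at
  one assignment may depend on all \<open>k\<close> tuples, whereas a vertex of a polynomial-size
  graph can record only a number of tuples independent of \<open>k\<close>. Counting instead of
  testing removes this, because a sum can be checked one local summand at a time. Some weights of
  the expansion are negative. All sums are therefore taken modulo \<open>m + 1\<close>, where
  \<open>m\<close> is the number of assignments: the true count lies between 0 and \<open>m\<close>,
  so its residue determines it, and \<open>1 - k\<close> is represented by the natural number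
  \<open>1 + k * m\<close>. As \<open>D\<close> depends on the formula alone, the reduction is
  polynomial in \<open>k\<close> too, and terms without calls suffice for it; calls serve the
  computable bounds in compositions of reductions and in circuit sizes. Circuit families are
  nonuniform, hence no program that constructs circuits has to be built.\<close>

definition runb :: "prog \<Rightarrow> stacks \<Rightarrow> nat \<Rightarrow> stacks \<Rightarrow> bool" where
  "runb P s b s' \<longleftrightarrow> (\<exists>t\<le>b. run P s t s')"

lemma runb_mono: "runb P s b s' \<Longrightarrow> b \<le> b' \<Longrightarrow> runb P s b' s'"
  unfolding runb_def using le_trans by blast

lemma runb_cong: "runb P s b s' \<Longrightarrow> s' = s'' \<Longrightarrow> b \<le> b' \<Longrightarrow> runb P s b' s''"
  using runb_mono by blast

lemma runb_Push: "1 \<le> b \<Longrightarrow> s' = s(r := v # s r) \<Longrightarrow> runb (Push r v) s b s'"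
  unfolding runb_def using run.push by blast

lemma runb_Pop: "1 \<le> b \<Longrightarrow> s' = s(r := tl (s r)) \<Longrightarrow> runb (Pop r) s b s'"
  unfolding runb_def using run.pop by blast

lemma runb_Seq:
  "runb P s b s' \<Longrightarrow> runb P' s' b' s'' \<Longrightarrow> b + b' \<le> c \<Longrightarrow> runb (Seq P P') s c s''"
  unfolding runb_def by (meson add_le_mono le_trans run.seq)

lemma runb_Branch_empty: "s r = [] \<Longrightarrow> runb P0 s b s' \<Longrightarrow> Suc b \<le> c \<Longrightarrow> runb (Branch r P0 P1 P2) s c s'"
  unfolding runb_def by (meson Suc_le_mono le_trans run.branch_empty)

lemma runb_Branch_False:
  "s r = False # w \<Longrightarrow> runb P1 s b s' \<Longrightarrow> Suc b \<le> c \<Longrightarrow> runb (Branch r P0 P1 P2) s c s'"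
  unfolding runb_def by (meson Suc_le_mono le_trans run.branch_False)

lemma runb_Branch_True:
  "s r = True # w \<Longrightarrow> runb P2 s b s' \<Longrightarrow> Suc b \<le> c \<Longrightarrow> runb (Branch r P0 P1 P2) s c s'"
  unfolding runb_def by (meson Suc_le_mono le_trans run.branch_True)

text \<open>The states after each round are supplied as \<open>\<sigma>\<close>, which replaces a
  loop invariant. The bound may vary with the round, as it does in \<open>TSum\<close>, where the
  cost of the body depends on the index.\<close>

lemma runb_Loop_sum:
  assumes "\<And>j. j < n \<Longrightarrow> \<sigma> j r \<noteq> []" "\<And>j. j < n \<Longrightarrow> runb P (\<sigma> j) (b j) (\<sigma> (Suc j))" "\<sigma> n r = []"
  shows "runb (Loop r P) (\<sigma> 0) ((\<Sum>j<n. b j + 1) + 1) (\<sigma> n)"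
  using assms
proof (induction n arbitrary: \<sigma> b)
  case 0
  then show ?case unfolding runb_def using run.loop_end by auto
next
  case (Suc n)
  have "runb (Loop r P) ((\<lambda>j. \<sigma> (Suc j)) 0) ((\<Sum>j<n. (\<lambda>j. b (Suc j)) j + 1) + 1) ((\<lambda>j. \<sigma> (Suc j)) n)"
    by (rule Suc.IH) (use Suc.prems in auto)
  then obtain t' where t': "t' \<le> (\<Sum>j<n. b (Suc j) + 1) + 1" "run (Loop r P) (\<sigma> (Suc 0)) t' (\<sigma> (Suc n))"
    unfolding runb_def by auto
  obtain t where t: "t \<le> b 0" "run P (\<sigma> 0) t (\<sigma> (Suc 0))"
    using Suc.prems(2)[of 0] unfolding runb_def by auto
  have "run (Loop r P) (\<sigma> 0) (Suc (t + t')) (\<sigma> (Suc n))"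
    using run.loop_step[OF _ t(2) t'(2)] Suc.prems(1)[of 0] by simp
  moreover have "Suc (t + t') \<le> (\<Sum>j<Suc n. b j + 1) + 1"
    using t(1) t'(1) by (subst sum.lessThan_Suc_shift) simp
  ultimately show ?case unfolding runb_def by blast
qed

lemma runb_Loop:
  assumes "\<And>j. j < n \<Longrightarrow> \<sigma> j r \<noteq> []" "\<And>j. j < n \<Longrightarrow> runb P (\<sigma> j) b (\<sigma> (Suc j))" "\<sigma> n r = []"
    "s = \<sigma> 0" "s' = \<sigma> n" "n * (b + 1) + 1 \<le> c"
  shows "runb (Loop r P) s c s'"
  using runb_Loop_sum[of n \<sigma> r P "\<lambda>_. b"] assms runb_mono by simp

definition skip :: "nat \<Rightarrow> prog" where "skip r = Seq (Push r True) (Pop r)"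

lemma runb_skip: "2 \<le> b \<Longrightarrow> s' = s \<Longrightarrow> runb (skip r) s b s'"
  unfolding skip_def by (rule runb_Seq[OF runb_Push[OF order_refl refl] runb_Pop[OF order_refl]]) auto

definition clear :: "nat \<Rightarrow> prog" where "clear r = Loop r (Pop r)"

lemma runb_clear: "2 * length (s r) + 1 \<le> b \<Longrightarrow> s' = s(r := []) \<Longrightarrow> runb (clear r) s b s'"
  unfolding clear_def
  by (rule runb_Loop[where n = "length (s r)" and \<sigma> = "\<lambda>j. s(r := drop j (s r))" and b = 1])
    (auto intro!: runb_Pop simp: tl_drop drop_Suc)

primrec clears :: "nat list \<Rightarrow> prog" where
  "clears [] = skip 0"
| "clears (j # js) = Seq (clear j) (clears js)"

lemma runb_clears:
  "(\<And>j. j \<in> set js \<Longrightarrow> length (s j) \<le> m) \<Longrightarrow> length js * (2 * m + 1) + 2 \<le> b \<Longrightarrow>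
    s' = (\<lambda>j. if j \<in> set js then [] else s j) \<Longrightarrow> runb (clears js) s b s'"
proof (induction js arbitrary: s b)
  case Nil
  then show ?case by (auto intro: runb_skip)
next
  case (Cons j js)
  have "runb (clear j) s (2 * m + 1) (s(j := []))"
    by (rule runb_clear) (use Cons.prems(1)[of j] in auto)
  moreover have "runb (clears js) (s(j := [])) (length js * (2 * m + 1) + 2) s'"
    by (rule Cons.IH) (use Cons.prems in \<open>auto simp: fun_eq_iff\<close>)
  ultimately show ?case
    unfolding clears.simps by (rule runb_Seq) (use Cons.prems(2) in simp)
qed

definition mv :: "nat \<Rightarrow> nat \<Rightarrow> prog" where
  "mv r q = Loop r (Seq (Pop r) (Push q True))"

lemma runb_mv:
  assumes "r \<noteq> q" "s r = replicate n True" "3 * n + 1 \<le> b" "s' = s(r := [], q := replicate n True @ s q)"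
  shows "runb (mv r q) s b s'"
  unfolding mv_def
  by (rule runb_Loop[where n = n and b = 2 and
        \<sigma> = "\<lambda>j. s(r := replicate (n - j) True, q := replicate j True @ s q)"])
    (use assms in \<open>auto intro!: runb_Seq[OF runb_Pop[OF order_refl refl] runb_Push[OF order_refl refl]]
      simp: fun_eq_iff replicate_app_Cons_same\<close>,
     auto intro!: runb_cong[OF runb_Seq[OF runb_Pop[OF order_refl refl] runb_Push[OF order_refl refl] order_refl]]
      simp: fun_eq_iff)

text \<open>Doing nothing on an empty stack makes seeking past the end of the input in
  \<open>TBit\<close> harmless.\<close>

definition move_bit :: "nat \<Rightarrow> nat \<Rightarrow> prog" where
  "move_bit r q = Branch r (skip q) (Seq (Pop r) (Push q False)) (Seq (Pop r) (Push q True))"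

lemma runb_move_bit:
  assumes "r \<noteq> q" "3 \<le> b" "s' = (if s r = [] then s else s(r := tl (s r), q := hd (s r) # s q))"
  shows "runb (move_bit r q) s b s'"
proof (cases "s r")
  case Nil
  then show ?thesis unfolding move_bit_def
    by (intro runb_Branch_empty[where b = 2] runb_skip) (use assms in auto)
next
  case (Cons v w)
  have "runb (Seq (Pop r) (Push q v)) s 2 s'"
    by (rule runb_Seq[OF runb_Pop[OF order_refl refl] runb_Push[OF order_refl refl, THEN runb_cong]])
      (use assms Cons in \<open>auto simp: fun_eq_iff\<close>)
  then show ?thesis
    using assms Cons unfolding move_bit_def
    by (cases v) (auto intro: runb_Branch_True[where b = 2] runb_Branch_False[where b = 2])
qed

definition move_bits :: "nat \<Rightarrow> nat \<Rightarrow> prog" where "move_bits r q = Loop r (move_bit r q)"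

lemma runb_move_bits:
  assumes "r \<noteq> q" "4 * length (s r) + 1 \<le> b" "s' = s(r := [], q := rev (s r) @ s q)"
  shows "runb (move_bits r q) s b s'"
  unfolding move_bits_def
  by (rule runb_Loop[where n = "length (s r)" and b = 3 and
        \<sigma> = "\<lambda>j. s(r := drop j (s r), q := rev (take j (s r)) @ s q)"])
   (use assms in \<open>auto intro!: runb_move_bit simp: fun_eq_iff tl_drop drop_Suc hd_drop_conv_nth take_Suc_conv_app_nth\<close>)

section \<open>Growth, locality and relocation of stacks\<close>

lemma run_length: "run P s t s' \<Longrightarrow> length (s' i) \<le> length (s i) + t"
  by (induction rule: run.induct) (auto split: if_splits)

primrec prog_bound :: "prog \<Rightarrow> nat" where
  "prog_bound (Push r b) = Suc r"
| "prog_bound (Pop r) = Suc r"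
| "prog_bound (Seq P Q) = max (prog_bound P) (prog_bound Q)"
| "prog_bound (Branch r P0 P1 P2) = Max {Suc r, prog_bound P0, prog_bound P1, prog_bound P2}"
| "prog_bound (Loop r P) = max (Suc r) (prog_bound P)"

lemma run_untouched: "run P s t s' \<Longrightarrow> prog_bound P \<le> i \<Longrightarrow> s' i = s i"
  by (induction rule: run.induct) auto

primrec shift :: "nat \<Rightarrow> prog \<Rightarrow> prog" where
  "shift d (Push r b) = Push (d + r) b"
| "shift d (Pop r) = Pop (d + r)"
| "shift d (Seq P Q) = Seq (shift d P) (shift d Q)"
| "shift d (Branch r P0 P1 P2) = Branch (d + r) (shift d P0) (shift d P1) (shift d P2)"
| "shift d (Loop r P) = Loop (d + r) (shift d P)"

text \<open>The lower \<open>d\<close> stacks are an untouched frame \<open>S\<close>, so a program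
  written for stacks 0, 1, ... can be called as a subroutine on the scratch stacks of another
  one.\<close>

lemma run_shift:
  "run P s t s' \<Longrightarrow>
    run (shift d P) (\<lambda>i. if i < d then S i else s (i - d)) t (\<lambda>i. if i < d then S i else s' (i - d))"
proof (induction rule: run.induct)
  case (push r b s)
  show ?case
    using run.push[of "d + r" b "\<lambda>i. if i < d then S i else s (i - d)"]
    by simp (erule back_subst[of "run _ _ _"], auto simp: fun_eq_iff)
next
  case (pop r s)
  show ?case
    using run.pop[of "d + r" "\<lambda>i. if i < d then S i else s (i - d)"]
    by simp (erule back_subst[of "run _ _ _"], auto simp: fun_eq_iff)
next
  case (loop_end s r P)
  then show ?case by (simp add: run.loop_end del: One_nat_def)
qed (auto intro: run.intros)

subsection \<open>Terms over unary numbers\<close>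

text \<open>Variables are de Bruijn indices. \<open>TApp P f T t\<close> calls a program \<open>P\<close> that computes \<open>f\<close> in
  time \<open>T\<close>; terms without such calls denote functions of polynomial growth.\<close>

datatype tm =
    TVar nat
  | TConst nat
  | TLen
  | TAdd tm tm
  | TMul tm tm
  | TSub tm tm
  | TSum tm tm
  | TBit tm
  | TApp prog "nat \<Rightarrow> nat" "nat \<Rightarrow> nat" tm

primrec eval :: "tm \<Rightarrow> bool list \<Rightarrow> (nat \<Rightarrow> nat) \<Rightarrow> nat" where
  "eval (TVar i) x e = e i"
| "eval (TConst c) x e = c"
| "eval TLen x e = length x"
| "eval (TAdd a b) x e = eval a x e + eval b x e"
| "eval (TMul a b) x e = eval a x e * eval b x e"
| "eval (TSub a b) x e = eval a x e - eval b x e"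
| "eval (TSum a b) x e = (\<Sum>i<eval a x e. eval b x (case_nat i e))"
| "eval (TBit a) x e = of_bool (eval a x e < length x \<and> x ! eval a x e)"
| "eval (TApp P f T a) x e = f (eval a x e)"

text \<open>The flag forbids calls.\<close>

primrec wf_tm :: "bool \<Rightarrow> tm \<Rightarrow> bool" where
  "wf_tm z (TVar i) \<longleftrightarrow> True"
| "wf_tm z (TConst c) \<longleftrightarrow> True"
| "wf_tm z TLen \<longleftrightarrow> True"
| "wf_tm z (TAdd a b) \<longleftrightarrow> wf_tm z a \<and> wf_tm z b"
| "wf_tm z (TMul a b) \<longleftrightarrow> wf_tm z a \<and> wf_tm z b"
| "wf_tm z (TSub a b) \<longleftrightarrow> wf_tm z a \<and> wf_tm z b"
| "wf_tm z (TSum a b) \<longleftrightarrow> wf_tm z a \<and> wf_tm z b"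
| "wf_tm z (TBit a) \<longleftrightarrow> wf_tm z a"
| "wf_tm z (TApp P f T a) \<longleftrightarrow> \<not> z \<and> wf_tm z a \<and>
    (\<forall>n. \<exists>s. runb P (load [] n) (T n) s \<and> s 1 = replicate (f n) True)"

lemma wf_tm_mono: "wf_tm z t \<Longrightarrow> wf_tm False t"
  by (induction t) auto

primrec pushes :: "nat \<Rightarrow> nat \<Rightarrow> prog" where
  "pushes 0 r = skip r"
| "pushes (Suc c) r = Seq (Push r True) (pushes c r)"

text \<open>\<open>compile t \<rho> d r\<close> pushes the value of \<open>t\<close> in unary on stack \<open>r\<close>. Variable \<open>i\<close> is stored on stack
  \<open>\<rho> i\<close>, the input string on stack \<open>0\<close>; stack \<open>2\<close> and all stacks from \<open>d\<close> on serve as scratch space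
  and are empty before and after.\<close>

primrec compile :: "tm \<Rightarrow> (nat \<Rightarrow> nat) \<Rightarrow> nat \<Rightarrow> nat \<Rightarrow> prog" where
  "compile (TVar i) \<rho> d r = Seq (mv (\<rho> i) d)
     (Loop d (Seq (Pop d) (Seq (Push (\<rho> i) True) (Push r True))))"
| "compile (TConst c) \<rho> d r = pushes c r"
| "compile TLen \<rho> d r = Seq (Loop 0 (Seq (move_bit 0 2) (Push r True))) (move_bits 2 0)"
| "compile (TAdd a b) \<rho> d r = Seq (compile a \<rho> d r) (compile b \<rho> d r)"
| "compile (TMul a b) \<rho> d r = Seq (compile a \<rho> (d + 1) d) (Loop d (Seq (Pop d) (compile b \<rho> (d + 1) r)))"
| "compile (TSub a b) \<rho> d r = Seq (compile a \<rho> (d + 1) d) (Seq (compile b \<rho> (d + 2) (d + 1))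
     (Seq (Loop (d + 1) (Seq (Pop (d + 1)) (Pop d))) (mv d r)))"
| "compile (TSum a b) \<rho> d r = Seq (compile a \<rho> (d + 1) d)
     (Seq (Loop d (Seq (Pop d) (Seq (compile b (case_nat (d + 1) \<rho>) (d + 2) r) (Push (d + 1) True))))
       (clear (d + 1)))"
| "compile (TBit a) \<rho> d r = Seq (compile a \<rho> (d + 1) d) (Seq (Loop d (Seq (Pop d) (move_bit 0 2)))
     (Seq (Branch 0 (skip r) (skip r) (Push r True)) (move_bits 2 0)))"
| "compile (TApp P f T a) \<rho> d r = Seq (compile a \<rho> (d + 2) (d + 1)) (Seq (shift d P)
     (Seq (mv (d + 1) r) (clears (map ((+) d) [0..<prog_bound P]))))"

text \<open>The product in the \<open>TApp\<close> clause pays for wiping the stacks that the called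
  program leaves behind; each has length at most the argument plus the running time, by
  \<open>run_length\<close>.\<close>

primrec cost :: "tm \<Rightarrow> bool list \<Rightarrow> (nat \<Rightarrow> nat) \<Rightarrow> nat" where
  "cost (TVar i) x e = 7 * e i + 2"
| "cost (TConst c) x e = c + 2"
| "cost TLen x e = 9 * length x + 2"
| "cost (TAdd a b) x e = cost a x e + cost b x e"
| "cost (TMul a b) x e = cost a x e + eval a x e * (cost b x e + 2) + 1"
| "cost (TSub a b) x e = cost a x e + cost b x e + 3 * eval a x e + 3 * eval b x e + 2"
| "cost (TSum a b) x e = cost a x e +
     (\<Sum>i<eval a x e. cost b x (case_nat i e) + 3) + 2 * eval a x e + 2"
| "cost (TBit a) x e = cost a x e + 5 * eval a x e + 4 * length x + 5"
| "cost (TApp P f T a) x e = (let n = eval a x e in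
     cost a x e + T n + 3 * f n + prog_bound P * (2 * (n + T n) + 1) + 3)"

text \<open>\<open>r\<close> differs from all variable stacks, so pushing a result never changes a
  variable. Variables may share a stack; the complete programs keep all variables but the relevant
  ones on one empty stack, with value 0.\<close>

definition invar :: "stacks \<Rightarrow> bool list \<Rightarrow> (nat \<Rightarrow> nat) \<Rightarrow> (nat \<Rightarrow> nat) \<Rightarrow> nat \<Rightarrow> nat \<Rightarrow> bool" where
  "invar s x e \<rho> d r \<longleftrightarrow> 3 \<le> d \<and> s 0 = x \<and> s 2 = [] \<and> (\<forall>j\<ge>d. s j = []) \<and>
     (\<forall>i. \<rho> i < d \<and> \<rho> i \<noteq> 0 \<and> \<rho> i \<noteq> 2 \<and> \<rho> i \<noteq> r \<and> s (\<rho> i) = replicate (e i) True) \<and>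
     r < d \<and> r \<noteq> 0 \<and> r \<noteq> 2"

lemma invar_out: "invar s x e \<rho> d r \<Longrightarrow> invar (s(r := w)) x e \<rho> d r"
  unfolding invar_def by auto

lemma invar_temp: "invar s x e \<rho> d r \<Longrightarrow> invar s x e \<rho> (Suc d) d"
  unfolding invar_def by (auto simp: less_SucI)

lemma invar_upd: "invar s x e \<rho> d r \<Longrightarrow> invar (s(d := w)) x e \<rho> (Suc d) r"
  unfolding invar_def by (auto simp: less_SucI)

lemma invar_le: "invar s x e \<rho> d r \<Longrightarrow> d \<le> d' \<Longrightarrow> invar s x e \<rho> d' r"
  unfolding invar_def by (auto intro: less_le_trans)

lemma runb_pushes: "c + 2 \<le> b \<Longrightarrow> s' = s(r := replicate c True @ s r) \<Longrightarrow> runb (pushes c r) s b s'"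
proof (induction c arbitrary: s b)
  case 0
  then show ?case by (auto intro: runb_skip)
next
  case (Suc c)
  have "runb (pushes c r) (s(r := True # s r)) (c + 2) s'"
    by (rule Suc.IH) (use Suc.prems in \<open>auto simp: replicate_app_Cons_same\<close>)
  then show ?case
    unfolding pushes.simps
    by (rule runb_Seq[OF runb_Push[OF order_refl refl]]) (use Suc.prems in auto)
qed

text \<open>Values are pushed on top of \<open>r\<close> rather than stored, so addition is
  sequencing, and sums and products merely repeat the code of the body.\<close>

lemma compile_correct:
  "wf_tm False t \<Longrightarrow> invar s x e \<rho> d r \<Longrightarrow>
    runb (compile t \<rho> d r) s (cost t x e) (s(r := replicate (eval t x e) True @ s r))"
proof (induction t arbitrary: s e \<rho> d r)
  case (TVar i)
  define n where "n = e i"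
  have I: "\<rho> i < d" "\<rho> i \<noteq> r" "s (\<rho> i) = replicate n True" "s d = []" "r < d"
    using TVar.prems unfolding invar_def n_def by auto
  let ?s = "s(\<rho> i := [], d := replicate n True)"
  have "runb (mv (\<rho> i) d) s (3 * n + 1) ?s"
    by (rule runb_mv) (use I in auto)
  moreover have "runb (Loop d (Seq (Pop d) (Seq (Push (\<rho> i) True) (Push r True)))) ?s (4 * n + 1)
    (s(r := replicate n True @ s r))"
    by (rule runb_Loop[where n = n and b = 3 and
        \<sigma> = "\<lambda>j. s(\<rho> i := replicate j True, d := replicate (n - j) True, r := replicate j True @ s r)"])
      (use I in \<open>auto intro!: runb_Seq[OF runb_Pop[OF order_refl refl]
        runb_Seq[OF runb_Push[OF order_refl refl] runb_Push[OF order_refl] order_refl]]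
        simp: fun_eq_iff replicate_app_Cons_same\<close>)
  ultimately show ?case
    unfolding compile.simps cost.simps eval.simps n_def[symmetric] by (rule runb_Seq) simp
next
  case (TConst c)
  show ?case by (simp only: compile.simps cost.simps eval.simps) (rule runb_pushes[OF order_refl refl])
next
  case TLen
  have I: "s 0 = x" "s 2 = []" "r \<noteq> 0" "r \<noteq> 2"
    using TLen.prems unfolding invar_def by auto
  let ?n = "length x"
  let ?s = "s(0 := [], 2 := rev x, r := replicate ?n True @ s r)"
  have "runb (Loop 0 (Seq (move_bit 0 2) (Push r True))) s (5 * ?n + 1) ?s"
    by (rule runb_Loop[where n = ?n and b = 4 and
        \<sigma> = "\<lambda>j. s(0 := drop j x, 2 := rev (take j x), r := replicate j True @ s r)"])
      (use I in \<open>auto intro!: runb_Seq[OF runb_move_bit[OF _ order_refl refl] runb_Push[OF order_refl]]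
        simp: fun_eq_iff tl_drop drop_Suc hd_drop_conv_nth take_Suc_conv_app_nth\<close>)
  moreover have "runb (move_bits 2 0) ?s (4 * ?n + 1) (s(r := replicate ?n True @ s r))"
    by (rule runb_move_bits) (use I in \<open>auto simp: fun_eq_iff\<close>)
  ultimately show ?case
    unfolding compile.simps cost.simps eval.simps by (rule runb_Seq) simp
next
  case (TAdd a b)
  let ?s = "s(r := replicate (eval a x e) True @ s r)"
  have "runb (compile a \<rho> d r) s (cost a x e) ?s"
    by (rule TAdd.IH) (use TAdd.prems in auto)
  moreover have "runb (compile b \<rho> d r) ?s (cost b x e) (?s(r := replicate (eval b x e) True @ ?s r))"
    using TAdd.prems by (intro TAdd.IH invar_out) simp_all
  ultimately show ?case
    unfolding compile.simps cost.simps eval.simps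
    by (rule runb_Seq[THEN runb_cong])
      (auto simp: replicate_add[symmetric] add.commute simp flip: append_assoc)
next
  case (TMul a b)
  let ?n = "eval a x e" and ?m = "eval b x e"
  have I: "s d = []" "r < d" using TMul.prems unfolding invar_def by auto
  let ?s = "s(d := replicate ?n True)"
  have "runb (compile a \<rho> (d + 1) d) s (cost a x e) (s(d := replicate ?n True @ s d))"
    by (rule TMul.IH) (use TMul.prems in \<open>auto intro: invar_temp\<close>)
  then have 1: "runb (compile a \<rho> (d + 1) d) s (cost a x e) ?s" using I by simp
  define \<sigma> where "\<sigma> = (\<lambda>j. s(d := replicate (?n - j) True, r := replicate (j * ?m) True @ s r))"
  have body: "runb (Seq (Pop d) (compile b \<rho> (d + 1) r)) (\<sigma> j) (cost b x e + 1) (\<sigma> (Suc j))"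
    if "j < ?n" for j
  proof -
    let ?t = "s(r := replicate (j * ?m) True @ s r, d := replicate (?n - Suc j) True)"
    have "runb (Pop d) (\<sigma> j) 1 ?t"
      by (rule runb_Pop) (use I that in \<open>auto simp: \<sigma>_def fun_eq_iff\<close>)
    moreover have "runb (compile b \<rho> (d + 1) r) ?t (cost b x e) (?t(r := replicate ?m True @ ?t r))"
    proof (rule TMul.IH)
      show "wf_tm False b" using TMul.prems by simp
      show "invar ?t x e \<rho> (d + 1) r"
        unfolding Suc_eq_plus1[symmetric] by (rule invar_upd[OF invar_out[OF TMul.prems(2)]])
    qed
    ultimately show ?thesis
      by (rule runb_Seq[THEN runb_cong])
        (use I in \<open>auto simp: \<sigma>_def fun_eq_iff replicate_add\<close>)
  qed
  have "runb (Loop d (Seq (Pop d) (compile b \<rho> (d + 1) r))) ?s (?n * (cost b x e + 2) + 1)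
     (s(r := replicate (?n * ?m) True @ s r))"
    by (rule runb_Loop[where n = ?n and \<sigma> = \<sigma> and b = "cost b x e + 1"])
      (use I body in \<open>auto simp: \<sigma>_def fun_eq_iff\<close>)
  with 1 show ?case
    unfolding compile.simps cost.simps eval.simps by (rule runb_Seq) simp
next
  case (TSub a b)
  let ?n = "eval a x e" and ?m = "eval b x e"
  have I: "s d = []" "s (Suc d) = []" "r < d" using TSub.prems unfolding invar_def by auto
  let ?s = "s(d := replicate ?n True)"
  let ?t = "s(d := replicate ?n True, d + 1 := replicate ?m True)"
  let ?u = "s(d := replicate (?n - ?m) True)"
  have "runb (compile a \<rho> (d + 1) d) s (cost a x e) (s(d := replicate ?n True @ s d))"
    by (rule TSub.IH) (use TSub.prems in \<open>auto intro: invar_temp\<close>)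
  then have 1: "runb (compile a \<rho> (d + 1) d) s (cost a x e) ?s" using I by simp
  have "runb (compile b \<rho> (d + 2) (d + 1)) ?s (cost b x e) (?s(d + 1 := replicate ?m True @ ?s (d + 1)))"
  proof (rule TSub.IH(2))
    show "wf_tm False b" using TSub.prems by simp
    show "invar ?s x e \<rho> (d + 2) (d + 1)"
      unfolding add_2_eq_Suc' Suc_eq_plus1[symmetric] by (rule invar_temp[OF invar_upd[OF TSub.prems(2)]])
  qed
  then have 2: "runb (compile b \<rho> (d + 2) (d + 1)) ?s (cost b x e) ?t" using I by simp
  have 3: "runb (Loop (d + 1) (Seq (Pop (d + 1)) (Pop d))) ?t (3 * ?m + 1) ?u"
    by (rule runb_Loop[where n = ?m and b = 2 and
        \<sigma> = "\<lambda>j. s(d := replicate (?n - j) True, d + 1 := replicate (?m - j) True)"])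
      (use I in \<open>auto intro!: runb_Seq[OF runb_Pop[OF order_refl refl] runb_Pop[OF order_refl]]
        simp: fun_eq_iff\<close>)
  have 4: "runb (mv d r) ?u (3 * ?n + 1) (s(r := replicate (?n - ?m) True @ s r))"
    by (rule runb_mv[where n = "?n - ?m"]) (use I in \<open>auto simp: fun_eq_iff\<close>)
  show ?case
    unfolding compile.simps cost.simps eval.simps
    by (rule runb_Seq[OF 1 runb_Seq[OF 2 runb_Seq[OF 3 4 order_refl] order_refl]]) simp
next
  case (TSum a b)
  let ?n = "eval a x e"
  define g where "g = (\<lambda>i. eval b x (case_nat i e))"
  have I: "s d = []" "s (Suc d) = []" "r < d" using TSum.prems unfolding invar_def by auto
  let ?s = "s(d := replicate ?n True)"
  have "runb (compile a \<rho> (d + 1) d) s (cost a x e) (s(d := replicate ?n True @ s d))"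
    by (rule TSum.IH) (use TSum.prems in \<open>auto intro: invar_temp\<close>)
  then have 1: "runb (compile a \<rho> (d + 1) d) s (cost a x e) ?s" using I by simp
  \<comment> \<open>Stack \<open>d\<close> counts the remaining rounds down, while
    \<open>d + 1\<close> counts up and is at the same time the stack of the bound variable of
    \<open>b\<close>.\<close>
  define \<sigma> where "\<sigma> = (\<lambda>j. s(d := replicate (?n - j) True, d + 1 := replicate j True,
    r := replicate (\<Sum>i<j. g i) True @ s r))"
  have body: "runb (Seq (Pop d) (Seq (compile b (case_nat (d + 1) \<rho>) (d + 2) r) (Push (d + 1) True)))
     (\<sigma> j) (cost b x (case_nat j e) + 2) (\<sigma> (Suc j))" if "j < ?n" for j
  proof -
    let ?t = "s(r := replicate (\<Sum>i<j. g i) True @ s r, d := replicate (?n - Suc j) True,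
      d + 1 := replicate j True)"
    have 1: "runb (Pop d) (\<sigma> j) 1 ?t"
      by (rule runb_Pop) (use I that in \<open>auto simp: \<sigma>_def fun_eq_iff\<close>)
    have inv: "invar ?t x (case_nat j e) (case_nat (d + 1) \<rho>) (d + 2) r"
    proof -
      have \<rho>: "\<rho> i < d" "\<rho> i \<noteq> 0" "\<rho> i \<noteq> 2" "\<rho> i \<noteq> r" "s (\<rho> i) = replicate (e i) True" for i
        using TSum.prems(2) unfolding invar_def by auto
      have dr: "3 \<le> d" "r < d" using TSum.prems(2) unfolding invar_def by auto
      have "case_nat (d + 1) \<rho> i < d + 2 \<and> case_nat (d + 1) \<rho> i \<noteq> 0 \<and> case_nat (d + 1) \<rho> i \<noteq> 2 \<and>
          case_nat (d + 1) \<rho> i \<noteq> r \<and> ?t (case_nat (d + 1) \<rho> i) = replicate (case_nat j e i) True" for i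
      proof (cases i)
        case 0
        then show ?thesis using dr by simp
      next
        case (Suc i')
        have "\<rho> i' \<noteq> d" "\<rho> i' \<noteq> d + 1" "\<rho> i' < d + 2" using \<rho>(1)[of i'] by auto
        then show ?thesis using Suc \<rho>(2-5)[of i'] by simp
      qed
      then show ?thesis
        using TSum.prems(2) unfolding invar_def by auto
    qed
    have 2: "runb (compile b (case_nat (d + 1) \<rho>) (d + 2) r) ?t (cost b x (case_nat j e))
      (?t(r := replicate (g j) True @ ?t r))"
      unfolding g_def
    proof (rule TSum.IH(2))
      show "wf_tm False b" using TSum.prems by simp
    qed (rule inv[unfolded g_def])
    show ?thesis
      by (rule runb_Seq[OF 1 runb_Seq[OF 2 runb_Push[OF order_refl refl] order_refl], THEN runb_cong])
        (use I in \<open>auto simp: \<sigma>_def fun_eq_iff replicate_add add.commute simp flip: append_assoc\<close>)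
  qed
  have "runb (Loop d (Seq (Pop d) (Seq (compile b (case_nat (d + 1) \<rho>) (d + 2) r) (Push (d + 1) True))))
    (\<sigma> 0) ((\<Sum>i<?n. (cost b x (case_nat i e) + 2) + 1) + 1) (\<sigma> ?n)"
  proof (rule runb_Loop_sum)
    show "\<sigma> j d \<noteq> []" if "j < ?n" for j using that I by (simp add: \<sigma>_def)
    show "\<sigma> ?n d = []" using I by (simp add: \<sigma>_def)
  qed (rule body)
  then have 2: "runb (Loop d (Seq (Pop d) (Seq (compile b (case_nat (d + 1) \<rho>) (d + 2) r) (Push (d + 1) True))))
    ?s ((\<Sum>i<?n. cost b x (case_nat i e) + 3) + 1) (\<sigma> ?n)"
    by (rule back_subst[of "\<lambda>s. runb _ s _ _", OF runb_mono])
      (use I in \<open>auto simp: \<sigma>_def fun_eq_iff intro!: sum_mono\<close>)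
  have 3: "runb (clear (d + 1)) (\<sigma> ?n) (2 * ?n + 1) (s(r := replicate (\<Sum>i<?n. g i) True @ s r))"
    by (rule runb_clear) (use I in \<open>auto simp: \<sigma>_def fun_eq_iff\<close>)
  show ?case
    unfolding compile.simps cost.simps eval.simps g_def[symmetric]
    by (rule runb_Seq[OF 1 runb_Seq[OF 2 3 order_refl]]) simp
next
  case (TBit a)
  let ?n = "eval a x e"
  have I: "s d = []" "r < d" "s 0 = x" "s 2 = []" "r \<noteq> 0" "r \<noteq> 2" "3 \<le> d"
    using TBit.prems unfolding invar_def by auto
  let ?s = "s(d := replicate ?n True)"
  have "runb (compile a \<rho> (d + 1) d) s (cost a x e) (s(d := replicate ?n True @ s d))"
    by (rule TBit.IH) (use TBit.prems in \<open>auto intro: invar_temp\<close>)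
  then have 1: "runb (compile a \<rho> (d + 1) d) s (cost a x e) ?s" using I by simp
  \<comment> \<open>The first \<open>?n\<close> bits are parked in reverse on stack 2. For
    \<open>?n\<close> beyond the input, stack 0 becomes empty, which the branch below treats like a
    False bit.\<close>
  let ?t = "s(0 := drop ?n x, 2 := rev (take ?n x))"
  have 2: "runb (Loop d (Seq (Pop d) (move_bit 0 2))) ?s (5 * ?n + 1) ?t"
    by (rule runb_Loop[where n = ?n and b = 4 and
        \<sigma> = "\<lambda>j. s(d := replicate (?n - j) True, 0 := drop j x, 2 := rev (take j x))"])
      (use I in \<open>auto intro!: runb_Seq[OF runb_Pop[OF order_refl refl] runb_move_bit[OF _ order_refl]]
        simp: fun_eq_iff tl_drop drop_Suc hd_drop_conv_nth take_Suc_conv_app_nth\<close>)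
  let ?v = "of_bool (?n < length x \<and> x ! ?n)"
  let ?u = "?t(r := replicate ?v True @ s r)"
  have 3: "runb (Branch 0 (skip r) (skip r) (Push r True)) ?t 3 ?u"
  proof (cases "drop ?n x")
    case Nil
    then show ?thesis by (intro runb_Branch_empty[where b = 2] runb_skip) (use I in \<open>auto simp: fun_eq_iff\<close>)
  next
    case (Cons v w)
    then have "?n < length x" by (metis drop_all linorder_not_less list.distinct(1))
    with Cons have "x ! ?n = v" by (metis hd_drop_conv_nth list.sel(1))
    show ?thesis
    proof (cases v)
      case True
      show ?thesis
        by (rule runb_Branch_True[where w = w, OF _ runb_Push[OF order_refl refl, THEN runb_cong, OF _ order_refl]])
          (use I Cons True \<open>x ! ?n = v\<close> \<open>?n < length x\<close> in \<open>auto simp: fun_eq_iff\<close>)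
    next
      case False
      show ?thesis
        by (rule runb_Branch_False[where w = w, OF _ runb_skip[OF order_refl]])
          (use I Cons False \<open>x ! ?n = v\<close> in \<open>auto simp: fun_eq_iff\<close>)
    qed
  qed
  have 4: "runb (move_bits 2 0) ?u (4 * length x + 1) (s(r := replicate ?v True @ s r))"
    by (rule runb_move_bits) (use I in \<open>auto simp: fun_eq_iff\<close>)
  show ?case
    unfolding compile.simps cost.simps eval.simps
    by (rule runb_Seq[OF 1 runb_Seq[OF 2 runb_Seq[OF 3 4 order_refl] order_refl]]) simp
next
  case (TApp P f T a)
  let ?n = "eval a x e"
  have I: "s d = []" "s (d + 1) = []" "\<forall>j\<ge>d. s j = []" "r < d" using TApp.prems unfolding invar_def by auto
  let ?s = "s(d + 1 := replicate ?n True)"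
  have "runb (compile a \<rho> (d + 2) (d + 1)) s (cost a x e) (s(d + 1 := replicate ?n True @ s (d + 1)))"
    by (rule TApp.IH) (use TApp.prems in \<open>auto intro!: invar_temp elim: invar_le\<close>)
  then have 1: "runb (compile a \<rho> (d + 2) (d + 1)) s (cost a x e) ?s" using I by simp
  obtain s1 t where s1: "run P (load [] ?n) t s1" "t \<le> T ?n" "s1 1 = replicate (f ?n) True"
    using TApp.prems(1) unfolding wf_tm.simps runb_def by blast
  let ?t = "\<lambda>i. if i < d then s i else s1 (i - d)"
  \<comment> \<open>All stacks from \<open>d\<close> on are empty by \<open>invar\<close>, apart
    from the argument just computed, so the shifted initial state \<open>load [] ?n\<close>
    coincides with the current one.\<close>
  have "(\<lambda>i. if i < d then s i else load [] ?n (i - d)) = ?s"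
    using I unfolding load_def by (auto simp: fun_eq_iff)
  with run_shift[OF s1(1), of d s] have 2: "runb (shift d P) ?s (T ?n) ?t"
    unfolding runb_def using s1(2) by auto
  let ?u = "?t(d + 1 := [], r := replicate (f ?n) True @ s r)"
  have 3: "runb (mv (d + 1) r) ?t (3 * f ?n + 1) ?u"
    by (rule runb_mv[where n = "f ?n"]) (use I s1(3) in \<open>auto simp: fun_eq_iff\<close>)
  have len: "length (s1 i) \<le> ?n + T ?n" for i
    using run_length[OF s1(1), of i] s1(2) unfolding load_def by (auto split: if_splits)
  have empty: "s1 i = []" if "prog_bound P \<le> i" "i \<noteq> 1" for i
    using run_untouched[OF s1(1) that(1)] that(2) unfolding load_def by simp
  have 4: "runb (clears (map ((+) d) [0..<prog_bound P])) ?u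
     (prog_bound P * (2 * (?n + T ?n) + 1) + 2) (s(r := replicate (f ?n) True @ s r))"
  proof (rule runb_clears[where m = "?n + T ?n"])
    show "length (?u j) \<le> ?n + T ?n" if "j \<in> set (map ((+) d) [0..<prog_bound P])" for j
      using that len I by auto
    have "j = d + (j - d)" if "d \<le> j" for j using that by simp
    then show "s(r := replicate (f ?n) True @ s r) =
      (\<lambda>j. if j \<in> set (map ((+) d) [0..<prog_bound P]) then [] else ?u j)"
      using I empty by (auto simp: fun_eq_iff image_iff)
  qed simp
  show ?case
    unfolding compile.simps cost.simps eval.simps Let_def
    by (rule runb_Seq[OF 1 runb_Seq[OF 2 runb_Seq[OF 3 4 order_refl] order_refl]]) simp
qed

subsection \<open>Polynomial bounds\<close>

text \<open>One \<open>m\<close> bounds the input length and all variables, so that the index of a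
  sum can be treated as one more variable. With a base of at least 2, constants and sums are
  absorbed by raising the exponent.\<close>

definition polybounded :: "(bool list \<Rightarrow> (nat \<Rightarrow> nat) \<Rightarrow> nat) \<Rightarrow> bool" where
  "polybounded F \<longleftrightarrow> (\<exists>c. \<forall>x e m. length x \<le> m \<longrightarrow> (\<forall>i. e i \<le> m) \<longrightarrow> F x e \<le> (m + 2) ^ c)"

lemma polyboundedI:
  "(\<And>x e m. length x \<le> m \<Longrightarrow> (\<And>i. e i \<le> m) \<Longrightarrow> F x e \<le> (m + 2) ^ c) \<Longrightarrow> polybounded F"
  unfolding polybounded_def by blast

lemma polybounded_le:
  assumes "polybounded G" "\<And>x e. F x e \<le> G x e"
  shows "polybounded F"
  using assms unfolding polybounded_def by (meson le_trans)

lemma polybounded_const: "polybounded (\<lambda>x e. k)"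
proof (rule polyboundedI[of _ k])
  fix m :: nat
  have "k \<le> 2 ^ k" using less_exp less_imp_le by blast
  also have "\<dots> \<le> (m + 2) ^ k" by (rule power_mono) auto
  finally show "k \<le> (m + 2) ^ k" .
qed

lemma polybounded_var: "polybounded (\<lambda>x e. e i)"
  by (rule polyboundedI[of _ 1]) (simp add: le_SucI)

lemma polybounded_length: "polybounded (\<lambda>x e. length x)"
  by (rule polyboundedI[of _ 1]) (simp add: le_SucI)

lemma polybounded_mult:
  assumes "polybounded F" "polybounded G"
  shows "polybounded (\<lambda>x e. F x e * G x e)"
proof -
  obtain a b where "\<And>x e m. length x \<le> m \<Longrightarrow> (\<And>i. e i \<le> m) \<Longrightarrow> F x e \<le> (m + 2) ^ a"
    "\<And>x e m. length x \<le> m \<Longrightarrow> (\<And>i. e i \<le> m) \<Longrightarrow> G x e \<le> (m + 2) ^ b"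
    using assms unfolding polybounded_def by metis
  then show ?thesis
    by (intro polyboundedI[of _ "a + b"]) (simp only: power_add, intro mult_le_mono, blast+)
qed

lemma polybounded_add:
  assumes "polybounded F" "polybounded G"
  shows "polybounded (\<lambda>x e. F x e + G x e)"
proof -
  obtain a b where ab: "\<And>x e m. length x \<le> m \<Longrightarrow> (\<And>i. e i \<le> m) \<Longrightarrow> F x e \<le> (m + 2) ^ a"
    "\<And>x e m. length x \<le> m \<Longrightarrow> (\<And>i. e i \<le> m) \<Longrightarrow> G x e \<le> (m + 2) ^ b"
    using assms unfolding polybounded_def by metis
  show ?thesis
  proof (rule polyboundedI[of _ "Suc (a + b)"])
    fix x :: "bool list" and e m assume *: "length x \<le> m" "\<And>i::nat. e i \<le> m"
    have "(m + 2) ^ a \<le> (m + 2) ^ (a + b)" "(m + 2) ^ b \<le> (m + 2) ^ (a + b)"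
      by (auto intro: power_increasing)
    then have "F x e + G x e \<le> 2 * (m + 2) ^ (a + b)"
      using ab(1)[of x m e, OF *] ab(2)[of x m e, OF *] by linarith
    also have "\<dots> \<le> (m + 2) ^ Suc (a + b)" by simp
    finally show "F x e + G x e \<le> (m + 2) ^ Suc (a + b)" .
  qed
qed

lemma polybounded_sum:
  assumes "polybounded F" "polybounded G"
  shows "polybounded (\<lambda>x e. \<Sum>i<F x e. G x (case_nat i e))"
proof -
  obtain a b where ab: "\<And>x e m. length x \<le> m \<Longrightarrow> (\<And>i. e i \<le> m) \<Longrightarrow> F x e \<le> (m + 2) ^ a"
    "\<And>x e m. length x \<le> m \<Longrightarrow> (\<And>i. e i \<le> m) \<Longrightarrow> G x e \<le> (m + 2) ^ b"
    using assms unfolding polybounded_def by metis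
  show ?thesis
  proof (rule polyboundedI[of _ "a + (a + 2) * b"])
    fix x :: "bool list" and e m assume *: "length x \<le> m" "\<And>i::nat. e i \<le> m"
    \<comment> \<open>\<open>?m\<close> dominates the old variables, the input length and the index,
      which is below \<open>(m + 2) ^ a\<close>. Since
      \<open>?m + 2 \<le> (m + 2) ^ (a + 2)\<close>, each summand is at most
      \<open>(m + 2) ^ ((a + 2) * b)\<close>.\<close>
    let ?m = "(m + 2) ^ (a + 1)"
    have "1 \<le> (m + 2) ^ a" by (rule one_le_power) simp
    then have m: "m + 2 \<le> ?m" using mult_le_mono1[of 1 "(m + 2) ^ a" "m + 2"] by (simp add: mult.commute)
    have "G x (case_nat i e) \<le> (m + 2) ^ ((a + 2) * b)" if "i < F x e" for i
    proof -
      have "(m + 2) ^ a \<le> ?m" by (rule power_increasing) auto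
      then have "i \<le> ?m" using that ab(1)[of x m e, OF *] by linarith
      then have "case_nat i e j \<le> ?m" for j
      proof (cases j)
        case (Suc j')
        have "e j' \<le> ?m" using *(2)[of j'] m by linarith
        then show ?thesis using Suc by simp
      qed simp
      moreover have "length x \<le> ?m" using m *(1) by linarith
      ultimately have "G x (case_nat i e) \<le> (?m + 2) ^ b" by (intro ab(2))
      also have "?m + 2 \<le> 2 * ?m" using m by linarith
      then have "?m + 2 \<le> (m + 2) ^ (a + 2)" by (simp add: algebra_simps)
      then have "(?m + 2) ^ b \<le> ((m + 2) ^ (a + 2)) ^ b" by (rule power_mono) simp
      also have "\<dots> = (m + 2) ^ ((a + 2) * b)" by (simp only: power_mult)
      finally show ?thesis .
    qed
    then have "(\<Sum>i<F x e. G x (case_nat i e)) \<le> of_nat (card {..<F x e}) * (m + 2) ^ ((a + 2) * b)"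
      by (intro sum_bounded_above) auto
    also have "\<dots> \<le> (m + 2) ^ a * (m + 2) ^ ((a + 2) * b)"
      using ab(1)[of x m e, OF *] by (simp add: mult_le_mono1)
    finally show "(\<Sum>i<F x e. G x (case_nat i e)) \<le> (m + 2) ^ (a + (a + 2) * b)"
      by (simp only: power_add)
  qed
qed

lemmas polybounded_intros = polybounded_const polybounded_var polybounded_length polybounded_mult
  polybounded_add polybounded_sum

lemma polybounded_eval: "wf_tm True t \<Longrightarrow> polybounded (eval t)"
proof (induction t)
  case (TSub a b)
  then have "polybounded (eval a)" by simp
  then show ?case by (rule polybounded_le) simp
next
  case (TBit a)
  show ?case by (rule polybounded_le[OF polybounded_const[of 1]]) auto
next
  case (TVar i)
  then show ?case using polybounded_var[of i] by (simp add: polybounded_def)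
next
  case (TConst i)
  then show ?case using polybounded_const[of i] by (simp add: polybounded_def)
next
  case TLen
  then show ?case using polybounded_length by (simp add: polybounded_def)
next
  case (TAdd a b)
  then show ?case using polybounded_add[of "eval a" "eval b"] by (simp add: polybounded_def)
next
  case (TMul a b)
  then show ?case using polybounded_mult[of "eval a" "eval b"] by (simp add: polybounded_def)
next
  case (TSum a b)
  then show ?case using polybounded_sum[of "eval a" "eval b"] by (simp add: polybounded_def)
qed auto

lemma polybounded_cost: "wf_tm True t \<Longrightarrow> polybounded (cost t)"
proof (induction t)
  case (TVar i)
  have "polybounded (\<lambda>x e. 7 * e i + 2)" by (intro polybounded_intros)
  then show ?case by (rule polybounded_le) simp
next
  case (TConst c)
  show ?case by (rule polybounded_le[OF polybounded_const[of "c + 2"]]) simp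
next
  case TLen
  have "polybounded (\<lambda>x e. 9 * length x + 2)" by (intro polybounded_intros)
  then show ?case by (rule polybounded_le) simp
next
  case (TAdd a b)
  then have "polybounded (\<lambda>x e. cost a x e + cost b x e)"
    using polybounded_eval[of a] polybounded_eval[of b] by (intro polybounded_intros) simp_all
  then show ?case by (rule polybounded_le) simp
next
  case (TMul a b)
  then have "polybounded (\<lambda>x e. cost a x e + eval a x e * (cost b x e + 2) + 1)"
    using polybounded_eval[of a] polybounded_eval[of b] by (intro polybounded_intros) simp_all
  then show ?case by (rule polybounded_le) simp
next
  case (TSub a b)
  then have "polybounded (\<lambda>x e. cost a x e + cost b x e + 3 * eval a x e + 3 * eval b x e + 2)"
    using polybounded_eval[of a] polybounded_eval[of b] by (intro polybounded_intros) simp_all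
  then show ?case by (rule polybounded_le) simp
next
  case (TSum a b)
  then have "polybounded (\<lambda>x e. cost b x e + 3)"
    by (intro polybounded_intros) simp_all
  with TSum have "polybounded (\<lambda>x e. cost a x e +
     (\<Sum>i<eval a x e. cost b x (case_nat i e) + 3) + 2 * eval a x e + 2)"
    using polybounded_eval[of a] polybounded_sum[of "eval a" "\<lambda>x e. cost b x e + 3"]
    by (intro polybounded_add polybounded_const polybounded_mult) simp_all
  then show ?case by (rule polybounded_le) simp
next
  case (TBit a)
  then have "polybounded (\<lambda>x e. cost a x e + 5 * eval a x e + 4 * length x + 5)"
    using polybounded_eval[of a] by (intro polybounded_intros) simp_all
  then show ?case by (rule polybounded_le) simp
qed auto

subsection \<open>Functions denoted by terms\<close>

text \<open>\<open>ok True F\<close>: \<open>F\<close> is computable in polynomial time on unary numbers; \<open>ok False F\<close>: \<open>F\<close> is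
  computable.\<close>

definition ok :: "bool \<Rightarrow> (bool list \<Rightarrow> (nat \<Rightarrow> nat) \<Rightarrow> nat) \<Rightarrow> bool" where
  "ok z F \<longleftrightarrow> (\<exists>t. wf_tm z t \<and> (\<forall>x e. eval t x e = F x e))"

lemma ok_True_False: "ok True F \<Longrightarrow> ok z F"
  unfolding ok_def by (cases z) (auto dest: wf_tm_mono)

lemma ok_var: "ok z (\<lambda>x e. e i)"
  unfolding ok_def by (rule exI[of _ "TVar i"]) simp

lemma ok_const: "ok z (\<lambda>x e. c)"
  unfolding ok_def by (rule exI[of _ "TConst c"]) simp

lemma ok_length: "ok z (\<lambda>x e. length x)"
  unfolding ok_def by (rule exI[of _ "TLen"]) simp

lemma ok_add: assumes "ok z F" "ok z G" shows "ok z (\<lambda>x e. F x e + G x e)"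
proof -
  obtain s t where "wf_tm z s \<and> (\<forall>x e. eval s x e = F x e)" "wf_tm z t \<and> (\<forall>x e. eval t x e = G x e)"
    using assms unfolding ok_def by blast
  then show ?thesis unfolding ok_def by (intro exI[of _ "TAdd s t"]) simp
qed

lemma ok_mult: assumes "ok z F" "ok z G" shows "ok z (\<lambda>x e. F x e * G x e)"
proof -
  obtain s t where "wf_tm z s \<and> (\<forall>x e. eval s x e = F x e)" "wf_tm z t \<and> (\<forall>x e. eval t x e = G x e)"
    using assms unfolding ok_def by blast
  then show ?thesis unfolding ok_def by (intro exI[of _ "TMul s t"]) simp
qed

lemma ok_diff: assumes "ok z F" "ok z G" shows "ok z (\<lambda>x e. F x e - G x e)"
proof -
  obtain s t where "wf_tm z s \<and> (\<forall>x e. eval s x e = F x e)" "wf_tm z t \<and> (\<forall>x e. eval t x e = G x e)"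
    using assms unfolding ok_def by blast
  then show ?thesis unfolding ok_def by (intro exI[of _ "TSub s t"]) simp
qed

text \<open>As in \<open>eval\<close>, the index is variable 0 of the body and the outer variables
  move up by one.\<close>

lemma ok_sum:
  assumes "ok z B" "ok z (\<lambda>x e. G x (e 0) (\<lambda>i. e (Suc i)))"
  shows "ok z (\<lambda>x e. \<Sum>i<B x e. G x i e)"
proof -
  obtain s t where "wf_tm z s \<and> (\<forall>x e. eval s x e = B x e)"
    "wf_tm z t \<and> (\<forall>x e. eval t x e = G x (e 0) (\<lambda>i. e (Suc i)))"
    using assms unfolding ok_def by blast
  then show ?thesis unfolding ok_def by (intro exI[of _ "TSum s t"]) simp
qed

lemma ok_bit_val: assumes "ok z F" shows "ok z (\<lambda>x e. of_bool (F x e < length x \<and> x ! F x e))"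
proof -
  obtain s where "wf_tm z s \<and> (\<forall>x e. eval s x e = F x e)"
    using assms unfolding ok_def by blast
  then show ?thesis unfolding ok_def by (intro exI[of _ "TBit s"]) simp
qed

lemma ok_app:
  assumes "computable f" "ok False F"
  shows "ok False (\<lambda>x e. f (F x e))"
proof -
  obtain s where s: "wf_tm False s \<and> (\<forall>x e. eval s x e = F x e)"
    using assms unfolding ok_def by blast
  obtain P T where "\<And>n. \<exists>s. run P (load [] n) (T n) s \<and> s 1 = replicate (f n) True"
    using assms(1) unfolding computable_def by metis
  then have "\<exists>s. runb P (load [] n) (T n) s \<and> s 1 = replicate (f n) True" for n
    unfolding runb_def by blast
  with s show ?thesis unfolding ok_def by (intro exI[of _ "TApp P f T s"]) simp
qed

primrec rename :: "tm \<Rightarrow> (nat \<Rightarrow> nat) \<Rightarrow> tm" where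
  "rename (TVar i) \<pi> = TVar (\<pi> i)"
| "rename (TConst c) \<pi> = TConst c"
| "rename TLen \<pi> = TLen"
| "rename (TAdd a b) \<pi> = TAdd (rename a \<pi>) (rename b \<pi>)"
| "rename (TMul a b) \<pi> = TMul (rename a \<pi>) (rename b \<pi>)"
| "rename (TSub a b) \<pi> = TSub (rename a \<pi>) (rename b \<pi>)"
| "rename (TSum a b) \<pi> = TSum (rename a \<pi>) (rename b (case_nat 0 (\<lambda>i. Suc (\<pi> i))))"
| "rename (TBit a) \<pi> = TBit (rename a \<pi>)"
| "rename (TApp P f T a) \<pi> = TApp P f T (rename a \<pi>)"

lemma wf_rename: "wf_tm z t \<Longrightarrow> wf_tm z (rename t \<pi>)"
  by (induction t arbitrary: \<pi>) auto

lemma eval_rename: "eval (rename t \<pi>) x e = eval t x (\<lambda>i. e (\<pi> i))"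
proof (induction t arbitrary: \<pi> e)
  case (TSum a b)
  have "(\<lambda>j. case_nat i e (case_nat 0 (\<lambda>i. Suc (\<pi> i)) j)) = case_nat i (\<lambda>i. e (\<pi> i))" for i
    by (auto simp: fun_eq_iff split: nat.split)
  with TSum show ?case by simp
qed auto

text \<open>Weakening: a term built outside a sum is often needed inside it, where its variables are
  shifted.\<close>

lemma ok_rename: "ok z F \<Longrightarrow> ok z (\<lambda>x e. F x (\<lambda>i. e (\<pi> i)))"
  unfolding ok_def using wf_rename eval_rename by metis

definition okb :: "bool \<Rightarrow> (bool list \<Rightarrow> (nat \<Rightarrow> nat) \<Rightarrow> bool) \<Rightarrow> bool" where
  "okb z P \<longleftrightarrow> ok z (\<lambda>x e. of_bool (P x e))"

lemma ok_of_bool: "okb z P \<Longrightarrow> ok z (\<lambda>x e. of_bool (P x e))"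
  by (simp add: okb_def)

lemma ok_cong: "ok z F \<Longrightarrow> (\<And>x e. G x e = F x e) \<Longrightarrow> ok z G"
  by presburger

lemma okb_cong: "okb z F \<Longrightarrow> (\<And>x e. G x e = F x e) \<Longrightarrow> okb z G"
  by presburger

lemma okb_bit: "ok z F \<Longrightarrow> okb z (\<lambda>x e. F x e < length x \<and> x ! F x e)"
  unfolding okb_def by (rule ok_bit_val)

lemma okb_less:
  assumes "ok z F" "ok z G"
  shows "okb z (\<lambda>x e. F x e < G x e)"
proof -
  have "ok z (\<lambda>x e. 1 - (1 - (G x e - F x e)))" by (intro ok_diff ok_const assms)
  then show ?thesis unfolding okb_def by (rule ok_cong) auto
qed

lemma okb_not:
  assumes "okb z P"
  shows "okb z (\<lambda>x e. \<not> P x e)"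
proof -
  have "ok z (\<lambda>x e. 1 - of_bool (P x e))" using assms unfolding okb_def by (intro ok_diff ok_const)
  then show ?thesis unfolding okb_def by (rule ok_cong) auto
qed

lemma okb_conj: "okb z P \<Longrightarrow> okb z Q \<Longrightarrow> okb z (\<lambda>x e. P x e \<and> Q x e)"
  unfolding okb_def of_bool_conj by (intro ok_mult)

lemma okb_disj: "okb z P \<Longrightarrow> okb z Q \<Longrightarrow> okb z (\<lambda>x e. P x e \<or> Q x e)"
  using okb_not[OF okb_conj[OF okb_not okb_not], of z P Q] by simp

lemma okb_imp: "okb z P \<Longrightarrow> okb z Q \<Longrightarrow> okb z (\<lambda>x e. P x e \<longrightarrow> Q x e)"
  using okb_disj[OF okb_not, of z P Q] by (rule okb_cong) auto

lemma okb_le: "ok z F \<Longrightarrow> ok z G \<Longrightarrow> okb z (\<lambda>x e. F x e \<le> G x e)"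
  using okb_not[OF okb_less, of z G F] by (simp add: not_less)

lemma okb_eq:
  assumes "ok z F" "ok z G"
  shows "okb z (\<lambda>x e. F x e = G x e)"
proof -
  have "okb z (\<lambda>x e. F x e \<le> G x e \<and> G x e \<le> F x e)" by (intro okb_conj okb_le assms)
  then show ?thesis by (rule okb_cong) auto
qed

lemma okb_iff:
  assumes "okb z P" "okb z Q"
  shows "okb z (\<lambda>x e. P x e \<longleftrightarrow> Q x e)"
proof -
  have "okb z (\<lambda>x e. (P x e \<longrightarrow> Q x e) \<and> (Q x e \<longrightarrow> P x e))" by (intro okb_conj okb_imp assms)
  then show ?thesis by (rule okb_cong) auto
qed

lemma okb_const: "okb z (\<lambda>x e. c)"
  unfolding okb_def by (rule ok_const)

lemma okb_rename: "okb z P \<Longrightarrow> okb z (\<lambda>x e. P x (\<lambda>i. e (\<pi> i)))"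
  unfolding okb_def by (rule ok_rename)

lemma okb_ex:
  assumes "ok z B" "okb z (\<lambda>x e. P x (e 0) (\<lambda>i. e (Suc i)))"
  shows "okb z (\<lambda>x e. \<exists>i<B x e. P x i e)"
proof -
  have "okb z (\<lambda>x e. 0 < (\<Sum>i<B x e. of_bool (P x i e) :: nat))"
    using assms unfolding okb_def
    by (intro okb_less[unfolded okb_def] ok_const ok_sum)
  then show ?thesis by (rule okb_cong) (auto simp: sum_nonneg_eq_0_iff simp flip: neq0_conv)
qed

lemma okb_all:
  assumes "ok z B" "okb z (\<lambda>x e. P x (e 0) (\<lambda>i. e (Suc i)))"
  shows "okb z (\<lambda>x e. \<forall>i<B x e. P x i e)"
  using okb_not[OF okb_ex[OF assms(1) okb_not[OF assms(2)]]] by simp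

text \<open>The sum over all \<open>i \<le> A x e\<close> with an equality indicator retains exactly
  the summand \<open>i = A x e\<close>, so a sum can bind a value to variable 0.\<close>

lemma ok_let:
  assumes "ok z A" "ok z (\<lambda>x e. G x (e 0) (\<lambda>i. e (Suc i)))"
  shows "ok z (\<lambda>x e. G x (A x e) e)"
proof -
  have "ok z (\<lambda>x e. \<Sum>i<A x e + 1. of_bool (i = A x e) * G x i e)"
    by (intro ok_sum ok_add ok_mult assms ok_const ok_of_bool okb_eq ok_var ok_rename[OF assms(1)])
  then show ?thesis by (rule ok_cong) simp
qed

lemma okb_let:
  assumes "ok z A" "okb z (\<lambda>x e. P x (e 0) (\<lambda>i. e (Suc i)))"
  shows "okb z (\<lambda>x e. P x (A x e) e)"
  using assms unfolding okb_def by (rule ok_let)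

lemma ok_if:
  assumes "okb z P" "ok z F" "ok z G"
  shows "ok z (\<lambda>x e. if P x e then F x e else G x e)"
proof -
  have "ok z (\<lambda>x e. of_bool (P x e) * F x e + of_bool (\<not> P x e) * G x e)"
    by (intro ok_add ok_mult ok_of_bool okb_not assms)
  then show ?thesis by (rule ok_cong) simp
qed

lemma ok_div:
  assumes "ok z F" "ok z G"
  shows "ok z (\<lambda>x e. F x e div G x e)"
proof -
  \<comment> \<open>The quotient \<open>a div b\<close> is the number of \<open>i\<close> with
    \<open>(i + 1) * b \<le> a\<close>; the leading factor yields the value 0 for
    \<open>b = 0\<close>.\<close>
  have "ok z (\<lambda>x e. of_bool (0 < G x e) * (\<Sum>i<F x e. of_bool ((i + 1) * G x e \<le> F x e)))"
    by (intro ok_sum ok_add ok_mult assms ok_const ok_of_bool okb_le okb_less ok_var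
        ok_rename[OF assms(1)] ok_rename[OF assms(2)])
  moreover have "a div b = of_bool (0 < b) * (\<Sum>i<a. of_bool ((i + 1) * b \<le> a))" for a b :: nat
  proof (cases "b = 0")
    case False
    then have "{i. i < a \<and> (i + 1) * b \<le> a} = {..<a div b}"
      by (auto simp: Suc_le_eq[symmetric] less_eq_div_iff_mult_less_eq)
        (metis Suc_le_eq div_le_dividend le_trans less_eq_div_iff_mult_less_eq mult_Suc neq0_conv)
    then have "card {i \<in> {..<a}. (i + 1) * b \<le> a} = a div b" by simp
    then show ?thesis using False by (simp add: Int_def)
  qed simp
  ultimately show ?thesis by simp
qed

lemma ok_mod: "ok z F \<Longrightarrow> ok z G \<Longrightarrow> ok z (\<lambda>x e. F x e mod G x e)"
  unfolding minus_mult_div_eq_mod[symmetric] by (intro ok_diff ok_mult ok_div)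

lemma ok_power: "ok z F \<Longrightarrow> ok z (\<lambda>x e. F x e ^ c)"
  by (induction c) (auto intro: ok_mult ok_const)

lemma ok_sum_const: "(\<And>j. j < (D::nat) \<Longrightarrow> ok z (F j)) \<Longrightarrow> ok z (\<lambda>x e. \<Sum>j<D. F j x e)"
  by (induction D) (auto intro: ok_add ok_const)

lemma ok_prod_const: "(\<And>j. j < (D::nat) \<Longrightarrow> ok z (F j)) \<Longrightarrow> ok z (\<lambda>x e. \<Prod>j<D. F j x e)"
  by (induction D) (auto intro: ok_mult ok_const)

lemma okb_all_const: "(\<And>j. j < (D::nat) \<Longrightarrow> okb z (P j)) \<Longrightarrow> okb z (\<lambda>x e. \<forall>j<D. P j x e)"
  by (induction D) (auto intro: okb_conj okb_const simp: less_Suc_eq all_conj_distrib imp_disjL)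

text \<open>\<open>ok_let\<close> eliminates only variable 0. The variables are reversed first, so
  that the arguments can be bound from the last to the first.\<close>

lemma ok_subst3:
  assumes "ok z (\<lambda>x e. H x (e 0) (e 1) (e 2))" "ok z A" "ok z B" "ok z C"
  shows "ok z (\<lambda>x e. H x (A x e) (B x e) (C x e))"
proof -
  have "ok z (\<lambda>x e. H x (e 2) (e 1) (e 0))"
    using ok_rename[OF assms(1), of "\<lambda>i. 2 - i"] by simp
  then have "ok z (\<lambda>x e. H x (e 1) (e 0) (C x (\<lambda>i. e (Suc (Suc i)))))"
    by (intro ok_let[where G = "\<lambda>x i e. H x (e 1) (e 0) i", OF ok_rename[OF assms(4)]])
      (simp add: numeral_2_eq_2)
  then have "ok z (\<lambda>x e. H x (e 0) (B x (\<lambda>i. e (Suc i))) (C x (\<lambda>i. e (Suc i))))"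
    by (intro ok_let[where G = "\<lambda>x i e. H x (e 0) i (C x (\<lambda>i. e (Suc i)))", OF ok_rename[OF assms(3)]]) simp
  then show ?thesis by (rule ok_let[OF assms(2)])
qed

lemma okb_subst3:
  "okb z (\<lambda>x e. H x (e 0) (e 1) (e 2)) \<Longrightarrow> ok z A \<Longrightarrow> ok z B \<Longrightarrow> ok z C \<Longrightarrow>
    okb z (\<lambda>x e. H x (A x e) (B x e) (C x e))"
  unfolding okb_def by (rule ok_subst3)

subsection \<open>Computable functions\<close>

lemma computable_ok:
  assumes "ok False (\<lambda>x e. f (e 0))"
  shows "computable f"
proof -
  obtain t where t: "wf_tm False t" "\<And>x e. eval t x e = f (e 0)"
    using assms unfolding ok_def by blast
  \<comment> \<open>Variable 0 is the argument on stack 1; all other variables share the empty stack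
    4 and have value 0.\<close>
  let ?\<rho> = "\<lambda>i. if i = 0 then 1 else (4::nat)"
  let ?P = "Seq (compile t ?\<rho> 5 3) (Seq (clear 1) (mv 3 1))"
  have "\<exists>u s. run ?P (load [] n) u s \<and> s 1 = replicate (f n) True" for n
  proof -
    let ?e = "\<lambda>i. if i = 0 then n else (0::nat)"
    let ?s = "(load [] n)(3 := replicate (f n) True)"
    have "runb (compile t ?\<rho> 5 3) (load [] n) (cost t [] ?e)
      ((load [] n)(3 := replicate (eval t [] ?e) True @ load [] n 3))"
      by (rule compile_correct[OF t(1)]) (auto simp: invar_def load_def)
    then have 1: "runb (compile t ?\<rho> 5 3) (load [] n) (cost t [] ?e) ?s" by (simp add: t(2) load_def)
    have 2: "runb (clear 1) ?s (2 * n + 1) (?s(1 := []))"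
      by (rule runb_clear) (auto simp: load_def)
    have 3: "runb (mv 3 1) (?s(1 := [])) (3 * f n + 1) (?s(3 := [], 1 := replicate (f n) True))"
      by (rule runb_mv[where n = "f n"]) (auto simp: load_def fun_eq_iff)
    from runb_Seq[OF 1 runb_Seq[OF 2 3 order_refl] order_refl]
    show ?thesis unfolding runb_def by (meson fun_upd_same)
  qed
  then show ?thesis unfolding computable_def by blast
qed

text \<open>Call-free terms grow polynomially, so exponentiation needs a program of its own, which
  doubles stack 2 once per mark on stack 1. It enters the size bound of the circuits.\<close>

lemma computable_power2: "computable (\<lambda>n. 2 ^ n)"
proof -
  let ?D = "Seq (Loop 2 (Seq (Pop 2) (Seq (Push 3 True) (Push 3 True)))) (mv 3 2)"
  let ?P = "Seq (Push 2 True) (Seq (Loop 1 (Seq (Pop 1) ?D)) (mv 2 1))"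
  have "\<exists>u s. run ?P (load [] n) u s \<and> s 1 = replicate (2 ^ n) True" for n
  proof -
    define \<sigma> :: "nat \<Rightarrow> stacks" where
      "\<sigma> j = (load [] n)(1 := replicate (n - j) True, 2 := replicate (2 ^ j) True)" for j
    have \<sigma>: "\<sigma> j 0 = []" "\<sigma> j 1 = replicate (n - j) True" "\<sigma> j 2 = replicate (2 ^ j) True"
      "\<sigma> j 3 = []" for j by (auto simp: \<sigma>_def load_def)
    have 1: "runb (Push 2 True) (load [] n) 1 (\<sigma> 0)"
      by (rule runb_Push) (auto simp: \<sigma>_def load_def fun_eq_iff)
    have body: "runb (Seq (Pop 1) ?D) (\<sigma> j) (1 + (4 * 2 ^ j + 1 + (3 * 2 ^ Suc j + 1))) (\<sigma> (Suc j))"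
      if "j < n" for j
    proof -
      let ?t = "(\<sigma> j)(1 := replicate (n - Suc j) True)"
      let ?u = "?t(2 := [], 3 := replicate (2 ^ Suc j) True)"
      have a: "runb (Pop 1) (\<sigma> j) 1 ?t"
        by (rule runb_Pop) (use that in \<open>auto simp: \<sigma>[simplified]\<close>)
      have b: "runb (Loop 2 (Seq (Pop 2) (Seq (Push 3 True) (Push 3 True)))) ?t (4 * 2 ^ j + 1) ?u"
        by (rule runb_Loop[where n = "2 ^ j" and b = 3 and
              \<sigma> = "\<lambda>i. ?t(2 := replicate (2 ^ j - i) True, 3 := replicate (2 * i) True)"])
          (use \<sigma>[simplified] in \<open>auto intro!: runb_Seq[OF runb_Pop[OF order_refl refl]
            runb_Seq[OF runb_Push[OF order_refl refl] runb_Push[OF order_refl] order_refl]]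
            simp: fun_eq_iff\<close>)
      have c: "runb (mv 3 2) ?u (3 * 2 ^ Suc j + 1) (\<sigma> (Suc j))"
        by (rule runb_mv[where n = "2 ^ Suc j"]) (auto simp: \<sigma>_def load_def fun_eq_iff)
      show ?thesis by (rule runb_Seq[OF a runb_Seq[OF b c order_refl] order_refl])
    qed
    have 2: "runb (Loop 1 (Seq (Pop 1) ?D)) (\<sigma> 0)
      ((\<Sum>j<n. (1 + (4 * 2 ^ j + 1 + (3 * 2 ^ Suc j + 1))) + 1) + 1) (\<sigma> n)"
    proof (rule runb_Loop_sum)
      show "\<sigma> j 1 \<noteq> []" if "j < n" for j using that by (simp add: \<sigma>_def)
      show "\<sigma> n 1 = []" by (simp add: \<sigma>_def)
    qed (rule body)
    have 3: "runb (mv 2 1) (\<sigma> n) (3 * 2 ^ n + 1) ((\<sigma> n)(2 := [], 1 := replicate (2 ^ n) True))"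
      by (rule runb_mv[where n = "2 ^ n"]) (auto simp: \<sigma>_def fun_eq_iff)
    from runb_Seq[OF 1 runb_Seq[OF 2 3 order_refl] order_refl]
    show ?thesis unfolding runb_def by (meson fun_upd_same)
  qed
  then show ?thesis unfolding computable_def by blast
qed

subsection \<open>Reductions given by terms\<close>

text \<open>The output is printed bit by bit, each bit being a term in its position and the
  parameter, so the program never has to store or search an intermediate structure.\<close>

lemma fpt_reducible_ok:
  fixes L :: "bool list \<Rightarrow> nat \<Rightarrow> nat" and B :: "bool list \<Rightarrow> nat \<Rightarrow> nat \<Rightarrow> bool"
  assumes L: "ok True (\<lambda>x e. L x (e 0))" and B: "okb True (\<lambda>x e. B x (e 1) (e 0))"
    and K: "ok True (\<lambda>x e. K (e 0))"
    and corr: "\<And>x k. (x, k) \<in> Q \<longleftrightarrow> (map (B x k) [0..<L x k], K k) \<in> Q'"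
  shows "fpt_reducible Q Q'"
proof -
  obtain tL tB tK where tL: "wf_tm True tL" "\<And>x e. eval tL x e = L x (e 0)"
    and tB: "wf_tm True tB" "\<And>x e. eval tB x e = of_bool (B x (e 1) (e 0))"
    and tK: "wf_tm True tK" "\<And>x e. eval tK x e = K (e 0)"
    using L B K unfolding okb_def ok_def by metis
  let ?\<rho> = "\<lambda>i. if i = 0 then 1 else (7::nat)"
  \<comment> \<open>Inside the loop, variable 0 is the output position on stack 3 and variable 1 the
    parameter on stack 1. The output bits gather in reverse order on stack 4.\<close>
  let ?\<rho>' = "case_nat 3 ?\<rho>"
  let ?body = "Seq (Pop 5) (Seq (compile tB ?\<rho>' 8 6) (Seq (Branch 6 (Push 4 False) (skip 4) (Push 4 True))
    (Seq (clear 6) (Push 3 True))))"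
  let ?P = "Seq (compile tL ?\<rho> 8 5) (Seq (Loop 5 ?body) (Seq (compile tK ?\<rho> 8 6)
    (Seq (clear 1) (Seq (mv 6 1) (Seq (clear 0) (move_bits 4 0))))))"
  define T where "T = (\<lambda>x e. cost tL x e + ((\<Sum>i<eval tL x e. (cost tB x (case_nat i e) + 7 + 1)) + 1 +
    (cost tK x e + (2 * e 0 + 1 + (3 * eval tK x e + 1 + (2 * length x + 1 + (4 * eval tL x e + 1)))))))"
  have "polybounded (\<lambda>x e. cost tB x e + 7 + 1)"
    using polybounded_cost tB(1) by (intro polybounded_intros) simp_all
  then have "polybounded T"
    unfolding T_def using polybounded_cost polybounded_eval tL(1) tK(1)
      polybounded_sum[of "eval tL" "\<lambda>x e. cost tB x e + 7 + 1"]
    by (intro polybounded_add polybounded_const polybounded_mult polybounded_var polybounded_length) simp_all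
  then obtain c where c: "\<And>x e m. length x \<le> m \<Longrightarrow> (\<And>i. e i \<le> m) \<Longrightarrow> T x e \<le> (m + 2) ^ c"
    unfolding polybounded_def by blast
  have run: "\<exists>t s. run ?P (load x k) t s \<and> s 1 = replicate (K k) True \<and>
    t \<le> (k + 2) ^ c * (length x + 1) ^ c \<and> s 0 = map (B x k) [0..<L x k]" for x k
  proof -
    let ?e = "\<lambda>i. if i = 0 then k else (0::nat)"
    let ?n = "L x k"
    let ?o = "\<lambda>j. map (B x k) [0..<j]"
    define \<sigma> where "\<sigma> = (\<lambda>j. (load x k)(5 := replicate (?n - j) True, 4 := rev (?o j), 3 := replicate j True))"
    have "runb (compile tL ?\<rho> 8 5) (load x k) (cost tL x ?e)
      ((load x k)(5 := replicate (eval tL x ?e) True @ load x k 5))"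
      by (rule compile_correct[OF wf_tm_mono[OF tL(1)]]) (auto simp: invar_def load_def)
    also have "(load x k)(5 := replicate (eval tL x ?e) True @ load x k 5) = \<sigma> 0"
      by (auto simp: \<sigma>_def load_def tL(2) fun_eq_iff)
    finally have 1: "runb (compile tL ?\<rho> 8 5) (load x k) (cost tL x ?e) (\<sigma> 0)" .
    have body: "runb ?body (\<sigma> j) (cost tB x (case_nat j ?e) + 7) (\<sigma> (Suc j))" if "j < ?n" for j
    proof -
      let ?s = "(\<sigma> j)(5 := replicate (?n - Suc j) True)"
      let ?v = "B x k j"
      let ?t = "?s(6 := replicate (of_bool ?v) True)"
      let ?u = "?t(4 := ?v # rev (?o j))"
      have a: "runb (Pop 5) (\<sigma> j) 1 ?s"
        by (rule runb_Pop) (use that in \<open>auto simp: \<sigma>_def fun_eq_iff\<close>)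
      have "runb (compile tB ?\<rho>' 8 6) ?s (cost tB x (case_nat j ?e))
        (?s(6 := replicate (eval tB x (case_nat j ?e)) True @ ?s 6))"
        by (rule compile_correct[OF wf_tm_mono[OF tB(1)]])
          (auto simp: invar_def load_def \<sigma>_def split: nat.split)
      also have "?s(6 := replicate (eval tB x (case_nat j ?e)) True @ ?s 6) = ?t"
        by (auto simp: \<sigma>_def load_def tB(2) fun_eq_iff)
      finally have b: "runb (compile tB ?\<rho>' 8 6) ?s (cost tB x (case_nat j ?e)) ?t" .
      have c: "runb (Branch 6 (Push 4 False) (skip 4) (Push 4 True)) ?t 2 ?u"
      proof (cases ?v)
        case True
        show ?thesis
          by (rule runb_Branch_True[where b = 1 and w = "[]"], simp add: True, rule runb_Push)
            (auto simp: \<sigma>_def True)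
      next
        case False
        show ?thesis
          by (rule runb_Branch_empty[where b = 1], simp add: False, rule runb_Push)
            (auto simp: \<sigma>_def False)
      qed
      have d: "runb (clear 6) ?u 3 (?u(6 := []))"
        by (rule runb_clear) auto
      have f: "runb (Push 3 True) (?u(6 := [])) 1 (\<sigma> (Suc j))"
        by (rule runb_Push) (auto simp: \<sigma>_def load_def fun_eq_iff)
      show ?thesis
        by (rule runb_mono[OF runb_Seq[OF a runb_Seq[OF b runb_Seq[OF c runb_Seq[OF d f order_refl]
              order_refl] order_refl] order_refl]]) simp
    qed
    have 2: "runb (Loop 5 ?body) (\<sigma> 0) ((\<Sum>j<?n. (cost tB x (case_nat j ?e) + 7) + 1) + 1) (\<sigma> ?n)"
    proof (rule runb_Loop_sum)
      show "\<sigma> j 5 \<noteq> []" if "j < ?n" for j using that by (simp add: \<sigma>_def)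
      show "\<sigma> ?n 5 = []" by (simp add: \<sigma>_def)
    qed (rule body)
    let ?s = "(\<sigma> ?n)(6 := replicate (K k) True)"
    have "runb (compile tK ?\<rho> 8 6) (\<sigma> ?n) (cost tK x ?e)
      ((\<sigma> ?n)(6 := replicate (eval tK x ?e) True @ \<sigma> ?n 6))"
      by (rule compile_correct[OF wf_tm_mono[OF tK(1)]]) (auto simp: invar_def load_def \<sigma>_def)
    also have "(\<sigma> ?n)(6 := replicate (eval tK x ?e) True @ \<sigma> ?n 6) = ?s"
      by (auto simp: \<sigma>_def load_def tK(2) fun_eq_iff)
    finally have 3: "runb (compile tK ?\<rho> 8 6) (\<sigma> ?n) (cost tK x ?e) ?s" .
    let ?t = "?s(1 := [])"
    have 4: "runb (clear 1) ?s (2 * k + 1) ?t"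
      by (rule runb_clear) (auto simp: \<sigma>_def load_def)
    let ?u = "?t(6 := [], 1 := replicate (K k) True)"
    have 5: "runb (mv 6 1) ?t (3 * K k + 1) ?u"
      by (rule runb_mv[where n = "K k"]) (auto simp: \<sigma>_def load_def fun_eq_iff)
    let ?v = "?u(0 := [])"
    have 6: "runb (clear 0) ?u (2 * length x + 1) ?v"
      by (rule runb_clear) (auto simp: \<sigma>_def load_def)
    have 7: "runb (move_bits 4 0) ?v (4 * ?n + 1) (?v(4 := [], 0 := ?o ?n))"
      by (rule runb_move_bits) (auto simp: \<sigma>_def load_def fun_eq_iff)
    have "runb ?P (load x k) (T x ?e) (?v(4 := [], 0 := ?o ?n))"
      by (rule runb_mono[OF runb_Seq[OF 1 runb_Seq[OF 2 runb_Seq[OF 3 runb_Seq[OF 4 runb_Seq[OF 5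
        runb_Seq[OF 6 7 order_refl] order_refl] order_refl] order_refl] order_refl] order_refl]])
        (simp add: T_def tL(2) tK(2))
    moreover have "T x ?e \<le> (k + 2) ^ c * (length x + 1) ^ c"
    proof -
      \<comment> \<open>A bound polynomial in \<open>length x + k\<close> splits into a parameter
        part and an input part because
        \<open>length x + k + 2 \<le> (k + 2) * (length x + 1)\<close>.\<close>
      have "T x ?e \<le> (length x + k + 2) ^ c" by (rule c) auto
      also have "\<dots> \<le> ((k + 2) * (length x + 1)) ^ c" by (rule power_mono) auto
      finally show ?thesis by (simp only: power_mult_distrib)
    qed
    ultimately obtain t where "t \<le> (k + 2) ^ c * (length x + 1) ^ c"
      "run ?P (load x k) t (?v(4 := [], 0 := ?o ?n))"
      unfolding runb_def using le_trans by blast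
    moreover have "(?v(4 := [], 0 := ?o ?n)) 1 = replicate (K k) True" "(?v(4 := [], 0 := ?o ?n)) 0 = ?o ?n"
      by simp_all
    ultimately show ?thesis by blast
  qed
  have c1: "computable (\<lambda>k. (k + 2) ^ c)"
    by (rule computable_ok, intro ok_power ok_add ok_var ok_const)
  have c2: "computable K"
    by (rule computable_ok[OF ok_True_False[OF K]])
  show ?thesis
    unfolding fpt_reducible_def
  proof (rule exI[of _ ?P], rule exI[of _ "\<lambda>k. (k + 2) ^ c"], rule exI[of _ K], rule exI[of _ c],
      intro conjI allI)
    fix x k
    obtain t s where "run ?P (load x k) t s" "s 1 = replicate (K k) True"
      "t \<le> (k + 2) ^ c * (length x + 1) ^ c" "s 0 = map (B x k) [0..<L x k]"
      using run[of x k] by blast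
    then show "\<exists>t s k'. run ?P (load x k) t s \<and> s 1 = replicate k' True \<and>
        t \<le> (k + 2) ^ c * (length x + 1) ^ c \<and> k' \<le> K k \<and> ((x, k) \<in> Q \<longleftrightarrow> (s 0, k') \<in> Q')"
      using corr[of x k] by (intro exI[of _ t] exI[of _ s] exI[of _ "K k"]) simp
  qed (rule c1, rule c2)
qed

text \<open>The first program may leave garbage on the stacks from 2 on, whereas the second expects
  them empty. The length of the garbage is bounded through the running time, so wiping it is
  affordable.\<close>

lemma fpt_reducible_trans:
  assumes "fpt_reducible Q1 Q2" "fpt_reducible Q2 Q3"
  shows "fpt_reducible Q1 Q3"
proof -
  obtain P f g c where f: "computable f" and g: "computable g" and
    1: "\<And>x k. \<exists>t s k'. run P (load x k) t s \<and> s 1 = replicate k' True \<and>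
        t \<le> f k * (length x + 1) ^ c \<and> k' \<le> g k \<and> ((x, k) \<in> Q1 \<longleftrightarrow> (s 0, k') \<in> Q2)"
    using assms(1) unfolding fpt_reducible_def by blast
  obtain P' f' g' c' where f': "computable f'" and g': "computable g'" and
    2: "\<And>x k. \<exists>t s k'. run P' (load x k) t s \<and> s 1 = replicate k' True \<and>
        t \<le> f' k * (length x + 1) ^ c' \<and> k' \<le> g' k \<and> ((x, k) \<in> Q2 \<longleftrightarrow> (s 0, k') \<in> Q3)"
    using assms(2) unfolding fpt_reducible_def by blast
  let ?b = "prog_bound P"
  let ?P = "Seq P (Seq (clears [2..<?b]) P')"
  \<comment> \<open>The intermediate parameter is only known to be at most \<open>g k\<close>, and
    \<open>f'\<close> and \<open>g'\<close> may fail to be monotone; hence the sums over all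
    arguments up to \<open>g k\<close>.\<close>
  define F where "F k = f k + (?b * (2 * (k + f k + 1) + 1) + 2) + (\<Sum>j<g k + 1. f' j) * (f k + 1) ^ c'" for k
  define G where "G k = (\<Sum>j<g k + 1. g' j)" for k
  define C where "C = (c + 1) + (c + 1) * c'"
  have "\<exists>t s k'. run ?P (load x k) t s \<and> s 1 = replicate k' True \<and>
        t \<le> F k * (length x + 1) ^ C \<and> k' \<le> G k \<and> ((x, k) \<in> Q1 \<longleftrightarrow> (s 0, k') \<in> Q3)" for x k
  proof -
    let ?n = "length x"
    obtain t s k' where s: "run P (load x k) t s" "s 1 = replicate k' True"
        "t \<le> f k * (?n + 1) ^ c" "k' \<le> g k" "(x, k) \<in> Q1 \<longleftrightarrow> (s 0, k') \<in> Q2"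
      using 1 by blast
    obtain t' s' k'' where s': "run P' (load (s 0) k') t' s'" "s' 1 = replicate k'' True"
        "t' \<le> f' k' * (length (s 0) + 1) ^ c'" "k'' \<le> g' k'" "(s 0, k') \<in> Q2 \<longleftrightarrow> (s' 0, k'') \<in> Q3"
      using 2 by blast
    \<comment> \<open>The exponent \<open>c + 1\<close> gives \<open>?n + 1 \<le> ?N\<close> also
      for \<open>c = 0\<close>.\<close>
    let ?N = "(?n + 1) ^ (c + 1)"
    have len0: "length (s i) \<le> length (load x k i) + t" for i
      using run_length[OF s(1)] .
    have N1: "?n + 1 \<le> ?N" by (rule self_le_power) auto
    have N2: "(?n + 1) ^ c \<le> ?N" by (rule power_increasing) auto
    have t: "t \<le> f k * ?N" using s(3) mult_le_mono2[OF N2] le_trans by blast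
    have k: "k \<le> k * ?N" using N1 by simp
    have len: "length (s i) \<le> (k + f k + 1) * ?N" for i
      using len0[of i] t k N1 unfolding load_def by (auto simp: algebra_simps split: if_splits)
    have untouched: "s i = []" if "?b \<le> i" "2 \<le> i" for i
      using run_untouched[OF s(1) that(1)] that(2) unfolding load_def by simp
    let ?m = "(k + f k + 1) * ?N"
    have "runb (clears [2..<?b]) s (?b * (2 * ?m + 1) + 2) (load (s 0) k')"
    proof (rule runb_clears[where m = ?m])
      show "length [2..<?b] * (2 * ?m + 1) + 2 \<le> ?b * (2 * ?m + 1) + 2"
        by (intro add_mono mult_le_mono) simp_all
      show "load (s 0) k' = (\<lambda>j. if j \<in> set [2..<?b] then [] else s j)"
        using untouched s(2) by (auto simp: load_def fun_eq_iff)
    qed (rule len)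
    then obtain u where u: "u \<le> ?b * (2 * ?m + 1) + 2" "run (clears [2..<?b]) s u (load (s 0) k')"
      unfolding runb_def by blast
    have u_le: "u \<le> (?b * (2 * (k + f k + 1) + 1) + 2) * ?N"
    proof -
      have "?b \<le> ?b * ?N" "2 \<le> 2 * ?N" using N1 by simp_all
      then show ?thesis using u(1) by (simp only: algebra_simps)
    qed
    have t'_le: "t' \<le> (\<Sum>j<g k + 1. f' j) * (f k + 1) ^ c' * ?N ^ c'"
    proof -
      have "length (s 0) + 1 \<le> (f k + 1) * ?N"
        using len0[of 0] t N1 unfolding load_def by (auto simp: algebra_simps)
      then have "(length (s 0) + 1) ^ c' \<le> ((f k + 1) * ?N) ^ c'" by (rule power_mono) simp
      moreover have "f' k' \<le> (\<Sum>j<g k + 1. f' j)"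
        using s(4) by (intro member_le_sum) auto
      ultimately have "f' k' * (length (s 0) + 1) ^ c' \<le> (\<Sum>j<g k + 1. f' j) * ((f k + 1) * ?N) ^ c'"
        by (rule mult_le_mono[rotated])
      then show ?thesis using s'(3) unfolding power_mult_distrib mult.assoc by linarith
    qed
    have N3: "?N \<le> (?n + 1) ^ C" and N4: "?N ^ c' \<le> (?n + 1) ^ C"
      unfolding C_def power_mult[symmetric] by (rule power_increasing; simp)+
    have "t \<le> f k * (?n + 1) ^ C"
      using le_trans[OF t mult_le_mono2[OF N3]] .
    moreover have "u \<le> (?b * (2 * (k + f k + 1) + 1) + 2) * (?n + 1) ^ C"
      using le_trans[OF u_le mult_le_mono2[OF N3]] .
    moreover have "t' \<le> (\<Sum>j<g k + 1. f' j) * (f k + 1) ^ c' * (?n + 1) ^ C"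
      using le_trans[OF t'_le mult_le_mono2[OF N4]] .
    ultimately have "t + (u + t') \<le> F k * (?n + 1) ^ C"
      unfolding F_def distrib_right by linarith
    moreover have "run ?P (load x k) (t + (u + t')) s'"
      using s(1) u(2) s'(1) by (intro run.seq)
    moreover have "k'' \<le> G k"
    proof -
      have "g' k' \<le> G k" unfolding G_def using s(4) by (intro member_le_sum) auto
      then show ?thesis using s'(4) by simp
    qed
    ultimately show ?thesis using s(5) s'(2,5) by blast
  qed
  moreover have "computable F"
    unfolding F_def
    by (rule computable_ok, intro ok_add ok_mult ok_sum ok_power ok_var ok_const
        ok_app[OF f] ok_app[OF f'] ok_app[OF g])
  moreover have "computable G"
    unfolding G_def
    by (rule computable_ok, intro ok_add ok_sum ok_var ok_const ok_app[OF g] ok_app[OF g'])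
  ultimately show ?thesis unfolding fpt_reducible_def by blast
qed

section \<open>Encodings of structures\<close>

text \<open>The value of a tuple read in base \<open>n\<close>, most significant entry first, that
  is, its lexicographic rank; \<open>tup\<close> is the inverse.\<close>

primrec idx :: "nat \<Rightarrow> nat list \<Rightarrow> nat" where
  "idx n [] = 0"
| "idx n (a # t) = a * n ^ length t + idx n t"

primrec tup :: "nat \<Rightarrow> nat \<Rightarrow> nat \<Rightarrow> nat list" where
  "tup n 0 q = []"
| "tup n (Suc r) q = q div n ^ r mod n # tup n r q"

definition tuple_set :: "nat \<Rightarrow> nat \<Rightarrow> nat list set" where
  "tuple_set n r = {t. length t = r \<and> set t \<subseteq> {..<n}}"

lemma tuples_eq: "tuples S r = tuple_set (card_univ S) r"
  by (simp add: tuples_def tuple_set_def univ_def)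

lemma length_tup [simp]: "length (tup n r q) = r"
  by (induction r) auto

lemma tup_in: "0 < n \<Longrightarrow> tup n r q \<in> tuple_set n r"
  by (induction r) (auto simp: tuple_set_def)

lemma nth_tup: "i < r \<Longrightarrow> tup n r q ! i = q div n ^ (r - 1 - i) mod n"
proof (induction r arbitrary: i)
  case (Suc r)
  then show ?case by (cases i) auto
qed simp

lemma idx_tup_mod: "idx n (tup n r q) = q mod n ^ r"
proof (induction r)
  case (Suc r)
  have "q mod n ^ Suc r = n ^ r * (q div n ^ r mod n) + q mod n ^ r"
    using mod_mult2_eq[of q "n ^ r" n] by (simp add: mult.commute)
  then show ?case using Suc by simp
qed simp

lemma idx_tup: "q < n ^ r \<Longrightarrow> idx n (tup n r q) = q"
  by (simp add: idx_tup_mod)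

lemma idx_less: "t \<in> tuple_set n r \<Longrightarrow> idx n t < n ^ r"
proof (induction t arbitrary: r)
  case (Cons a t)
  then obtain r' where r: "r = Suc r'" "length t = r'" "a < n" "t \<in> tuple_set n r'"
    by (auto simp: tuple_set_def)
  have "idx n (a # t) < a * n ^ r' + n ^ r'" using Cons.IH[OF r(4)] r(2) by simp
  also have "\<dots> = (a + 1) * n ^ r'" by simp
  also have "\<dots> \<le> n * n ^ r'" using r(3) by (intro mult_le_mono) auto
  finally show ?case using r(1) by simp
qed (simp add: tuple_set_def)

lemma div_mod_digit: "m < N \<Longrightarrow> (a * N + m) div N = (a::nat) \<and> (a * N + m) mod N = m"
  by (cases "N = 0") auto

lemma idx_inj: "t \<in> tuple_set n r \<Longrightarrow> u \<in> tuple_set n r \<Longrightarrow> idx n t = idx n u \<Longrightarrow> t = u"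
proof (induction t arbitrary: r u)
  case Nil
  then show ?case by (simp add: tuple_set_def)
next
  case (Cons a t)
  then obtain r' where r: "r = Suc r'" "length t = r'" "a < n" "t \<in> tuple_set n r'"
    by (auto simp: tuple_set_def)
  obtain b u' where u: "u = b # u'" "u' \<in> tuple_set n r'" "length u' = r'"
    using Cons.prems(2) r(1) by (cases u) (auto simp: tuple_set_def)
  have eq: "a * n ^ r' + idx n t = b * n ^ r' + idx n u'"
    using Cons.prems(3) u r by simp
  have "(a * n ^ r' + idx n t) div n ^ r' = a" "(a * n ^ r' + idx n t) mod n ^ r' = idx n t"
    using div_mod_digit[OF idx_less[OF r(4)]] by blast+
  moreover have "(b * n ^ r' + idx n u') div n ^ r' = b" "(b * n ^ r' + idx n u') mod n ^ r' = idx n u'"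
    using div_mod_digit[OF idx_less[OF u(2)]] by blast+
  ultimately have "a = b" "idx n t = idx n u'" using eq by metis+
  then show ?case using Cons.IH[OF r(4) u(2)] u(1) by simp
qed

lemma tup_idx: "t \<in> tuple_set n r \<Longrightarrow> tup n r (idx n t) = t"
proof -
  assume t: "t \<in> tuple_set n r"
  show ?thesis
  proof (cases "n = 0 \<and> r > 0")
    case True
    then show ?thesis using t by (auto simp: tuple_set_def)
  next
    case False
    then have "tup n r (idx n t) \<in> tuple_set n r"
      using tup_in[of n r] by (cases r) (auto simp: tuple_set_def)
    then show ?thesis using t idx_less[OF t] by (intro idx_inj) (auto simp: idx_tup)
  qed
qed

lemma bij_tup: "0 < n \<Longrightarrow> bij_betw (tup n r) {..<n ^ r} (tuple_set n r)"
  by (rule bij_betw_byWitness[where f' = "idx n"]) (auto simp: idx_tup tup_idx tup_in idx_less)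

lemma tup_mod: "0 < n \<Longrightarrow> tup n r (q mod n ^ r) = tup n r q"
  by (rule idx_inj[of _ n r]) (auto simp: tup_in idx_tup_mod)

lemma concat_map_upt:
  "concat (map (\<lambda>a. map (f a) [0..<m]) [0..<n]) = map (\<lambda>p. f (p div m) (p mod m)) [0..<n * m]"
proof (induction n)
  case (Suc n)
  have "[0..<Suc n * m] = [0..<n * m] @ [n * m..<n * m + m]"
    using upt_add_eq_append[of 0 "n * m" m] by (simp add: add.commute)
  also have "[n * m..<n * m + m] = map ((+) (n * m)) [0..<m]"
    by (rule nth_equalityI) auto
  finally have "[0..<Suc n * m] = [0..<n * m] @ map ((+) (n * m)) [0..<m]" .
  moreover have "map ((\<lambda>p. f (p div m) (p mod m)) \<circ> (+) (n * m)) [0..<m] = map (f n) [0..<m]"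
    by (rule map_cong) auto
  ultimately show ?case using Suc by simp
qed simp

text \<open>The lexicographic order of tuples is the numerical order of their base \<open>n\<close>
  values, so truth tables can be addressed arithmetically.\<close>

lemma product_lists_upt: "0 < n \<Longrightarrow> product_lists (replicate r [0..<n]) = map (tup n r) [0..<n ^ r]"
proof (induction r)
  case (Suc r)
  then have "product_lists (replicate (Suc r) [0..<n]) =
    concat (map (\<lambda>a. map (\<lambda>q. a # tup n r q) [0..<n ^ r]) [0..<n])"
    by (simp add: o_def)
  also have "\<dots> = map (\<lambda>p. p div n ^ r # tup n r (p mod n ^ r)) [0..<n * n ^ r]"
    by (rule concat_map_upt)
  also have "\<dots> = map (tup n (Suc r)) [0..<n ^ Suc r]"
    using Suc.prems by (auto simp: tup_mod less_mult_imp_div_less)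
  finally show ?case .
qed simp

lemma concat_blocks_length: "length (concat (map (\<lambda>i. map (f i) [0..<m i]) [0..<l])) = (\<Sum>i<l. m i)"
  by (induction l) auto

lemma concat_blocks_nth:
  "i < l \<Longrightarrow> q < m i \<Longrightarrow> concat (map (\<lambda>i. map (f i) [0..<m i]) [0..<l]) ! ((\<Sum>j<i. m j) + q) = f i q"
proof (induction l)
  case (Suc l)
  let ?C = "concat (map (\<lambda>i. map (f i) [0..<m i]) [0..<l])"
  show ?case
  proof (cases "i = l")
    case True
    then show ?thesis using Suc.prems by (simp add: nth_append concat_blocks_length)
  next
    case False
    then have i: "i < l" using Suc.prems by simp
    have "(\<Sum>j<i. m j) + q < (\<Sum>j<Suc i. m j)" using Suc.prems by simp
    also have "\<dots> \<le> (\<Sum>j<l. m j)" using i by (intro sum_mono2) auto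
    finally show ?thesis using Suc i by (simp add: nth_append concat_blocks_length)
  qed
qed simp

lemma concat_blocks_eq:
  "length y = (\<Sum>i<l. m i) \<Longrightarrow>
    concat (map (\<lambda>i. map (\<lambda>q. y ! ((\<Sum>j<i. m j) + q)) [0..<m i]) [0..<l]) = y"
proof (induction l arbitrary: y)
  case (Suc l)
  let ?M = "\<Sum>i<l. m i"
  have M: "(\<Sum>j<i. m j) + q < ?M" if "i < l" "q < m i" for i q
  proof -
    have "(\<Sum>j<i. m j) + q < (\<Sum>j<Suc i. m j)" using that by simp
    also have "\<dots> \<le> ?M" using that by (intro sum_mono2) auto
    finally show ?thesis .
  qed
  have "concat (map (\<lambda>i. map (\<lambda>q. take ?M y ! ((\<Sum>j<i. m j) + q)) [0..<m i]) [0..<l]) = take ?M y"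
    by (rule Suc.IH) (use Suc.prems in simp)
  moreover have "map (\<lambda>i. map (\<lambda>q. take ?M y ! ((\<Sum>j<i. m j) + q)) [0..<m i]) [0..<l] =
    map (\<lambda>i. map (\<lambda>q. y ! ((\<Sum>j<i. m j) + q)) [0..<m i]) [0..<l]"
    using M by auto
  moreover have "map (\<lambda>q. y ! (?M + q)) [0..<m l] = drop ?M y"
    by (rule nth_equalityI) (use Suc.prems in auto)
  ultimately show ?case by simp
qed simp

text \<open>The start of the table of relation \<open>i\<close>, behind the \<open>n\<close> True
  bits and the False that ends them; for \<open>i = length V\<close> it is the length of the entire
  code.\<close>

definition offset :: "vocabulary \<Rightarrow> nat \<Rightarrow> nat \<Rightarrow> nat" where
  "offset V n i = n + 1 + (\<Sum>j<i. n ^ (V ! j))"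

definition code_card :: "bool list \<Rightarrow> nat" where
  "code_card x = length (takeWhile id x)"

definition valid_code :: "vocabulary \<Rightarrow> bool list \<Rightarrow> bool" where
  "valid_code V x \<longleftrightarrow> 0 < code_card x \<and> length x = offset V (code_card x) (length V)"

definition decode :: "vocabulary \<Rightarrow> bool list \<Rightarrow> relstruct" where
  "decode V x = \<lparr>card_univ = code_card x,
     rels = map (\<lambda>i. {t \<in> tuple_set (code_card x) (V ! i). x ! (offset V (code_card x) i + idx (code_card x) t)})
       [0..<length V]\<rparr>"

lemma encode_eq:
  assumes "S \<in> structures V"
  shows "encode V S = replicate (card_univ S) True @ False #
    concat (map (\<lambda>i. map (\<lambda>q. tup (card_univ S) (V ! i) q \<in> rels S ! i) [0..<card_univ S ^ (V ! i)])
      [0..<length V])"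
proof -
  have S: "0 < card_univ S" "length (rels S) = length V"
    using assms by (auto simp: structures_def univ_def)
  have "zip V (rels S) = map (\<lambda>i. (V ! i, rels S ! i)) [0..<length V]"
    using S by (intro nth_equalityI) auto
  then show ?thesis
    unfolding encode_def using S by (simp add: product_lists_upt o_def split_beta)
qed

lemma length_encode: "S \<in> structures V \<Longrightarrow> length (encode V S) = offset V (card_univ S) (length V)"
  by (simp add: encode_eq offset_def concat_blocks_length)

lemma code_card_encode: "S \<in> structures V \<Longrightarrow> code_card (encode V S) = card_univ S"
  unfolding encode_eq code_card_def by (subst takeWhile_append2) auto

lemma valid_encode: "S \<in> structures V \<Longrightarrow> valid_code V (encode V S)"
  by (auto simp: valid_code_def code_card_encode length_encode structures_def univ_def)

lemma decode_encode:
  assumes S: "S \<in> structures V"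
  shows "decode V (encode V S) = S"
proof -
  let ?n = "card_univ S"
  have "rels (decode V (encode V S)) ! i = rels S ! i" if i: "i < length V" for i
  proof -
    have *: "encode V S ! (offset V ?n i + idx ?n t) = (t \<in> rels S ! i)" if "t \<in> tuple_set ?n (V ! i)" for t
    proof -
      have "encode V S ! (offset V ?n i + idx ?n t) = (tup ?n (V ! i) (idx ?n t) \<in> rels S ! i)"
        using concat_blocks_nth[OF i, of "idx ?n t" "\<lambda>i. ?n ^ (V ! i)"] idx_less[OF that]
        unfolding encode_eq[OF S] offset_def by (simp add: nth_append)
      then show ?thesis using tup_idx[OF that] by simp
    qed
    have "rels S ! i \<subseteq> tuple_set ?n (V ! i)" using S i by (simp add: structures_def tuples_eq)
    then show ?thesis using i * by (auto simp: decode_def code_card_encode[OF S])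
  qed
  moreover have "length (rels S) = length V" using S by (simp add: structures_def)
  ultimately have "rels (decode V (encode V S)) = rels S"
    by (intro nth_equalityI) (auto simp: decode_def)
  moreover have "card_univ (decode V (encode V S)) = ?n"
    by (simp add: decode_def code_card_encode[OF S])
  ultimately show ?thesis by simp
qed

lemma decode_structure: "valid_code V x \<Longrightarrow> decode V x \<in> structures V"
  by (auto simp: valid_code_def decode_def structures_def univ_def tuples_eq lessThan_empty_iff)

text \<open>Every filling of the tables belongs to some structure, so a string is a code as soon as
  its prefix of True bits is nonempty and fits its length.\<close>

lemma encode_decode:
  assumes "valid_code V x"
  shows "encode V (decode V x) = x"
proof -
  let ?n = "code_card x"
  let ?y = "drop (?n + 1) x"
  have n: "0 < ?n" "length x = offset V ?n (length V)" using assms by (auto simp: valid_code_def)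
  then have "?n < length x" by (simp add: offset_def)
  then have F: "\<not> x ! ?n" unfolding code_card_def using nth_length_takeWhile[of id x] by simp
  have T: "take ?n x = replicate ?n True"
    unfolding code_card_def takeWhile_eq_take[symmetric]
    by (rule replicate_eqI) (auto dest: set_takeWhileD)
  have "x = take ?n x @ x ! ?n # ?y" using id_take_nth_drop[OF \<open>?n < length x\<close>] by simp
  then have x: "x = replicate ?n True @ False # ?y" using T F by simp
  have y: "length ?y = (\<Sum>i<length V. ?n ^ (V ! i))" using n by (simp add: offset_def)
  have "encode V (decode V x) = replicate ?n True @ False #
    concat (map (\<lambda>i. map (\<lambda>q. tup ?n (V ! i) q \<in> rels (decode V x) ! i) [0..<?n ^ (V ! i)]) [0..<length V])"
    unfolding encode_eq[OF decode_structure[OF assms]] by (simp add: decode_def)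
  also have "map (\<lambda>i. map (\<lambda>q. tup ?n (V ! i) q \<in> rels (decode V x) ! i) [0..<?n ^ (V ! i)]) [0..<length V] =
    map (\<lambda>i. map (\<lambda>q. ?y ! ((\<Sum>j<i. ?n ^ (V ! j)) + q)) [0..<?n ^ (V ! i)]) [0..<length V]"
  proof (intro map_cong refl)
    fix i q assume iq: "i \<in> set [0..<length V]" "q \<in> set [0..<?n ^ (V ! i)]"
    have "(tup ?n (V ! i) q \<in> rels (decode V x) ! i) = x ! (offset V ?n i + q)"
      using iq n tup_in[of ?n] by (simp add: decode_def idx_tup)
    also have "\<dots> = ?y ! ((\<Sum>j<i. ?n ^ (V ! j)) + q)"
      using \<open>?n < length x\<close> by (simp add: offset_def add.assoc)
    finally show "(tup ?n (V ! i) q \<in> rels (decode V x) ! i) = ?y ! ((\<Sum>j<i. ?n ^ (V ! j)) + q)" .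
  qed
  also have "concat \<dots> = ?y" by (rule concat_blocks_eq[OF y])
  finally show ?thesis using x by simp
qed

lemma encode_problem_iff:
  assumes "Q \<subseteq> structures V \<times> UNIV"
  shows "(x, k) \<in> encode_problem V Q \<longleftrightarrow> valid_code V x \<and> (decode V x, k) \<in> Q"
proof
  assume "(x, k) \<in> encode_problem V Q"
  then obtain S where S: "x = encode V S" "(S, k) \<in> Q" by (auto simp: encode_problem_def)
  then have "S \<in> structures V" using assms by auto
  then show "valid_code V x \<and> (decode V x, k) \<in> Q" using S by (simp add: valid_encode decode_encode)
next
  assume "valid_code V x \<and> (decode V x, k) \<in> Q"
  then show "(x, k) \<in> encode_problem V Q"
    unfolding encode_problem_def using encode_decode[of V x] by (intro CollectI exI[of _ "decode V x"] exI[of _ k]) simp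
qed

lemma p_models_iff:
  "(x, k) \<in> encode_problem V (p_models cmp s V \<phi>) \<longleftrightarrow>
    valid_code V x \<and> so_models cmp s (decode V x) k \<phi>"
  using decode_structure[of V x]
  by (subst encode_problem_iff) (auto simp: p_models_def)

lemma p_models_undirected_iff:
  "(x, k) \<in> encode_problem graph_voc (p_models cmp s graph_voc \<phi> \<inter> undirected_graphs \<times> UNIV) \<longleftrightarrow>
    valid_code graph_voc x \<and> decode graph_voc x \<in> undirected_graphs \<and> so_models cmp s (decode graph_voc x) k \<phi>"
  using decode_structure[of graph_voc x]
  by (subst encode_problem_iff) (auto simp: p_models_def)

lemma encode_mem_p_models:
  "S \<in> structures V \<Longrightarrow> (encode V S, k) \<in> encode_problem V (p_models cmp s V \<phi>) \<longleftrightarrow> so_models cmp s S k \<phi>"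
  by (simp add: p_models_iff valid_encode decode_encode)

lemma encode_mem_p_models_undirected:
  "S \<in> undirected_graphs \<Longrightarrow>
    (encode graph_voc S, k) \<in> encode_problem graph_voc (p_models cmp s graph_voc \<phi> \<inter> undirected_graphs \<times> UNIV) \<longleftrightarrow>
    so_models cmp s S k \<phi>"
  by (subst p_models_undirected_iff) (simp add: valid_encode decode_encode undirected_graphs_def)

lemma less_length_takeWhile: "i < length (takeWhile P xs) \<longleftrightarrow> (\<forall>j<Suc i. j < length xs \<and> P (xs ! j))"
proof (induction xs arbitrary: i)
  case (Cons a xs)
  show ?case
  proof (cases i)
    case (Suc i')
    have "(\<forall>j<Suc i. j < length (a # xs) \<and> P ((a # xs) ! j)) \<longleftrightarrow>
      P a \<and> (\<forall>j<i. j < length xs \<and> P (xs ! j))"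
      unfolding Suc by (subst All_less_Suc2) simp
    then show ?thesis using Suc Cons.IH[of i'] by simp
  qed auto
qed auto

text \<open>A form that terms can express: the leading True bits are counted as the positions up to
  which every bit is True.\<close>

lemma code_card_eq: "code_card x = (\<Sum>i<length x. of_bool (\<forall>j<Suc i. j < length x \<and> x ! j))"
proof -
  have "{..<length x} \<inter> {i. \<forall>j<Suc i. j < length x \<and> x ! j} = {..<code_card x}"
    unfolding code_card_def using less_length_takeWhile[of _ id x] length_takeWhile_le[of id x]
    by (auto simp: subset_iff dest: less_le_trans)
  then show ?thesis by (simp only: sum_of_bool_eq finite_lessThan card_lessThan of_nat_id)
qed

lemma ok_code_card: "ok z (\<lambda>x e. code_card x)"
  unfolding code_card_eq Suc_eq_plus1
  by (intro ok_sum ok_length ok_of_bool okb_all ok_add ok_var ok_const okb_bit)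

lemma ok_offset: "ok z F \<Longrightarrow> ok z (\<lambda>x e. offset V (F x e) i)"
  unfolding offset_def by (intro ok_add ok_const ok_sum_const ok_power)

lemma okb_valid_code: "okb z (\<lambda>x e. valid_code V x)"
  unfolding valid_code_def
  by (intro okb_conj okb_less okb_eq ok_const ok_length ok_code_card ok_offset)

subsection \<open>Graphs\<close>

definition graph :: "nat \<Rightarrow> (nat \<Rightarrow> nat \<Rightarrow> bool) \<Rightarrow> relstruct" where
  "graph N E = \<lparr>card_univ = N, rels = [{[u, v] |u v. u < N \<and> v < N \<and> E u v}]\<rparr>"

lemma graph_structure: "0 < N \<Longrightarrow> graph N E \<in> structures graph_voc"
  by (auto simp: graph_def structures_def univ_def tuples_def)

lemma graph_undirected: "0 < N \<Longrightarrow> (\<And>u v. E u v \<Longrightarrow> E v u) \<Longrightarrow> graph N E \<in> undirected_graphs"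
  using graph_structure[of N E] by (auto simp: undirected_graphs_def graph_def)

text \<open>A single bit of the code of \<open>graph N E\<close>; position \<open>N\<close>
  satisfies neither alternative, which yields the separating False.\<close>

definition graph_code :: "nat \<Rightarrow> (nat \<Rightarrow> nat \<Rightarrow> bool) \<Rightarrow> nat \<Rightarrow> bool" where
  "graph_code N E i \<longleftrightarrow> i < N \<or> (N < i \<and> E ((i - N - 1) div N) ((i - N - 1) mod N))"

lemma encode_graph:
  assumes "0 < N"
  shows "encode graph_voc (graph N E) = map (graph_code N E) [0..<N + 1 + N * N]"
proof -
  have "[0..<N + 1 + N * N] = [0..<N] @ N # [N + 1..<N + 1 + N * N]"
    using upt_add_eq_append[of 0 N "1 + N * N"] upt_rec[of N "N + 1 + N * N"] by (simp add: add.assoc)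
  also have "[N + 1..<N + 1 + N * N] = map ((+) (N + 1)) [0..<N * N]"
    by (rule nth_equalityI) (auto simp del: upt_Suc)
  finally have eq: "[0..<N + 1 + N * N] = [0..<N] @ N # map ((+) (N + 1)) [0..<N * N]" .
  have "map (graph_code N E) [0..<N] = replicate N True"
    by (rule nth_equalityI) (auto simp: graph_code_def)
  moreover have "map (graph_code N E) (map ((+) (N + 1)) [0..<N * N]) =
    map (\<lambda>q. E (q div N) (q mod N)) [0..<N * N]"
    by (auto simp: graph_code_def)
  moreover have "\<not> graph_code N E N" by (simp add: graph_code_def)
  ultimately have "map (graph_code N E) [0..<N + 1 + N * N] = replicate N True @ False #
    map (\<lambda>q. E (q div N) (q mod N)) [0..<N * N]"
    unfolding eq by (simp only: map_append list.map simp_thms)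
  moreover have "encode graph_voc (graph N E) = replicate N True @ False #
    map (\<lambda>q. tup N 2 q \<in> {[u, v] |u v. u < N \<and> v < N \<and> E u v}) [0..<N ^ 2]"
    by (subst encode_eq[OF graph_structure[OF assms]]) (simp add: graph_def)
  moreover have "tup N 2 q \<in> {[u, v] |u v. u < N \<and> v < N \<and> E u v} \<longleftrightarrow> E (q div N) (q mod N)"
    if "q < N * N" for q
    using that assms by (auto simp: numeral_2_eq_2 less_mult_imp_div_less)
  ultimately show ?thesis by (simp add: power2_eq_square cong: map_cong)
qed

lemma okb_graph_code:
  assumes "ok z N" "okb z (\<lambda>x e. E x (e 0) (e 1) (\<lambda>i. e (i + 2)))" "ok z I"
  shows "okb z (\<lambda>x e. graph_code (N x e) (\<lambda>u v. E x u v e) (I x e))"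
proof -
  have "okb z (\<lambda>x e. E x ((I x e - N x e - 1) div N x e) ((I x e - N x e - 1) mod N x e) e)"
  proof (rule okb_let[where P = "\<lambda>x u e. E x u ((I x e - N x e - 1) mod N x e) e"])
    show "ok z (\<lambda>x e. (I x e - N x e - 1) div N x e)"
      by (intro ok_div ok_diff ok_const assms)
    show "okb z (\<lambda>x e. E x (e 0) ((I x (\<lambda>i. e (Suc i)) - N x (\<lambda>i. e (Suc i)) - 1) mod N x (\<lambda>i. e (Suc i)))
      (\<lambda>i. e (Suc i)))"
    proof (rule okb_let[where P = "\<lambda>x v e. E x (e 0) v (\<lambda>i. e (Suc i))"])
      show "ok z (\<lambda>x e. (I x (\<lambda>i. e (Suc i)) - N x (\<lambda>i. e (Suc i)) - 1) mod N x (\<lambda>i. e (Suc i)))"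
        by (intro ok_mod ok_diff ok_const ok_rename[OF assms(1)] ok_rename[OF assms(3)])
      show "okb z (\<lambda>x e. E x (e (Suc 0)) (e 0) (\<lambda>i. e (Suc (Suc i))))"
        using okb_rename[OF assms(2), of "\<lambda>i. if i = 0 then 1 else if i = 1 then 0 else i"]
        by simp
    qed
  qed
  then show ?thesis
    unfolding graph_code_def by (intro okb_disj okb_conj okb_less assms)
qed

subsection \<open>Quantifier prefixes\<close>

text \<open>The patterns contain \<open>aa\<close> or \<open>ae\<close> only as subsequences. The
  surplus quantifiers bind variables that do not occur in the matrix and are vacuous because the
  universe is nonempty.\<close>

lemma holds_append_const:
  assumes "univ S \<noteq> {}"
    "\<And>us. length us = length p \<Longrightarrow> set us \<subseteq> univ S \<Longrightarrow> holds S (env @ us) (q, a) \<longleftrightarrow> b"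
  shows "holds S env (p @ q, a) \<longleftrightarrow> b"
  using assms(2)
proof (induction p arbitrary: env)
  case Nil
  then show ?case using Nil[of "[]"] by simp
next
  case (Cons Q p)
  have "holds S (env @ [u]) (p @ q, a) \<longleftrightarrow> b" if "u \<in> univ S" for u
    by (rule Cons.IH) (use Cons.prems[of "u # us" for us] that in auto)
  then show ?case using assms(1) by (cases Q) auto
qed

lemma holds_const:
  assumes "univ S \<noteq> {}"
    "\<And>us. length us = length p \<Longrightarrow> set us \<subseteq> univ S \<Longrightarrow> holds_qf S (env @ us) a \<longleftrightarrow> b"
  shows "holds S env (p, a) \<longleftrightarrow> b"
  using holds_append_const[of S p env "[]" a b] assms by simp

lemma subseq_Cons_append: "subseq (x # xs) ys \<Longrightarrow> \<exists>us vs. ys = us @ x # vs \<and> subseq xs vs"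
  using list_emb_ConsD[of "(=)" x xs ys] by auto

lemma holds_replicate_All:
  "holds S env (replicate l QAll, a) \<longleftrightarrow> (\<forall>t\<in>tuples S l. holds_qf S (env @ t) a)"
proof (induction l arbitrary: env)
  case (Suc l)
  have "tuples S (Suc l) = (\<lambda>(u, t). u # t) ` (univ S \<times> tuples S l)"
    by (auto simp: tuples_def length_Suc_conv image_iff)
  then show ?case using Suc by auto
qed (simp add: tuples_def)

section \<open>Counting satisfying assignments by local terms\<close>

primrec nocc :: "nat \<Rightarrow> qf_formula \<Rightarrow> nat" where
  "nocc r Falsum = 0"
| "nocc r (Equal x y) = 0"
| "nocc r (Atom R xs) = of_bool (R = r)"
| "nocc r (Neg a) = nocc r a"
| "nocc r (Conj a b) = nocc r a + nocc r b"
| "nocc r (Disj a b) = nocc r a + nocc r b"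

text \<open>Evaluation where the \<open>j\<close>-th occurrence of relation symbol \<open>r\<close> has its own interpretation
  \<open>f j\<close> and \<open>b\<close> gives the truth values of the other atoms, and the arithmetization of this
  evaluation, which is affine in each \<open>y j\<close>.\<close>

primrec oev :: "nat \<Rightarrow> (qf_formula \<Rightarrow> bool) \<Rightarrow> (nat \<Rightarrow> nat list \<Rightarrow> bool) \<Rightarrow> qf_formula \<Rightarrow> bool" where
  "oev r b f Falsum = False"
| "oev r b f (Equal x y) = b (Equal x y)"
| "oev r b f (Atom R xs) = (if R = r then f 0 xs else b (Atom R xs))"
| "oev r b f (Neg a) = (\<not> oev r b f a)"
| "oev r b f (Conj a c) = (oev r b f a \<and> oev r b (\<lambda>j. f (j + nocc r a)) c)"
| "oev r b f (Disj a c) = (oev r b f a \<or> oev r b (\<lambda>j. f (j + nocc r a)) c)"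

primrec pev :: "nat \<Rightarrow> (qf_formula \<Rightarrow> bool) \<Rightarrow> (nat \<Rightarrow> nat list \<Rightarrow> int) \<Rightarrow> qf_formula \<Rightarrow> int" where
  "pev r b y Falsum = 0"
| "pev r b y (Equal u v) = of_bool (b (Equal u v))"
| "pev r b y (Atom R xs) = (if R = r then y 0 xs else of_bool (b (Atom R xs)))"
| "pev r b y (Neg a) = 1 - pev r b y a"
| "pev r b y (Conj a c) = pev r b y a * pev r b (\<lambda>j. y (j + nocc r a)) c"
| "pev r b y (Disj a c) = 1 - (1 - pev r b y a) * (1 - pev r b (\<lambda>j. y (j + nocc r a)) c)"

lemma pev_of_bool: "pev r b (\<lambda>j xs. of_bool (f j xs)) a = of_bool (oev r b f a)"
  by (induction a arbitrary: f) auto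

lemma pev_cong: "(\<And>j. j < nocc r a \<Longrightarrow> y j = y' j) \<Longrightarrow> pev r b y a = pev r b y' a"
proof (induction a arbitrary: y y')
  case (Conj a c)
  have "pev r b y a = pev r b y' a" by (rule Conj.IH) (use Conj.prems in auto)
  moreover have "pev r b (\<lambda>j. y (j + nocc r a)) c = pev r b (\<lambda>j. y' (j + nocc r a)) c"
    by (rule Conj.IH) (use Conj.prems in auto)
  ultimately show ?case by simp
next
  case (Disj a c)
  have "pev r b y a = pev r b y' a" by (rule Disj.IH) (use Disj.prems in auto)
  moreover have "pev r b (\<lambda>j. y (j + nocc r a)) c = pev r b (\<lambda>j. y' (j + nocc r a)) c"
    by (rule Disj.IH) (use Disj.prems in auto)
  ultimately show ?case by simp
next
  case (Neg a)
  have "pev r b y a = pev r b y' a" by (rule Neg.IH) (use Neg.prems in auto)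
  then show ?case by simp
qed auto

text \<open>Each occurrence lies in exactly one factor of every product, so the value has the form
  \<open>u * y j xs + v\<close> with \<open>u\<close> and \<open>v\<close> independent of
  \<open>y j\<close>; for weights of sum 1 the constant part survives unchanged.\<close>

lemma pev_affine:
  assumes "(\<Sum>i\<in>I. w i) = 1"
  shows "pev r b (y(j := \<lambda>xs. \<Sum>i\<in>I. w i * z i xs)) a = (\<Sum>i\<in>I. w i * pev r b (y(j := z i)) a)"
proof -
  have sub: "1 - (\<Sum>i\<in>I. w i * F i) = (\<Sum>i\<in>I. w i * (1 - F i))" for F
    using assms by (simp add: right_diff_distrib sum_subtractf)
  show ?thesis
  proof (induction a arbitrary: y j)
    case Falsum
    show ?case by simp
  next
    case (Equal u v)
    show ?case using assms by (simp flip: sum_distrib_right)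
  next
    case (Atom R xs)
    show ?case
    proof (cases "R = r \<and> j = 0")
      case False
      then have "pev r b (y(j := g)) (Atom R xs) = pev r b y (Atom R xs)" for g by auto
      then show ?thesis using assms by (simp flip: sum_distrib_right)
    qed simp
  next
    case (Neg a)
    show ?case by (simp only: pev.simps Neg.IH sub)
  next
    case (Conj a c)
    let ?m = "nocc r a"
    show ?case
    proof (cases "j < ?m")
      case True
      then have "(\<lambda>j'. (y(j := g)) (j' + ?m)) = (\<lambda>j'. y (j' + ?m))" for g by (auto simp: fun_eq_iff)
      then show ?thesis
        by (simp only: pev.simps Conj.IH(1) sum_distrib_right mult.assoc)
    next
      case False
      then have s: "(\<lambda>j'. (y(j := g)) (j' + ?m)) = (\<lambda>j'. y (j' + ?m))(j - ?m := g)" for g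
        by (auto simp: fun_eq_iff)
      have "pev r b (y(j := g)) a = pev r b y a" for g
        by (rule pev_cong) (use False in auto)
      then show ?thesis
        by (simp only: pev.simps Conj.IH(2) s sum_distrib_left mult.left_commute)
    qed
  next
    case (Disj a c)
    let ?m = "nocc r a"
    show ?case
    proof (cases "j < ?m")
      case True
      then have "(\<lambda>j'. (y(j := g)) (j' + ?m)) = (\<lambda>j'. y (j' + ?m))" for g by (auto simp: fun_eq_iff)
      then show ?thesis
        by (simp only: pev.simps Disj.IH(1) sub sum_distrib_right mult.assoc)
    next
      case False
      then have s: "(\<lambda>j'. (y(j := g)) (j' + ?m)) = (\<lambda>j'. y (j' + ?m))(j - ?m := g)" for g
        by (auto simp: fun_eq_iff)
      have c: "pev r b (y(j := g)) a = pev r b y a" for g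
        by (rule pev_cong) (use False in auto)
      have "(1 - pev r b y a) * (\<Sum>i\<in>I. w i * F i) = (\<Sum>i\<in>I. w i * ((1 - pev r b y a) * F i))" for F
        by (simp add: sum_distrib_left mult.left_commute)
      then show ?thesis
        by (simp only: pev.simps Disj.IH(2) s c sub)
    qed
qed
qed

section \<open>Expansion of the arithmetization over all occurrences\<close>

definition digit :: "nat \<Rightarrow> nat \<Rightarrow> nat \<Rightarrow> nat" where
  "digit K p j = p div K ^ j mod K"

lemma digit_less: "0 < K \<Longrightarrow> digit K p j < K"
  by (simp add: digit_def)

text \<open>Digits are numbered from the least significant one, entries of \<open>tup\<close> from
  the most significant one.\<close>

lemma digit_nth_tup: "j < r \<Longrightarrow> digit K p j = tup K r p ! (r - 1 - j)"
  by (subst nth_tup) (auto simp: digit_def)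

lemma digit_mod:
  assumes "0 < K" "j < r"
  shows "digit K (p mod K ^ r) j = digit K p j"
  using assms digit_nth_tup[of j r K] tup_mod[of K r p] by simp

lemma digit_exists:
  assumes "\<And>j. j < D \<Longrightarrow> d j < w"
  shows "\<exists>q<w ^ D. \<forall>j<D. digit w q j = d j"
proof -
  let ?t = "map (\<lambda>i. d (D - 1 - i)) [0..<D]"
  have t: "?t \<in> tuple_set w D" using assms by (auto simp: tuple_set_def)
  have "digit w (idx w ?t) j = d j" if "j < D" for j
    unfolding digit_nth_tup[OF that] tup_idx[OF t] using that by simp
  then show ?thesis using idx_less[OF t] by blast
qed

lemma sum_div_mod: "(\<Sum>i<(K::nat). \<Sum>p<M. H i p) = (\<Sum>q<K * M. H (q div M) (q mod M))"
proof (induction K)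
  case (Suc K)
  have "(\<Sum>q<Suc K * M. H (q div M) (q mod M)) =
    (\<Sum>q<K * M. H (q div M) (q mod M)) + (\<Sum>q\<in>{K * M..<K * M + M}. H (q div M) (q mod M))"
    using sum.atLeastLessThan_concat[of 0 "K * M" "K * M + M" "\<lambda>q. H (q div M) (q mod M)"]
    by (simp add: atLeast0LessThan add.commute)
  also have "(\<Sum>q\<in>{K * M..<K * M + M}. H (q div M) (q mod M)) = (\<Sum>p<M. H K p)"
  proof (rule sum.reindex_bij_witness[where i = "\<lambda>p. K * M + p" and j = "\<lambda>q. q - K * M"])
    fix q assume "q \<in> {K * M..<K * M + M}"
    then have "q = K * M + (q - K * M)" "q - K * M < M" by auto
    then show "H K (q - K * M) = H (q div M) (q mod M)" by (metis div_mod_digit)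
  qed auto
  finally show ?case using Suc by simp
qed simp

text \<open>\<open>p\<close> in base \<open>K\<close> encodes one choice of a summand for each of
  the \<open>D\<close> occurrences. The induction expands the last occurrence first, whose choice
  becomes the leading digit.\<close>

lemma pev_multi_affine:
  assumes "0 < K" "(\<Sum>i<K. w i) = 1"
  shows "pev r b (\<lambda>j xs. if j < D then \<Sum>i<K. w i * z j i xs else y j xs) a =
    (\<Sum>p<K ^ D. (\<Prod>j<D. w (digit K p j)) * pev r b (\<lambda>j xs. if j < D then z j (digit K p j) xs else y j xs) a)"
proof (induction D arbitrary: y)
  case (Suc D)
  let ?Y = "\<lambda>y j xs. if j < D then \<Sum>i<K. w i * z j i xs else y j xs"
  have "(\<lambda>j xs. if j < Suc D then \<Sum>i<K. w i * z j i xs else y j xs) =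
      (?Y y)(D := \<lambda>xs. \<Sum>i<K. w i * z D i xs)"
    by (auto simp: fun_eq_iff less_Suc_eq)
  then have "pev r b (\<lambda>j xs. if j < Suc D then \<Sum>i<K. w i * z j i xs else y j xs) a =
      (\<Sum>i<K. w i * pev r b ((?Y y)(D := z D i)) a)"
    using pev_affine[OF assms(2)] by simp
  also have "\<dots> = (\<Sum>i<K. w i * pev r b (?Y (y(D := z D i))) a)"
  proof (rule sum.cong[OF refl])
    fix i
    have "(?Y y)(D := z D i) = ?Y (y(D := z D i))" by (auto simp: fun_eq_iff)
    then show "w i * pev r b ((?Y y)(D := z D i)) a = w i * pev r b (?Y (y(D := z D i))) a" by simp
  qed
  also have "\<dots> = (\<Sum>i<K. \<Sum>p<K ^ D. w i * ((\<Prod>j<D. w (digit K p j)) *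
      pev r b (\<lambda>j xs. if j < D then z j (digit K p j) xs else (y(D := z D i)) j xs) a))"
    unfolding Suc.IH by (simp add: sum_distrib_left)
  also have "\<dots> = (\<Sum>q<K * K ^ D. w (q div K ^ D) * ((\<Prod>j<D. w (digit K (q mod K ^ D) j)) *
      pev r b (\<lambda>j xs. if j < D then z j (digit K (q mod K ^ D) j) xs else (y(D := z D (q div K ^ D))) j xs) a))"
    by (rule sum_div_mod)
  also have "\<dots> = (\<Sum>p<K ^ Suc D. (\<Prod>j<Suc D. w (digit K p j)) *
      pev r b (\<lambda>j xs. if j < Suc D then z j (digit K p j) xs else y j xs) a)"
  proof (rule sum.cong)
    fix q assume "q \<in> {..<K ^ Suc D}"
    then have "q div K ^ D < K" by (simp add: less_mult_imp_div_less)
    then have D: "digit K q D = q div K ^ D" by (simp add: digit_def)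
    have "(\<lambda>j xs. if j < D then z j (digit K (q mod K ^ D) j) xs else (y(D := z D (q div K ^ D))) j xs) =
      (\<lambda>j xs. if j < Suc D then z j (digit K q j) xs else y j xs)"
      using digit_mod[OF assms(1)] D by (auto simp: fun_eq_iff less_Suc_eq)
    moreover have "(\<Prod>j<D. w (digit K (q mod K ^ D) j)) = (\<Prod>j<D. w (digit K q j))"
      using digit_mod[OF assms(1)] by simp
    ultimately show "w (q div K ^ D) * ((\<Prod>j<D. w (digit K (q mod K ^ D) j)) *
      pev r b (\<lambda>j xs. if j < D then z j (digit K (q mod K ^ D) j) xs else (y(D := z D (q div K ^ D))) j xs) a) =
      (\<Prod>j<Suc D. w (digit K q j)) * pev r b (\<lambda>j xs. if j < Suc D then z j (digit K q j) xs else y j xs) a"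
      using D by (simp add: mult.commute mult.left_commute)
  qed simp
  finally show ?case .
qed simp

text \<open>For an injective enumeration \<open>c\<close> of a set, membership is \<open>\<Sum>i<k. [x = c i]\<close>. Padding this with
  a summand \<open>0\<close> of weight \<open>1 - k\<close> makes it an affine combination.\<close>

lemma oev_expansion:
  assumes "nocc r a \<le> D" "inj_on c {..<k}"
  shows "of_bool (oev r b (\<lambda>_ xs. g xs \<in> c ` {..<k}) a) =
    (\<Sum>p<(k + 1) ^ D. (\<Prod>j<D. if digit (k + 1) p j < k then 1 else 1 - int k) *
      of_bool (oev r b (\<lambda>j xs. digit (k + 1) p j < k \<and> g xs = c (digit (k + 1) p j)) a))"
proof -
  let ?w = "\<lambda>i. if i < k then 1 else 1 - int k"
  let ?z = "\<lambda>j i xs. of_bool (i < k \<and> g xs = c i) :: int"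
  have mem: "of_bool (g xs \<in> c ` {..<k}) = (\<Sum>i<k + 1. ?w i * ?z j i xs)" for j xs
  proof (cases "g xs \<in> c ` {..<k}")
    case True
    then obtain i where i: "i < k" "g xs = c i" by auto
    \<comment> \<open>By injectivity exactly one index contributes, so the sum is 1 and not the
      number of preimages.\<close>
    then have "(\<Sum>i'<k. ?w i' * ?z j i' xs) = (\<Sum>i'<k. if i' = i then 1 else 0)"
      using assms(2) by (intro sum.cong) (auto dest: inj_onD)
    then show ?thesis using True i by simp
  next
    case False
    then have "(\<Sum>i'<k. ?w i' * ?z j i' xs) = 0" by (intro sum.neutral) auto
    then show ?thesis using False by simp
  qed
  have "of_bool (oev r b (\<lambda>_ xs. g xs \<in> c ` {..<k}) a) =
      pev r b (\<lambda>j xs. of_bool (g xs \<in> c ` {..<k})) a"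
    by (rule pev_of_bool[symmetric])
  also have "\<dots> = pev r b (\<lambda>j xs. if j < D then \<Sum>i<k + 1. ?w i * ?z j i xs else 0) a"
    by (rule pev_cong) (use assms(1) mem in auto)
  also have "\<dots> = (\<Sum>p<(k + 1) ^ D. (\<Prod>j<D. ?w (digit (k + 1) p j)) *
      pev r b (\<lambda>j xs. if j < D then ?z j (digit (k + 1) p j) xs else 0) a)"
    by (rule pev_multi_affine) auto
  also have "\<dots> = (\<Sum>p<(k + 1) ^ D. (\<Prod>j<D. ?w (digit (k + 1) p j)) *
      pev r b (\<lambda>j xs. of_bool (digit (k + 1) p j < k \<and> g xs = c (digit (k + 1) p j))) a)"
    using assms(1) by (intro sum.cong refl arg_cong2[where f = "(*)"] pev_cong) auto
  finally show ?thesis unfolding pev_of_bool .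
qed

section \<open>Reduction to independent sets\<close>

text \<open>Vertex \<open>i\<close> consists of a number \<open>vp i\<close> of a summand, of the values \<open>vv i j\<close> claimed for the
  elements \<open>c (digit (k + 1) (vp i) j)\<close>, and of the sum modulo \<open>m + 1\<close> of the preceding summands.\<close>

locale summation =
  fixes k D w m :: nat and wt :: "nat \<Rightarrow> nat" and cnt :: "nat \<Rightarrow> (nat \<Rightarrow> nat) \<Rightarrow> nat"
  assumes D: "0 < D" and w: "0 < w"
    and cnt_cong: "(\<And>j. j < D \<Longrightarrow> digit (k + 1) p j < k \<Longrightarrow> v j = v' j) \<Longrightarrow> cnt p v = cnt p v'"
begin

definition vs :: "nat \<Rightarrow> nat" where "vs i = i mod (m + 1)"
definition vp :: "nat \<Rightarrow> nat" where "vp i = i div (m + 1) div w ^ D"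
definition vv :: "nat \<Rightarrow> nat \<Rightarrow> nat" where "vv i j = digit w (i div (m + 1)) j"
definition summand :: "nat \<Rightarrow> nat" where "summand i = wt (vp i) * cnt (vp i) (vv i)"

text \<open>The equivalence in the first clause forces equal claims for equal indices and distinct
  claims for distinct ones, which is injectivity of \<open>c\<close>. The last two clauses concern
  \<open>i\<close> alone; as \<open>compat i i\<close> is demanded too, a violation excludes the
  vertex altogether.\<close>

definition compat :: "nat \<Rightarrow> nat \<Rightarrow> bool" where
  "compat i i' \<longleftrightarrow>
    (\<forall>j<D. \<forall>j'<D. digit (k + 1) (vp i) j < k \<and> digit (k + 1) (vp i') j' < k \<longrightarrow>
      (digit (k + 1) (vp i) j = digit (k + 1) (vp i') j' \<longleftrightarrow> vv i j = vv i' j')) \<and>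
    (vp i = vp i' \<longrightarrow> i = i') \<and>
    (vp i' = vp i + 1 \<longrightarrow> vs i' = (vs i + summand i) mod (m + 1)) \<and>
    (vp i = 0 \<longrightarrow> vs i = 0) \<and>
    (vp i + 1 = (k + 1) ^ D \<longrightarrow> (vs i + summand i) mod (m + 1) = m)"

definition total :: "(nat \<Rightarrow> nat) \<Rightarrow> nat \<Rightarrow> nat" where
  "total c p = (\<Sum>q<p. wt q * cnt q (\<lambda>j. c (digit (k + 1) q j)))"

lemma independent_if:
  assumes "inj_on c {..<k}" "c ` {..<k} \<subseteq> {..<w}" "total c ((k + 1) ^ D) mod (m + 1) = m"
  shows "\<exists>I\<subseteq>{..<(k + 1) ^ D * w ^ D * (m + 1)}. (k + 1) ^ D \<le> card I \<and>
    (\<forall>i\<in>I. \<forall>i'\<in>I. compat i i')"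
proof -
  let ?K = "(k + 1) ^ D"
  \<comment> \<open>Digit \<open>k\<close> refers to no element; the claim stored for it has no
    effect and is set to 0, which is below \<open>w\<close>.\<close>
  let ?d = "\<lambda>p j. if digit (k + 1) p j < k then c (digit (k + 1) p j) else 0"
  have "\<exists>q<w ^ D. \<forall>j<D. digit w q j = ?d p j" for p
    by (rule digit_exists) (use assms(2) w in auto)
  then obtain r where r: "\<And>p. r p < w ^ D" "\<And>p j. j < D \<Longrightarrow> digit w (r p) j = ?d p j"
    by metis
  define s where "s p = total c p mod (m + 1)" for p
  \<comment> \<open>Summand number, claims and partial sum are packed into one number, matching the
    projections \<open>vp\<close>, \<open>vv\<close> and \<open>vs\<close>.\<close>
  define f where "f p = (p * w ^ D + r p) * (m + 1) + s p" for p
  have "s p < m + 1" for p by (simp add: s_def)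
  then have f1: "f p div (m + 1) = p * w ^ D + r p" "vs (f p) = s p" for p
    unfolding f_def vs_def by (auto simp only: div_mod_digit)
  have f2: "vp (f p) = p" for p
    unfolding vp_def f1 using div_mod_digit[OF r(1)] by blast
  have f3: "vv (f p) j = ?d p j" if "j < D" for p j
  proof -
    have "vv (f p) j = digit w ((p * w ^ D + r p) mod w ^ D) j"
      unfolding vv_def f1 by (rule digit_mod[OF w that, symmetric])
    then show ?thesis using div_mod_digit[OF r(1)[of p], of p] r(2)[OF that] by simp
  qed
  have f4: "summand (f p) = wt p * cnt p (\<lambda>j. c (digit (k + 1) p j))" for p
  proof -
    have "cnt p (vv (f p)) = cnt p (\<lambda>j. c (digit (k + 1) p j))"
      by (rule cnt_cong) (simp add: f3)
    then show ?thesis by (simp add: summand_def f2)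
  qed
  have f5: "(vs (f p) + summand (f p)) mod (m + 1) = s (Suc p)" for p
    unfolding f1 f4 s_def total_def by (simp add: mod_add_left_eq)
  have inj: "inj_on f A" for A by (rule inj_on_inverseI[of _ vp]) (rule f2)
  have comp: "compat (f p) (f p')" if "p < ?K" "p' < ?K" for p p'
    unfolding compat_def f2
  proof (intro conjI allI impI)
    fix j j' assume "j < D" "j' < D" "digit (k + 1) p j < k \<and> digit (k + 1) p' j' < k"
    then show "digit (k + 1) p j = digit (k + 1) p' j' \<longleftrightarrow> vv (f p) j = vv (f p') j'"
      using assms(1) by (auto simp: f3 dest: inj_onD)
  next
    assume "p' = p + 1"
    then show "vs (f p') = (vs (f p) + summand (f p)) mod (m + 1)"
      unfolding f5 by (simp add: f1)
  next
    assume "p = 0"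
    then show "vs (f p) = 0" by (simp add: f1 s_def total_def)
  next
    assume "p + 1 = ?K"
    then show "(vs (f p) + summand (f p)) mod (m + 1) = m"
      unfolding f5 using assms(3) by (simp add: s_def)
  qed simp
  have "f p < ?K * w ^ D * (m + 1)" if "p < ?K" for p
  proof -
    have "f p < (p * w ^ D + r p + 1) * (m + 1)" using \<open>s p < m + 1\<close> by (simp add: f_def)
    also have "\<dots> \<le> ?K * w ^ D * (m + 1)"
    proof (rule mult_le_mono1)
      have "p * w ^ D + r p + 1 \<le> (p + 1) * w ^ D" using r(1)[of p] by simp
      also have "\<dots> \<le> ?K * w ^ D" using that by (intro mult_le_mono1) simp
      finally show "p * w ^ D + r p + 1 \<le> ?K * w ^ D" .
    qed
    finally show ?thesis .
  qed
  then show ?thesis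
    using comp by (intro exI[of _ "f ` {..<?K}"]) (auto simp: card_image[OF inj])
qed

text \<open>No two distinct vertices of the same summand are compatible, so size
  \<open>(k + 1) ^ D\<close> forces exactly one vertex per summand. The partial sums are then
  correct by induction on the summand, and the last clause of \<open>compat\<close> fixes the
  total.\<close>

lemma independent_only_if:
  assumes "I \<subseteq> {..<(k + 1) ^ D * w ^ D * (m + 1)}" "(k + 1) ^ D \<le> card I"
    "\<And>i i'. i \<in> I \<Longrightarrow> i' \<in> I \<Longrightarrow> compat i i'"
  shows "\<exists>c. inj_on c {..<k} \<and> c ` {..<k} \<subseteq> {..<w} \<and> total c ((k + 1) ^ D) mod (m + 1) = m"
proof -
  let ?K = "(k + 1) ^ D"
  have fin: "finite I" using assms(1) finite_subset by blast
  have "inj_on vp I" using assms(3) by (auto simp: inj_on_def compat_def)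
  have "vp i < ?K" if "i \<in> I" for i
  proof -
    have "i < ?K * w ^ D * (m + 1)" using that assms(1) by auto
    then show ?thesis unfolding vp_def by (simp only: less_mult_imp_div_less)
  qed
  then have sub: "vp ` I \<subseteq> {..<?K}" by auto
  have "card (vp ` I) = card I" by (rule card_image) fact
  then have "vp ` I = {..<?K}"
    using assms(2) by (intro card_subset_eq sub) (use card_mono[OF _ sub] in auto)
  then have "\<forall>p<?K. \<exists>i\<in>I. vp i = p" by (metis image_iff lessThan_iff)
  then obtain f where f: "\<And>p. p < ?K \<Longrightarrow> f p \<in> I" "\<And>p. p < ?K \<Longrightarrow> vp (f p) = p" by metis
  have comp: "compat (f p) (f p')" if "p < ?K" "p' < ?K" for p p'
    using that f(1) assms(3) by blast
  \<comment> \<open>For \<open>i < k\<close> summand number \<open>i\<close> has digit 0 equal to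
    \<open>i\<close>, so its first claim can serve as \<open>c i\<close>; \<open>0 < D\<close>
    ensures that there is a summand with this number.\<close>
  have less: "i < ?K" if "i < k" for i
  proof -
    have "k + 1 \<le> ?K" using D by (intro self_le_power) auto
    then show ?thesis using that by simp
  qed
  have d0: "digit (k + 1) i 0 = i" if "i < k" for i using that by (simp add: digit_def)
  define c where "c i = vv (f i) 0" for i
  have "inj_on c {..<k}"
  proof (rule inj_onI)
    fix i i' assume "i \<in> {..<k}" "i' \<in> {..<k}" and eq: "c i = c i'"
    then have i: "i < k" "i' < k" by auto
    with comp[OF less less, OF i] show "i = i'"
      unfolding compat_def f(2)[OF less[OF i(1)]] f(2)[OF less[OF i(2)]]
      using D d0 eq by (metis c_def)
  qed
  moreover have "c ` {..<k} \<subseteq> {..<w}" using w by (auto simp: c_def vv_def digit_less)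
  moreover have cv: "vv (f p) j = c (digit (k + 1) p j)" if "p < ?K" "j < D" "digit (k + 1) p j < k" for p j
  proof -
    let ?i = "digit (k + 1) p j"
    have "digit (k + 1) (vp (f p)) j = digit (k + 1) (vp (f ?i)) 0 \<longleftrightarrow> vv (f p) j = vv (f ?i) 0"
      using comp[OF that(1) less[OF that(3)]] that D d0[OF that(3)] unfolding compat_def
        f(2)[OF that(1)] f(2)[OF less[OF that(3)]] by metis
    then show ?thesis using f(2)[OF that(1)] f(2)[OF less[OF that(3)]] d0[OF that(3)] by (simp add: c_def)
  qed
  have sm: "summand (f p) = wt p * cnt p (\<lambda>j. c (digit (k + 1) p j))" if "p < ?K" for p
  proof -
    have "cnt p (vv (f p)) = cnt p (\<lambda>j. c (digit (k + 1) p j))"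
      by (rule cnt_cong) (rule cv[OF that])
    then show ?thesis by (simp add: summand_def f(2)[OF that])
  qed
  have vs: "vs (f p) = total c p mod (m + 1)" if "p < ?K" for p
    using that
  proof (induction p)
    case 0
    then show ?case using comp[of 0 0] f(2)[of 0] by (simp add: compat_def total_def)
  next
    case (Suc p)
    then have "vs (f (Suc p)) = (vs (f p) + summand (f p)) mod (m + 1)"
      using comp[of p "Suc p"] f(2)[of p] f(2)[of "Suc p"] by (simp add: compat_def)
    then show ?case using Suc sm[of p] by (simp add: total_def mod_add_left_eq)
  qed
  obtain p where p: "?K = Suc p" using gr0_conv_Suc[of ?K] by auto
  then have "(vs (f p) + summand (f p)) mod (m + 1) = m"
    using comp[of p p] f(2)[of p] by (simp add: compat_def)
  then have "total c ?K mod (m + 1) = m"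
    unfolding p using vs[of p] sm[of p] p by (simp add: total_def mod_add_left_eq)
  ultimately show ?thesis by blast
qed

end

lemma (in summation) independent_iff:
  "(\<exists>c. inj_on c {..<k} \<and> c ` {..<k} \<subseteq> {..<w} \<and> total c ((k + 1) ^ D) mod (m + 1) = m) \<longleftrightarrow>
    (\<exists>I\<subseteq>{..<(k + 1) ^ D * w ^ D * (m + 1)}. (k + 1) ^ D \<le> card I \<and> (\<forall>i\<in>I. \<forall>i'\<in>I. compat i i'))"
  (is "?L \<longleftrightarrow> ?R")
proof
  assume ?L
  then obtain c where "inj_on c {..<k}" "c ` {..<k} \<subseteq> {..<w}" "total c ((k + 1) ^ D) mod (m + 1) = m"
    by blast
  then show ?R by (rule independent_if)
next
  assume ?R
  then obtain I where I: "I \<subseteq> {..<(k + 1) ^ D * w ^ D * (m + 1)}" "(k + 1) ^ D \<le> card I"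
    "\<And>i i'. i \<in> I \<Longrightarrow> i' \<in> I \<Longrightarrow> compat i i'"
    by blast
  show ?L by (rule independent_only_if[OF I])
qed

section \<open>Truth of universal sentences as a weighted count\<close>

lemma oev_cong: "(\<And>j. j < nocc r a \<Longrightarrow> f j = f' j) \<Longrightarrow> oev r b f a = oev r b f' a"
  using pev_cong[of r a "\<lambda>j xs. of_bool (f j xs)" "\<lambda>j xs. of_bool (f' j xs)" b]
  unfolding pev_of_bool by auto

text \<open>Assignment number \<open>u\<close> gives variable \<open>i\<close> the digit
  \<open>l - 1 - i\<close>, since \<open>tup\<close> starts with the most significant digit. The
  result is the rank of the argument tuple.\<close>

definition arg_idx :: "nat \<Rightarrow> nat \<Rightarrow> nat \<Rightarrow> nat list \<Rightarrow> nat" where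
  "arg_idx l n u xs = idx n (map (\<lambda>i. digit n u (l - 1 - i)) xs)"

text \<open>The length test mirrors \<open>TBit\<close>; for well-formed atoms and valid codes it
  always succeeds.\<close>

fun base_val :: "vocabulary \<Rightarrow> nat \<Rightarrow> bool list \<Rightarrow> nat \<Rightarrow> qf_formula \<Rightarrow> bool" where
  "base_val V l x u (Equal i j) =
     (digit (code_card x) u (l - 1 - i) = digit (code_card x) u (l - 1 - j))"
| "base_val V l x u (Atom R xs) =
     (offset V (code_card x) R + arg_idx l (code_card x) u xs < length x \<and>
      x ! (offset V (code_card x) R + arg_idx l (code_card x) u xs))"
| "base_val V l x u _ = False"

lemma map_tup: "\<forall>i\<in>set xs. i < l \<Longrightarrow> map ((!) (tup n l u)) xs = map (\<lambda>i. digit n u (l - 1 - i)) xs"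
  by (auto simp: nth_tup digit_def)

lemma map_digit_in: "0 < n \<Longrightarrow> map (\<lambda>i. digit n u (f i)) xs \<in> tuple_set n (length xs)"
  by (auto simp: tuple_set_def digit_less)

lemma offset_idx_less:
  assumes "R < length V" "t \<in> tuple_set n (V ! R)"
  shows "offset V n R + idx n t < offset V n (length V)"
proof -
  have "offset V n R + idx n t < offset V n (Suc R)" using idx_less[OF assms(2)] by (simp add: offset_def)
  also have "\<dots> \<le> offset V n (length V)"
    unfolding offset_def using assms(1) by (intro add_mono sum_mono2) auto
  finally show ?thesis .
qed

text \<open>Passage from tuples to ranks: \<open>X\<close> becomes a set \<open>A\<close> of
  numbers, and all occurrences of \<open>X\<close> receive the same interpretation.\<close>

lemma holds_oev:
  assumes x: "valid_code V x" and A: "A \<subseteq> {..<code_card x ^ s}"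
  shows "wf_qf (V @ [s]) l a \<Longrightarrow>
    holds_qf (expand (decode V x) (tup (code_card x) s ` A)) (tup (code_card x) l u) a \<longleftrightarrow>
    oev (length V) (base_val V l x u) (\<lambda>_ xs. arg_idx l (code_card x) u xs \<in> A) a"
proof (induction a)
  case (Equal i j)
  then show ?case by (simp add: nth_tup digit_def)
next
  case (Atom R xs)
  let ?n = "code_card x"
  let ?t = "map (\<lambda>i. digit ?n u (l - 1 - i)) xs"
  have n: "0 < ?n" using x by (simp add: valid_code_def)
  have t: "?t \<in> tuple_set ?n (length xs)" using map_digit_in[OF n] .
  have m: "map ((!) (tup ?n l u)) xs = ?t" using Atom by (intro map_tup) auto
  show ?case
  proof (cases "R = length V")
    case True
    then have "length xs = s" using Atom by simp
    then have "?t \<in> tup ?n s ` A \<longleftrightarrow> idx ?n ?t \<in> A"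
      using t A by (auto simp: idx_tup tup_idx image_iff intro!: bexI[of _ "idx ?n ?t"])
    then show ?thesis
      unfolding holds_qf.simps oev.simps m using True by (simp add: expand_def decode_def nth_append arg_idx_def)
  next
    case False
    then have R: "R < length V" "length xs = V ! R" using Atom by (auto simp: nth_append)
    then have "offset V ?n R + idx ?n ?t < length x"
      using x offset_idx_less[of R V ?t ?n] t by (simp add: valid_code_def)
    then show ?thesis
      unfolding holds_qf.simps oev.simps m
      using False R t by (simp add: expand_def decode_def nth_append arg_idx_def)
  qed
qed auto

text \<open>The additional slot keeps the number positive even if \<open>X\<close> does not occur,
  as \<open>summation\<close> demands.\<close>

definition slots :: "vocabulary \<Rightarrow> qf_formula \<Rightarrow> nat" where
  "slots V a = nocc (length V) a + 1"

text \<open>\<open>1 + k * m\<close> is a natural number congruent to \<open>1 - k\<close> modulo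
  \<open>m + 1\<close>.\<close>

definition weight :: "nat \<Rightarrow> nat \<Rightarrow> nat \<Rightarrow> nat \<Rightarrow> nat" where
  "weight D m k p = (\<Prod>j<D. if digit (k + 1) p j < k then 1 else 1 + k * m)"

definition count :: "vocabulary \<Rightarrow> nat \<Rightarrow> qf_formula \<Rightarrow> bool list \<Rightarrow> nat \<Rightarrow> nat \<Rightarrow> (nat \<Rightarrow> nat) \<Rightarrow> nat" where
  "count V l a x k p v = (\<Sum>u<code_card x ^ l. of_bool (oev (length V) (base_val V l x u)
     (\<lambda>j xs. digit (k + 1) p j < k \<and> arg_idx l (code_card x) u xs = v j) a))"

lemma summation:
  assumes "valid_code V x"
  shows "summation k (slots V a) (code_card x ^ s) (count V l a x k)"
proof
  show "0 < slots V a" by (simp add: slots_def)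
  show "0 < code_card x ^ s" using assms by (simp add: valid_code_def)
  fix p and v v' :: "nat \<Rightarrow> nat" assume *: "\<And>j. j < slots V a \<Longrightarrow> digit (k + 1) p j < k \<Longrightarrow> v j = v' j"
  have "oev (length V) b (\<lambda>j xs. digit (k + 1) p j < k \<and> arg_idx l (code_card x) u xs = v j) a =
    oev (length V) b (\<lambda>j xs. digit (k + 1) p j < k \<and> arg_idx l (code_card x) u xs = v' j) a" for b u
    by (rule oev_cong) (use * in \<open>auto simp: slots_def fun_eq_iff\<close>)
  then show "count V l a x k p v = count V l a x k p v'" unfolding count_def by simp
qed

text \<open>Summing \<open>oev_expansion\<close> over all assignments and exchanging the sums
  expresses the count of satisfying assignments with signed weights, which agree with
  \<open>weight\<close> modulo \<open>m + 1\<close>. The count is at most \<open>m\<close>, so it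
  equals its residue.\<close>

lemma total_mod:
  fixes V :: vocabulary and x :: "bool list" and a :: qf_formula and l k s :: nat
  assumes "valid_code V x" "inj_on c {..<k}"
  defines "m \<equiv> code_card x ^ l" and "D \<equiv> slots V a"
  shows "summation.total k (weight D m k) (count V l a x k) c ((k + 1) ^ D) mod (m + 1) =
    (\<Sum>u<m. of_bool (oev (length V) (base_val V l x u) (\<lambda>_ xs. arg_idx l (code_card x) u xs \<in> c ` {..<k}) a))"
    (is "?T mod _ = ?S")
proof -
  interpret summation k D "code_card x ^ s" m "weight D m k" "count V l a x k"
    unfolding D_def by (rule summation) fact
  let ?W = "\<lambda>p. \<Prod>j<D. if digit (k + 1) p j < k then 1 else 1 - int k"
  let ?c = "\<lambda>p. count V l a x k p (\<lambda>j. c (digit (k + 1) p j))"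
  let ?M = "int (m + 1)"
  have "int (weight D m k p) mod ?M = ?W p mod ?M" for p
  proof -
    have "(1 + int k * int m) mod ?M = (1 - int k + int k * ?M) mod ?M"
      by (rule arg_cong[where f = "\<lambda>z. z mod _"]) (simp add: algebra_simps)
    also have "\<dots> = (1 - int k) mod ?M" by (rule mod_mult_self1)
    finally have "int (if digit (k + 1) p j < k then 1 else 1 + k * m) mod ?M =
        (if digit (k + 1) p j < k then 1 else 1 - int k) mod ?M" for j by simp
    then have "(\<Prod>j<D. int (if digit (k + 1) p j < k then 1 else 1 + k * m) mod ?M) mod ?M =
      (\<Prod>j<D. (if digit (k + 1) p j < k then 1 else 1 - int k) mod ?M) mod ?M" by simp
    then show ?thesis unfolding weight_def of_nat_prod mod_prod_eq .
  qed
  then have W: "int (weight D m k p * ?c p) mod ?M = ?W p * int (?c p) mod ?M" for p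
    unfolding of_nat_mult by (rule mod_mult_cong) simp
  have "int ?T mod ?M = (\<Sum>p<(k + 1) ^ D. int (weight D m k p * ?c p) mod ?M) mod ?M"
    unfolding total_def by (simp only: of_nat_sum mod_sum_eq)
  also have "\<dots> = (\<Sum>p<(k + 1) ^ D. ?W p * int (?c p)) mod ?M"
    unfolding W by (simp only: mod_sum_eq)
  also have "(\<Sum>p<(k + 1) ^ D. ?W p * int (?c p)) = int ?S"
  proof -
    have "int ?S = (\<Sum>u<m. \<Sum>p<(k + 1) ^ D. ?W p * of_bool (oev (length V) (base_val V l x u)
      (\<lambda>j xs. digit (k + 1) p j < k \<and> arg_idx l (code_card x) u xs = c (digit (k + 1) p j)) a))"
      unfolding of_nat_sum of_nat_of_bool
      by (intro sum.cong refl oev_expansion assms(2)) (simp add: D_def slots_def)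
    also have "\<dots> = (\<Sum>p<(k + 1) ^ D. ?W p * int (?c p))"
      unfolding count_def m_def[symmetric] of_nat_sum of_nat_of_bool sum_distrib_left by (rule sum.swap)
    finally show ?thesis ..
  qed
  finally have "?T mod (m + 1) = ?S mod (m + 1)"
    unfolding of_nat_mod[symmetric] of_nat_eq_iff .
  moreover have "?S \<le> (\<Sum>u<m. 1)" by (intro sum_mono) auto
  ultimately show ?thesis by simp
qed

text \<open>Sets of exactly \<open>k\<close> tuples correspond to ranges of injective enumerations
  of ranks, and the sentence holds iff the count of satisfying assignments reaches its maximum
  \<open>m\<close>.\<close>

lemma so_models_total:
  fixes V :: vocabulary and x :: "bool list" and a :: qf_formula and l k s :: nat
  assumes x: "valid_code V x" and wf: "wf_qf (V @ [s]) l a"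
  defines "m \<equiv> code_card x ^ l" and "D \<equiv> slots V a"
  shows "so_models (=) s (decode V x) k (replicate l QAll, a) \<longleftrightarrow>
    (\<exists>c. inj_on c {..<k} \<and> c ` {..<k} \<subseteq> {..<code_card x ^ s} \<and>
      summation.total k (weight D m k) (count V l a x k) c ((k + 1) ^ D) mod (m + 1) = m)"
proof -
  let ?n = "code_card x"
  let ?S = "decode V x"
  have n: "0 < ?n" "card_univ ?S = ?n" using x by (auto simp: valid_code_def decode_def)
  have bij: "bij_betw (tup ?n r) {..<?n ^ r} (tuple_set ?n r)" for r by (rule bij_tup) fact
  have iff: "holds (expand ?S (tup ?n s ` c ` {..<k})) [] (replicate l QAll, a) \<longleftrightarrow>
    summation.total k (weight D m k) (count V l a x k) c ((k + 1) ^ D) mod (m + 1) = m"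
    if c: "inj_on c {..<k}" "c ` {..<k} \<subseteq> {..<?n ^ s}" for c
  proof -
    let ?P = "\<lambda>u. oev (length V) (base_val V l x u) (\<lambda>_ xs. arg_idx l ?n u xs \<in> c ` {..<k}) a"
    have "tuples (expand ?S (tup ?n s ` c ` {..<k})) l = tup ?n l ` {..<m}"
      using bij[of l] n by (simp add: tuples_eq expand_def m_def bij_betw_def)
    then have "holds (expand ?S (tup ?n s ` c ` {..<k})) [] (replicate l QAll, a) \<longleftrightarrow> (\<forall>u<m. ?P u)"
      unfolding holds_replicate_All using holds_oev[OF x c(2) wf] by (simp, simp add: Ball_def)
    also have "\<dots> \<longleftrightarrow> (\<Sum>u<m. of_bool (?P u)) = m"
    proof
      assume "(\<Sum>u<m. of_bool (?P u)) = m"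
      then have "card {u \<in> {..<m}. ?P u} = card {..<m}" by (simp add: Int_def)
      then have "{u \<in> {..<m}. ?P u} = {..<m}" by (intro card_subset_eq) auto
      then show "\<forall>u<m. ?P u" by auto
    qed simp
    finally show ?thesis unfolding m_def D_def total_mod[OF x c(1)] .
  qed
  show ?thesis
  proof
    assume "so_models (=) s ?S k (replicate l QAll, a)"
    then obtain C where C: "C \<subseteq> tuple_set ?n s" "card C = k" "holds (expand ?S C) [] (replicate l QAll, a)"
      using n by (auto simp: so_models_def tuples_eq)
    have "inj_on (idx ?n) C" by (rule inj_onI) (use C(1) idx_inj in blast)
    then have card: "card (idx ?n ` C) = k" using C(2) by (simp add: card_image)
    have "idx ?n ` C \<subseteq> {..<?n ^ s}" using C(1) idx_less by auto
    then have "finite (idx ?n ` C)" using finite_subset by blast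
    then obtain c where c: "bij_betw c {0..<k} (idx ?n ` C)"
      using ex_bij_betw_nat_finite card by blast
    then have c: "inj_on c {..<k}" "c ` {..<k} = idx ?n ` C"
      by (auto simp: bij_betw_def atLeast0LessThan)
    have "tup ?n s ` idx ?n ` C = (\<lambda>t. t) ` C"
      unfolding image_image using C(1) tup_idx by (intro image_cong) auto
    then show "\<exists>c. inj_on c {..<k} \<and> c ` {..<k} \<subseteq> {..<?n ^ s} \<and>
      summation.total k (weight D m k) (count V l a x k) c ((k + 1) ^ D) mod (m + 1) = m"
      using c iff[of c] C(3) \<open>idx ?n ` C \<subseteq> {..<?n ^ s}\<close> by (intro exI[of _ c]) simp
  next
    assume "\<exists>c. inj_on c {..<k} \<and> c ` {..<k} \<subseteq> {..<?n ^ s} \<and>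
      summation.total k (weight D m k) (count V l a x k) c ((k + 1) ^ D) mod (m + 1) = m"
    then obtain c where c: "inj_on c {..<k}" "c ` {..<k} \<subseteq> {..<?n ^ s}"
      "holds (expand ?S (tup ?n s ` c ` {..<k})) [] (replicate l QAll, a)"
      using iff by blast
    have "inj_on (tup ?n s) (c ` {..<k})"
      using bij[of s] c(2) by (auto simp: bij_betw_def intro: inj_on_subset)
    then have "card (tup ?n s ` c ` {..<k}) = k" using c(1) by (simp add: card_image)
    moreover have "tup ?n s ` c ` {..<k} \<subseteq> tuples ?S s"
      using n tup_in[of ?n s] by (auto simp: tuples_eq)
    ultimately show "so_models (=) s ?S k (replicate l QAll, a)"
      unfolding so_models_def using c(3) by (intro exI[of _ "tup ?n s ` c ` {..<k}"]) simp
  qed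
qed

subsection \<open>The reduction is given by terms\<close>

lemma ok_digit: "ok z K \<Longrightarrow> ok z P \<Longrightarrow> ok z (\<lambda>x e. digit (K x e) (P x e) j)"
  unfolding digit_def by (intro ok_mod ok_div ok_power)

lemma ok_arg_idx:
  assumes "ok z N" "ok z U"
  shows "ok z (\<lambda>x e. arg_idx l (N x e) (U x e) xs)"
  unfolding arg_idx_def
proof (induction xs)
  case (Cons i xs)
  then show ?case using assms
    by simp (intro ok_add ok_mult ok_power ok_digit; assumption)
qed (simp add: ok_const)

lemma okb_base_val:
  assumes "ok z U"
  shows "okb z (\<lambda>x e. base_val V l x (U x e) c)"
proof (cases c)
  case (Equal i j)
  show ?thesis unfolding Equal base_val.simps by (intro okb_eq ok_digit ok_code_card assms)
next
  case (Atom R xs)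
  show ?thesis unfolding Atom base_val.simps
    by (intro okb_bit ok_add ok_offset ok_arg_idx ok_code_card assms)
qed (simp_all add: okb_const)

lemma okb_oev:
  assumes "\<And>c. okb z (\<lambda>x e. b x e c)" "\<And>j xs. okb z (\<lambda>x e. f x e j xs)"
  shows "okb z (\<lambda>x e. oev r (b x e) (f x e) a)"
  using assms(2)
proof (induction a arbitrary: f)
  case (Conj a c)
  show ?case unfolding oev.simps by (rule okb_conj[OF Conj.IH(1) Conj.IH(2)]) (rule Conj.prems)+
next
  case (Disj a c)
  show ?case unfolding oev.simps by (rule okb_disj[OF Disj.IH(1) Disj.IH(2)]) (rule Disj.prems)+
next
  case (Neg a)
  show ?case unfolding oev.simps by (rule okb_not[OF Neg.IH]) (rule Neg.prems)
next
  case (Atom R xs)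
  then show ?case using assms(1) by (cases "R = r") simp_all
qed (use assms(1) in \<open>simp_all add: okb_const\<close>)

text \<open>\<open>M\<close> is the property tested on the constructed graph, so that instances for
  independent sets can be reused for the models of a formula.\<close>

definition graph_reduction :: "pproblem \<Rightarrow> (nat \<Rightarrow> (nat \<Rightarrow> nat \<Rightarrow> bool) \<Rightarrow> nat \<Rightarrow> bool) \<Rightarrow>
    (bool list \<Rightarrow> nat \<Rightarrow> nat) \<Rightarrow> (bool list \<Rightarrow> nat \<Rightarrow> nat \<Rightarrow> nat \<Rightarrow> bool) \<Rightarrow> (nat \<Rightarrow> nat) \<Rightarrow> bool" where
  "graph_reduction P M N E K \<longleftrightarrow>
    ok True (\<lambda>x e. N x (e 0)) \<and> okb True (\<lambda>x e. E x (e 2) (e 0) (e 1)) \<and> ok True (\<lambda>x e. K (e 0)) \<and>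
    (\<forall>x k. 0 < N x k) \<and> (\<forall>x k u v. E x k u v \<longrightarrow> E x k v u) \<and>
    (\<forall>x k. (x, k) \<in> P \<longleftrightarrow> M (N x k) (E x k) (K k))"

definition independent_set :: "nat \<Rightarrow> (nat \<Rightarrow> nat \<Rightarrow> bool) \<Rightarrow> nat \<Rightarrow> bool" where
  "independent_set N E k \<longleftrightarrow> (\<exists>I\<subseteq>{..<N}. k \<le> card I \<and> (\<forall>u\<in>I. \<forall>v\<in>I. \<not> E u v))"

context
  fixes V :: vocabulary and s l :: nat and a :: qf_formula
begin

text \<open>This and the next definitions are counterparts of the notions of
  \<open>summation\<close> for arbitrary strings: terms have to be total in \<open>x\<close>,
  whereas the locale is available for valid codes only.\<close>

definition xvs :: "bool list \<Rightarrow> nat \<Rightarrow> nat" where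
  "xvs x i = i mod (code_card x ^ l + 1)"

definition xvp :: "bool list \<Rightarrow> nat \<Rightarrow> nat" where
  "xvp x i = i div (code_card x ^ l + 1) div (code_card x ^ s) ^ slots V a"

definition xvv :: "bool list \<Rightarrow> nat \<Rightarrow> nat \<Rightarrow> nat" where
  "xvv x i j = digit (code_card x ^ s) (i div (code_card x ^ l + 1)) j"

definition xsummand :: "bool list \<Rightarrow> nat \<Rightarrow> nat \<Rightarrow> nat" where
  "xsummand x k i = weight (slots V a) (code_card x ^ l) k (xvp x i) * count V l a x k (xvp x i) (xvv x i)"

definition xcompat :: "bool list \<Rightarrow> nat \<Rightarrow> nat \<Rightarrow> nat \<Rightarrow> bool" where
  "xcompat x k i i' \<longleftrightarrow>
    (\<forall>j<slots V a. \<forall>j'<slots V a. digit (k + 1) (xvp x i) j < k \<and> digit (k + 1) (xvp x i') j' < k \<longrightarrow>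
      (digit (k + 1) (xvp x i) j = digit (k + 1) (xvp x i') j' \<longleftrightarrow> xvv x i j = xvv x i' j')) \<and>
    (xvp x i = xvp x i' \<longrightarrow> i = i') \<and>
    (xvp x i' = xvp x i + 1 \<longrightarrow> xvs x i' = (xvs x i + xsummand x k i) mod (code_card x ^ l + 1)) \<and>
    (xvp x i = 0 \<longrightarrow> xvs x i = 0) \<and>
    (xvp x i + 1 = (k + 1) ^ slots V a \<longrightarrow>
      (xvs x i + xsummand x k i) mod (code_card x ^ l + 1) = code_card x ^ l)"

lemma xcompat_eq:
  assumes "valid_code V x"
  shows "xcompat x k i i' \<longleftrightarrow> summation.compat k (slots V a) (code_card x ^ s) (code_card x ^ l)
    (weight (slots V a) (code_card x ^ l) k) (count V l a x k) i i'"
proof -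
  interpret summation k "slots V a" "code_card x ^ s" "code_card x ^ l"
    "weight (slots V a) (code_card x ^ l) k" "count V l a x k"
    by (rule summation) fact
  have eq: "vs = xvs x" "vp = xvp x" "vv = xvv x"
    by (auto simp: fun_eq_iff vs_def vp_def vv_def xvs_def xvp_def xvv_def)
  have "summand = xsummand x k"
    by (rule ext) (simp only: eq summand_def xsummand_def)
  then show ?thesis unfolding compat_def xcompat_def eq by simp
qed

lemma ok_xvs: "ok z I \<Longrightarrow> ok z (\<lambda>x e. xvs x (I x e))"
  unfolding xvs_def by (intro ok_mod ok_add ok_power ok_code_card ok_const)

lemma ok_xvp: "ok z I \<Longrightarrow> ok z (\<lambda>x e. xvp x (I x e))"
  unfolding xvp_def by (intro ok_div ok_add ok_power ok_code_card ok_const)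

lemma ok_xvv: "ok z I \<Longrightarrow> ok z (\<lambda>x e. xvv x (I x e) j)"
  unfolding xvv_def by (intro ok_digit ok_div ok_add ok_power ok_code_card ok_const)

lemma ok_xsummand:
  assumes "ok z K" "ok z I"
  shows "ok z (\<lambda>x e. xsummand x (K x e) (I x e))"
  unfolding xsummand_def
proof (rule ok_mult)
  show "ok z (\<lambda>x e. weight (slots V a) (code_card x ^ l) (K x e) (xvp x (I x e)))"
    unfolding weight_def
    by (rule ok_prod_const)
      (intro ok_if okb_less ok_digit ok_add ok_mult ok_power ok_code_card ok_const ok_xvp assms)
  show "ok z (\<lambda>x e. count V l a x (K x e) (xvp x (I x e)) (xvv x (I x e)))"
    unfolding count_def
  proof (rule ok_sum)
    show "ok z (\<lambda>x e. code_card x ^ l)" by (intro ok_power ok_code_card)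
    show "ok z (\<lambda>x e. of_bool (oev (length V) (base_val V l x (e 0))
       (\<lambda>j xs. digit (K x (\<lambda>i. e (Suc i)) + 1) (xvp x (I x (\<lambda>i. e (Suc i)))) j < K x (\<lambda>i. e (Suc i)) \<and>
         arg_idx l (code_card x) (e 0) xs = xvv x (I x (\<lambda>i. e (Suc i))) j) a))"
      by (intro ok_of_bool okb_oev okb_base_val ok_var okb_conj okb_less okb_eq ok_digit ok_add
          ok_const ok_xvp ok_xvv ok_arg_idx ok_code_card ok_rename[OF assms(1)] ok_rename[OF assms(2)])
  qed
qed

lemma okb_xcompat:
  assumes "ok z K" "ok z I" "ok z J"
  shows "okb z (\<lambda>x e. xcompat x (K x e) (I x e) (J x e))"
proof -
  note rules = okb_less okb_eq okb_imp okb_iff ok_digit ok_add ok_mod ok_power ok_const ok_code_card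
    ok_xvp ok_xvv ok_xvs ok_xsummand assms
  have "okb z (\<lambda>x e. \<forall>j<slots V a. \<forall>j'<slots V a.
      digit (K x e + 1) (xvp x (I x e)) j < K x e \<and> digit (K x e + 1) (xvp x (J x e)) j' < K x e \<longrightarrow>
      (digit (K x e + 1) (xvp x (I x e)) j = digit (K x e + 1) (xvp x (J x e)) j' \<longleftrightarrow>
        xvv x (I x e) j = xvv x (J x e) j'))"
    by (intro okb_all_const) (intro okb_conj rules)
  then show ?thesis unfolding xcompat_def by (intro okb_conj rules)
qed

lemma independent_set_instance:
  assumes "sentence (V @ [s]) (replicate l QAll, a)"
  shows "\<exists>N E K. graph_reduction (encode_problem V (p_models (=) s V (replicate l QAll, a))) independent_set N E K"
proof -
  let ?D = "slots V a"
  have wf: "wf_qf (V @ [s]) l a" using assms by (simp add: sentence_def)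
  define K where "K k = (k + 1) ^ ?D" for k :: nat
  \<comment> \<open>An invalid string yields a single vertex with a loop, hence no independent set
    of the positive size \<open>K k\<close>.\<close>
  define N where "N x k = (if valid_code V x
    then (k + 1) ^ ?D * (code_card x ^ s) ^ ?D * (code_card x ^ l + 1) else 1)" for x k
  \<comment> \<open>Compatibility is not symmetric, as it passes sums forward; both directions are
    demanded to get an undirected graph.\<close>
  define E where "E x k u v \<longleftrightarrow> \<not> (valid_code V x \<and> xcompat x k u v \<and> xcompat x k v u)" for x k u v
  have "(x, k) \<in> encode_problem V (p_models (=) s V (replicate l QAll, a)) \<longleftrightarrow>
      (\<exists>I\<subseteq>{..<N x k}. K k \<le> card I \<and> (\<forall>u\<in>I. \<forall>v\<in>I. \<not> E x k u v))" for x k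
  proof (cases "valid_code V x")
    case False
    have "\<not> K k \<le> card I" if "\<forall>u\<in>I. \<forall>v\<in>I. \<not> E x k u v" for I
    proof -
      have "I = {}" using that False by (auto simp: E_def)
      then show ?thesis by (simp add: K_def)
    qed
    then show ?thesis using False unfolding p_models_iff by blast
  next
    case True
    interpret summation k ?D "code_card x ^ s" "code_card x ^ l"
      "weight ?D (code_card x ^ l) k" "count V l a x k"
      by (rule summation) fact
    have indep: "(\<forall>u\<in>I. \<forall>v\<in>I. \<not> E x k u v) \<longleftrightarrow> (\<forall>u\<in>I. \<forall>v\<in>I. compat u v)" for I
      using True xcompat_eq[OF True] by (auto simp: E_def)
    have "(x, k) \<in> encode_problem V (p_models (=) s V (replicate l QAll, a)) \<longleftrightarrow>
      (\<exists>c. inj_on c {..<k} \<and> c ` {..<k} \<subseteq> {..<code_card x ^ s} \<and>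
        total c ((k + 1) ^ ?D) mod (code_card x ^ l + 1) = code_card x ^ l)"
      unfolding p_models_iff using True so_models_total[OF True wf] by simp
    also have "\<dots> \<longleftrightarrow> (\<exists>I\<subseteq>{..<N x k}. K k \<le> card I \<and> (\<forall>u\<in>I. \<forall>v\<in>I. compat u v))"
      unfolding N_def K_def by (simp only: True if_True independent_iff)
    finally show ?thesis unfolding indep .
  qed
  moreover have "ok True (\<lambda>x e. N x (e 0))"
    unfolding N_def
    by (intro ok_if okb_valid_code ok_mult ok_add ok_power ok_code_card ok_var ok_const)
  moreover have "okb True (\<lambda>x e. E x (e 2) (e 0) (e 1))"
    unfolding E_def by (intro okb_not okb_conj okb_valid_code okb_xcompat ok_var)
  moreover have "ok True (\<lambda>x e. K (e 0))"
    unfolding K_def by (intro ok_power ok_add ok_var ok_const)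
  moreover have "0 < N x k" for x k by (simp add: N_def valid_code_def)
  moreover have "E x k u v \<Longrightarrow> E x k v u" for x k u v by (auto simp: E_def)
  ultimately have "graph_reduction (encode_problem V (p_models (=) s V (replicate l QAll, a))) independent_set N E K"
    unfolding graph_reduction_def independent_set_def by blast
  then show ?thesis by blast
qed

end

section \<open>W[1]-hardness\<close>

text \<open>Only the generators of \<open>W1\<close> have to be reduced; transitivity covers the
  rest. As the constructed graphs are symmetric, one reduction serves arbitrary structures and
  undirected graphs alike.\<close>

lemma hard_problems:
  assumes sent: "sentence (graph_voc @ [1]) (p, \<phi>)"
    and inst: "\<And>V s l a. sentence (V @ [s]) (replicate l QAll, a) \<Longrightarrow>
      \<exists>N E K. graph_reduction (encode_problem V (p_models (=) s V (replicate l QAll, a)))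
        (\<lambda>N E k. so_models (\<ge>) 1 (graph N E) k (p, \<phi>)) N E K"
  shows "(\<exists>Q\<in>p_FD (\<ge>) p. W1_hard Q) \<and> (\<exists>Q\<in>p_FD_undirected (\<ge>) p. W1_hard Q)"
proof -
  let ?Q = "encode_problem graph_voc (p_models (\<ge>) 1 graph_voc (p, \<phi>))"
  let ?Q' = "encode_problem graph_voc (p_models (\<ge>) 1 graph_voc (p, \<phi>) \<inter> undirected_graphs \<times> UNIV)"
  have red: "fpt_reducible P ?Q \<and> fpt_reducible P ?Q'" if "P \<in> p_WD_Pi1" for P
  proof -
    obtain V s l a where P: "P = encode_problem V (p_models (=) s V (replicate l QAll, a))"
      "sentence (V @ [s]) (replicate l QAll, a)"
      using \<open>P \<in> p_WD_Pi1\<close> unfolding p_WD_Pi1_def by blast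
    obtain N E K where G: "graph_reduction P (\<lambda>N E k. so_models (\<ge>) 1 (graph N E) k (p, \<phi>)) N E K"
      using inst[OF P(2)] unfolding P(1)[symmetric] by blast
    have N: "ok True (\<lambda>x e. N x (e 0))" and E: "okb True (\<lambda>x e. E x (e 2) (e 0) (e 1))"
      and K: "ok True (\<lambda>x e. K (e 0))" and pos: "\<And>x k. 0 < N x k" and sym: "\<And>x k u v. E x k u v \<Longrightarrow> E x k v u"
      and corr: "\<And>x k. (x, k) \<in> P \<longleftrightarrow> so_models (\<ge>) 1 (graph (N x k) (E x k)) (K k) (p, \<phi>)"
      using G unfolding graph_reduction_def by simp_all
    have N': "ok True (\<lambda>x e. N x (e 1))" using ok_rename[OF N, of "\<lambda>i. i + 1"] by simp
    have len: "ok True (\<lambda>x e. N x (e 0) + 1 + N x (e 0) * N x (e 0))"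
      by (intro ok_add ok_mult ok_const N)
    have bit: "okb True (\<lambda>x e. graph_code (N x (e 1)) (E x (e 1)) (e 0))"
      using okb_rename[OF E, of "\<lambda>i. if i = 2 then 3 else i"]
      by (intro okb_graph_code[where E = "\<lambda>x u v e. E x (e 1) u v"] N' ok_var) (simp add: numeral_3_eq_3)
    have code: "map (graph_code (N x k) (E x k)) [0..<N x k + 1 + N x k * N x k] =
        encode graph_voc (graph (N x k) (E x k))" for x k
      by (rule encode_graph[symmetric]) (rule pos)
    have "fpt_reducible P ?Q"
      by (rule fpt_reducible_ok[OF len bit K])
        (simp only: code corr encode_mem_p_models graph_structure pos)
    moreover have "fpt_reducible P ?Q'"
      by (rule fpt_reducible_ok[OF len bit K], subst code, subst encode_mem_p_models_undirected)
        (use pos sym corr in \<open>auto intro: graph_undirected\<close>)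
    ultimately show ?thesis ..
  qed
  then have "W1_hard ?Q" "W1_hard ?Q'"
    unfolding W1_hard_def W1_def using fpt_reducible_trans by blast+
  moreover have "?Q \<in> p_FD (\<ge>) p"
    unfolding p_FD_def using sent by (auto simp: vocabulary_def intro!: exI[of _ graph_voc] exI[of _ \<phi>])
  moreover have "?Q' \<in> p_FD_undirected (\<ge>) p"
    unfolding p_FD_undirected_def using sent by auto
  ultimately show ?thesis by blast
qed

section \<open>Formulas with two relevant quantifiers on graphs\<close>

lemma so_models_unary:
  "so_models cmp 1 S k \<phi> \<longleftrightarrow> (\<exists>I\<subseteq>univ S. cmp (card I) k \<and> holds (expand S ((\<lambda>u. [u]) ` I)) [] \<phi>)"
proof
  assume "so_models cmp 1 S k \<phi>"
  then obtain C where C: "C \<subseteq> tuples S 1" "cmp (card C) k" "holds (expand S C) [] \<phi>"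
    unfolding so_models_def by blast
  have "C = (\<lambda>u. [u]) ` {u. [u] \<in> C}"
    using C(1) by (auto simp: tuples_def image_iff length_Suc_conv subset_iff)
  moreover have "{u. [u] \<in> C} \<subseteq> univ S" using C(1) by (auto simp: tuples_def)
  moreover have "card ((\<lambda>u. [u]) ` {u. [u] \<in> C}) = card {u. [u] \<in> C}"
    by (rule card_image) (auto simp: inj_on_def)
  ultimately show "\<exists>I\<subseteq>univ S. cmp (card I) k \<and> holds (expand S ((\<lambda>u. [u]) ` I)) [] \<phi>"
    using C(2,3) by (intro exI[of _ "{u. [u] \<in> C}"]) simp
next
  assume "\<exists>I\<subseteq>univ S. cmp (card I) k \<and> holds (expand S ((\<lambda>u. [u]) ` I)) [] \<phi>"
  then obtain I where I: "I \<subseteq> univ S" "cmp (card I) k" "holds (expand S ((\<lambda>u. [u]) ` I)) [] \<phi>" by blast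
  have "card ((\<lambda>u. [u]) ` I) = card I" by (rule card_image) (auto simp: inj_on_def)
  then show "so_models cmp 1 S k \<phi>"
    unfolding so_models_def using I by (intro exI[of _ "(\<lambda>u. [u]) ` I"]) (auto simp: tuples_def)
qed

lemma holds_two_quantifiers:
  assumes "univ S \<noteq> {}"
    "\<And>us u us' v us''. length us = length p1 \<Longrightarrow> length us' = length p2 \<Longrightarrow> length us'' = length p3 \<Longrightarrow>
      holds_qf S (us @ u # us' @ v # us'') a \<longleftrightarrow> M u v"
  shows "holds S [] (p1 @ QAll # p2 @ Q # p3, a) \<longleftrightarrow>
    (\<forall>u\<in>univ S. case Q of QAll \<Rightarrow> \<forall>v\<in>univ S. M u v | QEx \<Rightarrow> \<exists>v\<in>univ S. M u v)"
proof (rule holds_append_const[OF assms(1)])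
  fix us :: "nat list" assume us: "length us = length p1"
  have "holds S (us @ [u]) (p2 @ Q # p3, a) \<longleftrightarrow>
    (case Q of QAll \<Rightarrow> \<forall>v\<in>univ S. M u v | QEx \<Rightarrow> \<exists>v\<in>univ S. M u v)" for u
  proof (rule holds_append_const[OF assms(1)])
    fix us' :: "nat list" assume us': "length us' = length p2"
    have "holds S (((us @ [u]) @ us') @ [v]) (p3, a) \<longleftrightarrow> M u v" for v
      by (rule holds_const[OF assms(1)]) (use assms(2) us us' in simp)
    then show "holds S ((us @ [u]) @ us') (Q # p3, a) \<longleftrightarrow>
      (case Q of QAll \<Rightarrow> \<forall>v\<in>univ S. M u v | QEx \<Rightarrow> \<exists>v\<in>univ S. M u v)"
      by (cases Q) simp_all
  qed
  then show "holds S ([] @ us) (QAll # p2 @ Q # p3, a) \<longleftrightarrow>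
    (\<forall>u\<in>univ S. case Q of QAll \<Rightarrow> \<forall>v\<in>univ S. M u v | QEx \<Rightarrow> \<exists>v\<in>univ S. M u v)"
    by simp
qed

lemma univ_graph: "univ (expand (graph N E) C) = {..<N}" "univ (graph N E) = {..<N}"
  by (auto simp: univ_def expand_def graph_def)

lemma rels_graph: "rels (expand (graph N E) C) ! 0 = {[u, v] |u v. u < N \<and> v < N \<and> E u v}"
  "rels (expand (graph N E) C) ! Suc 0 = C"
  by (auto simp: expand_def graph_def)

lemma nth_two:
  "length us = i \<Longrightarrow> (us @ u # us') ! i = u"
  "length us = i \<Longrightarrow> length us' = i' \<Longrightarrow> (us @ u # us' @ v # us'') ! Suc (i + i') = v"
  by (auto simp: nth_append)

text \<open>The two variables may coincide, so looped vertices are kept out of \<open>X\<close>, in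
  accordance with \<open>independent_set\<close>.\<close>

lemma hard_all_all:
  assumes "subseq [QAll, QAll] p"
  shows "(\<exists>Q\<in>p_FD (\<ge>) p. W1_hard Q) \<and> (\<exists>Q\<in>p_FD_undirected (\<ge>) p. W1_hard Q)"
proof -
  obtain p1 p2 p3 where p: "p = p1 @ QAll # p2 @ QAll # p3"
    using assms subseq_Cons_append by metis
  let ?i = "length p1" and ?j = "length p1 + 1 + length p2"
  let ?\<phi> = "Neg (Conj (Atom 0 [?i, ?j]) (Conj (Atom 1 [?i]) (Atom 1 [?j])))"
  have models: "so_models (\<ge>) 1 (graph N E) k (p, ?\<phi>) \<longleftrightarrow>
    independent_set N E k" if "0 < N" for N E k
  proof -
    have "holds (expand (graph N E) ((\<lambda>u. [u]) ` I)) [] (p, ?\<phi>) \<longleftrightarrow> (\<forall>u\<in>I. \<forall>v\<in>I. \<not> E u v)"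
      if "I \<subseteq> {..<N}" for I
    proof -
      let ?M = "\<lambda>u v. \<not> (u < N \<and> v < N \<and> E u v \<and> u \<in> I \<and> v \<in> I)"
      have "holds (expand (graph N E) ((\<lambda>u. [u]) ` I)) [] (p, ?\<phi>) \<longleftrightarrow> (\<forall>u\<in>{..<N}. \<forall>v\<in>{..<N}. ?M u v)"
        unfolding p
        by (subst holds_two_quantifiers[where M = ?M])
          (use \<open>0 < N\<close> in \<open>auto simp: nth_two univ_graph rels_graph lessThan_empty_iff image_iff\<close>)
      then show ?thesis using that by blast
    qed
    then show ?thesis unfolding so_models_unary univ_graph independent_set_def by auto
  qed
  show ?thesis
  proof (rule hard_problems[where \<phi> = ?\<phi>])
    show "sentence (graph_voc @ [1]) (p, ?\<phi>)" by (simp add: sentence_def p)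
  next
    fix V s l a assume "sentence (V @ [s]) (replicate l QAll, a)"
    then obtain N E K where "graph_reduction (encode_problem V (p_models (=) s V (replicate l QAll, a)))
        independent_set N E K"
      using independent_set_instance by blast
    then have "graph_reduction (encode_problem V (p_models (=) s V (replicate l QAll, a)))
        (\<lambda>N E k. so_models (\<ge>) 1 (graph N E) k (p, ?\<phi>)) N E K"
      using models unfolding graph_reduction_def by simp
    then show "\<exists>N E K. graph_reduction (encode_problem V (p_models (=) s V (replicate l QAll, a)))
        (\<lambda>N E k. so_models (\<ge>) 1 (graph N E) k (p, ?\<phi>)) N E K" by blast
  qed
qed

text \<open>Two looped vertices for each pair \<open>(a, b)\<close> of vertices: if the pair is an edge, both are joined
  to \<open>a\<close> and \<open>b\<close>, otherwise they are joined to each other. If looped vertices are not in \<open>X\<close> and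
  have a neighbour outside \<open>X\<close> other than themselves, then \<open>X\<close> contains no edge.\<close>

definition incidence_graph :: "nat \<Rightarrow> (nat \<Rightarrow> nat \<Rightarrow> bool) \<Rightarrow> nat \<Rightarrow> nat \<Rightarrow> bool" where
  "incidence_graph N E u v \<longleftrightarrow>
    (let q = (u - N) div 2; q' = (v - N) div 2; a = q div N; b = q mod N; a' = q' div N; b' = q' mod N in
      (u < N \<and> N \<le> v \<and> E a' b' \<and> (u = a' \<or> u = b')) \<or>
      (v < N \<and> N \<le> u \<and> E a b \<and> (v = a \<or> v = b)) \<or>
      (N \<le> u \<and> N \<le> v \<and> (u = v \<or> (q = q' \<and> \<not> E a b))))"

lemma incidence_graph_sym: "incidence_graph N E u v \<Longrightarrow> incidence_graph N E v u"
  unfolding incidence_graph_def Let_def by metis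

text \<open>A looped vertex of an edge has only the ends of the edge as neighbours besides itself,
  so one end is outside \<open>X\<close>. For a nonedge the twin is such a neighbour and nothing is
  demanded of the ends; this is why each pair has two vertices. Vertices without loop satisfy the
  implication vacuously.\<close>

lemma incidence_graph_independent:
  fixes E :: "nat \<Rightarrow> nat \<Rightarrow> bool" and N :: nat
  assumes "I \<subseteq> {..<N + 2 * (N * N)}"
  defines "G \<equiv> incidence_graph N E"
  shows "(\<forall>u<N + 2 * (N * N). \<exists>v<N + 2 * (N * N). G u u \<longrightarrow> u \<notin> I \<and> G v u \<and> v \<noteq> u \<and> v \<notin> I) \<longleftrightarrow>
    I \<subseteq> {..<N} \<and> (\<forall>u\<in>I. \<forall>v\<in>I. \<not> E u v)"
proof
  assume *: "\<forall>u<N + 2 * (N * N). \<exists>v<N + 2 * (N * N). G u u \<longrightarrow> u \<notin> I \<and> G v u \<and> v \<noteq> u \<and> v \<notin> I"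
  have loop: "G u u" if "N \<le> u" for u using that by (simp add: G_def incidence_graph_def)
  have sub: "I \<subseteq> {..<N}"
  proof
    fix u assume u: "u \<in> I"
    show "u \<in> {..<N}"
    proof (rule ccontr)
      assume "u \<notin> {..<N}"
      then have "G u u" using loop by simp
      moreover have "u < N + 2 * (N * N)" using u assms by auto
      ultimately show False using * u by blast
    qed
  qed
  moreover have False if ab: "a \<in> I" "b \<in> I" "E a b" for a b
  proof -
    \<comment> \<open>The first of the two vertices of the pair \<open>(a, b)\<close>.\<close>
    define w where "w = N + 2 * (a * N + b)"
    have lt: "a < N" "b < N" using ab sub by auto
    have "a * N + b < a * N + N" using lt by simp
    also have "a * N + N = (a + 1) * N" by simp
    also have "\<dots> \<le> N * N" using lt by (intro mult_le_mono1) simp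
    finally have "w < N + 2 * (N * N)" by (simp add: w_def)
    moreover have w: "N \<le> w" by (simp add: w_def)
    ultimately obtain v where v: "G v w" "v \<noteq> w" "v \<notin> I" using * loop[of w] by blast
    have d: "(a * N + b) div N = a" "(a * N + b) mod N = b" using div_mod_digit[OF lt(2)] by blast+
    have q: "(w - N) div 2 = a * N + b" by (simp add: w_def)
    have "v = a \<or> v = b \<or>
        ((v - N) div 2 = a * N + b \<and> \<not> E ((v - N) div 2 div N) ((v - N) div 2 mod N))"
      using v(1,2) w unfolding G_def incidence_graph_def Let_def q d by (elim disjE conjE) simp_all
    then show False using v(3) ab d by metis
  qed
  ultimately show "I \<subseteq> {..<N} \<and> (\<forall>u\<in>I. \<forall>v\<in>I. \<not> E u v)" by blast
next
  assume I: "I \<subseteq> {..<N} \<and> (\<forall>u\<in>I. \<forall>v\<in>I. \<not> E u v)"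
  show "\<forall>u<N + 2 * (N * N). \<exists>v<N + 2 * (N * N). G u u \<longrightarrow> u \<notin> I \<and> G v u \<and> v \<noteq> u \<and> v \<notin> I"
  proof (intro allI impI)
    fix u assume u: "u < N + 2 * (N * N)"
    show "\<exists>v<N + 2 * (N * N). G u u \<longrightarrow> u \<notin> I \<and> G v u \<and> v \<noteq> u \<and> v \<notin> I"
    proof (cases "u < N")
      case True
      then have "\<not> G u u" by (simp add: G_def incidence_graph_def)
      then show ?thesis using u by blast
    next
      case False
      define q where "q = (u - N) div 2"
      let ?a = "q div N" and ?b = "q mod N"
      have q: "q < N * N" using u False by (simp add: q_def)
      then have N: "0 < N" by (cases N) auto
      have ab: "?a < N" "?b < N" using q N by (simp_all add: less_mult_imp_div_less)
      have u_I: "u \<notin> I" using False I by auto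
      show ?thesis
      proof (cases "E ?a ?b")
        case True
        have "\<exists>v. v \<notin> I \<and> (v = ?a \<or> v = ?b)" using I True by blast
        then obtain v where v: "v \<notin> I" "v = ?a \<or> v = ?b" by blast
        then have "v < N" using ab by auto
        moreover from this have "G v u"
          using v(2) False True unfolding G_def incidence_graph_def Let_def q_def[symmetric] by auto
        ultimately show ?thesis using v(1) u_I False by (intro exI[of _ v]) auto
      next
        case nE: False
        \<comment> \<open>The twin: pair number \<open>q\<close> owns the vertices
          \<open>N + 2 * q\<close> and \<open>N + 2 * q + 1\<close>.\<close>
        define v where "v = (if even (u - N) then u + 1 else u - 1)"
        have "u - N < 2 * (N * N)" using u False by simp
        have v: "N \<le> v" "v < N + 2 * (N * N)" "v \<noteq> u" "(v - N) div 2 = q"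
        proof -
          obtain t where t: "u = N + t" using False by (metis le_Suc_ex not_less)
          show "N \<le> v" "v < N + 2 * (N * N)" "v \<noteq> u" "(v - N) div 2 = q"
            using u unfolding v_def q_def t by (auto elim!: evenE oddE)
        qed
        then have "G v u"
          using False nE unfolding G_def incidence_graph_def Let_def q_def[symmetric] by auto
        moreover have "v \<notin> I" using v(1) I by auto
        ultimately show ?thesis using v u_I by blast
      qed
    qed
  qed
qed

lemma okb_incidence_graph:
  assumes N: "ok z (\<lambda>x e. N x (e 0))" and E: "okb z (\<lambda>x e. E x (e 2) (e 0) (e 1))"
  shows "okb z (\<lambda>x e. incidence_graph (N x (e 2)) (E x (e 2)) (e 0) (e 1))"
proof -
  have N': "ok z (\<lambda>x e. N x (e 2))" using ok_rename[OF N, of "\<lambda>i. if i = 0 then 2 else i"] by simp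
  have E': "okb z (\<lambda>x e. E x (e 2) (A x e) (B x e))" if "ok z A" "ok z B" for A B
    by (rule okb_subst3[where H = "\<lambda>x u v k. E x k u v", OF E that ok_var])
  show ?thesis
    unfolding incidence_graph_def Let_def
    by (intro okb_disj okb_conj okb_less okb_le okb_eq okb_not E' ok_div ok_mod ok_diff ok_const ok_var N')
qed

text \<open>A single universal quantifier cannot range over both ends of an edge, so pairs become
  vertices. Loops mark them, as the edge relation is the only symbol of the vocabulary.\<close>

lemma hard_all_ex:
  assumes "subseq [QAll, QEx] p"
  shows "(\<exists>Q\<in>p_FD (\<ge>) p. W1_hard Q) \<and> (\<exists>Q\<in>p_FD_undirected (\<ge>) p. W1_hard Q)"
proof -
  obtain p1 p2 p3 where p: "p = p1 @ QAll # p2 @ QEx # p3"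
    using assms subseq_Cons_append by metis
  let ?i = "length p1" and ?j = "length p1 + 1 + length p2"
  let ?\<phi> = "Disj (Neg (Atom 0 [?i, ?i])) (Conj (Neg (Atom 1 [?i]))
    (Conj (Atom 0 [?j, ?i]) (Conj (Neg (Equal ?j ?i)) (Neg (Atom 1 [?j])))))"
  have models: "so_models (\<ge>) 1 (graph (N + 2 * (N * N)) (incidence_graph N E)) k (p, ?\<phi>) \<longleftrightarrow>
    independent_set N E k" if "0 < N" for N E k
  proof -
    let ?N = "N + 2 * (N * N)"
    let ?G = "incidence_graph N E"
    let ?H = "\<lambda>I. holds (expand (graph ?N ?G) ((\<lambda>u. [u]) ` I)) [] (p, ?\<phi>)"
    have eq: "?H I \<longleftrightarrow> I \<subseteq> {..<N} \<and> (\<forall>u\<in>I. \<forall>v\<in>I. \<not> E u v)" if "I \<subseteq> {..<?N}" for I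
    proof -
      let ?M = "\<lambda>u v. (u < ?N \<and> ?G u u) \<longrightarrow> u \<notin> I \<and> (v < ?N \<and> u < ?N \<and> ?G v u) \<and> v \<noteq> u \<and> v \<notin> I"
      have "holds (expand (graph ?N ?G) ((\<lambda>u. [u]) ` I)) [] (p, ?\<phi>) \<longleftrightarrow> (\<forall>u\<in>{..<?N}. \<exists>v\<in>{..<?N}. ?M u v)"
        unfolding p
        by (subst holds_two_quantifiers[where M = ?M])
          (use \<open>0 < N\<close> in \<open>auto simp: nth_two univ_graph rels_graph lessThan_empty_iff image_iff\<close>)
      also have "\<dots> \<longleftrightarrow> (\<forall>u<?N. \<exists>v<?N. ?G u u \<longrightarrow> u \<notin> I \<and> ?G v u \<and> v \<noteq> u \<and> v \<notin> I)" by blast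
      finally show ?thesis unfolding incidence_graph_independent[OF that] .
    qed
    show ?thesis
      unfolding so_models_unary univ_graph independent_set_def
    proof
      assume "\<exists>I\<subseteq>{..<?N}. k \<le> card I \<and> ?H I"
      then obtain I where "I \<subseteq> {..<?N}" "k \<le> card I" "?H I" by blast
      then show "\<exists>I\<subseteq>{..<N}. k \<le> card I \<and> (\<forall>u\<in>I. \<forall>v\<in>I. \<not> E u v)"
        using eq[of I] by (intro exI[of _ I]) simp
    next
      assume "\<exists>I\<subseteq>{..<N}. k \<le> card I \<and> (\<forall>u\<in>I. \<forall>v\<in>I. \<not> E u v)"
      then obtain I where I: "I \<subseteq> {..<N}" "k \<le> card I" "\<forall>u\<in>I. \<forall>v\<in>I. \<not> E u v" by blast
      then have "I \<subseteq> {..<?N}" by auto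
      then show "\<exists>I\<subseteq>{..<?N}. k \<le> card I \<and> ?H I"
        using eq[of I] I by (intro exI[of _ I]) simp
    qed
  qed
  show ?thesis
  proof (rule hard_problems[where \<phi> = ?\<phi>])
    show "sentence (graph_voc @ [1]) (p, ?\<phi>)" by (simp add: sentence_def p)
  next
    fix V s l a assume "sentence (V @ [s]) (replicate l QAll, a)"
    then obtain N E K where G: "graph_reduction (encode_problem V (p_models (=) s V (replicate l QAll, a)))
        independent_set N E K"
      using independent_set_instance by blast
    have N: "ok True (\<lambda>x e. N x (e 0))" and E: "okb True (\<lambda>x e. E x (e 2) (e 0) (e 1))"
      and K: "ok True (\<lambda>x e. K (e 0))" and pos: "\<And>x k. 0 < N x k"
      and corr: "\<And>x k. (x, k) \<in> encode_problem V (p_models (=) s V (replicate l QAll, a)) \<longleftrightarrow>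
        independent_set (N x k) (E x k) (K k)"
      using G unfolding graph_reduction_def by simp_all
    have "graph_reduction (encode_problem V (p_models (=) s V (replicate l QAll, a)))
        (\<lambda>N E k. so_models (\<ge>) 1 (graph N E) k (p, ?\<phi>))
        (\<lambda>x k. N x k + 2 * (N x k * N x k)) (\<lambda>x k. incidence_graph (N x k) (E x k)) K"
      unfolding graph_reduction_def
    proof (intro conjI allI impI)
      show "ok True (\<lambda>x e. N x (e 0) + 2 * (N x (e 0) * N x (e 0)))"
        by (intro ok_add ok_mult ok_const N)
      show "okb True (\<lambda>x e. incidence_graph (N x (e 2)) (E x (e 2)) (e 0) (e 1))"
        by (rule okb_incidence_graph[OF N E])
      show "ok True (\<lambda>x e. K (e 0))" by (rule K)
      fix x k
      show "0 < N x k + 2 * (N x k * N x k)" using pos[of x k] by simp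
      show "(x, k) \<in> encode_problem V (p_models (=) s V (replicate l QAll, a)) \<longleftrightarrow>
          so_models (\<ge>) 1 (graph (N x k + 2 * (N x k * N x k)) (incidence_graph (N x k) (E x k))) (K k) (p, ?\<phi>)"
        by (simp only: corr models[OF pos])
    qed (rule incidence_graph_sym)
    then show "\<exists>N E K. graph_reduction (encode_problem V (p_models (=) s V (replicate l QAll, a)))
        (\<lambda>N E k. so_models (\<ge>) 1 (graph N E) k (p, ?\<phi>)) N E K" by blast
  qed
qed

section \<open>Circuits from formulas\<close>

text \<open>Circuits as trees, which compose freely; each subtree becomes a block of gates of its
  own, so the size of the tree bounds the length of the circuit.\<close>

datatype bform = BIn nat | BNot bform | BAnd "bform list" | BOr "bform list"

fun bval :: "bform \<Rightarrow> bool list \<Rightarrow> bool" where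
  "bval (BIn j) x = x ! j"
| "bval (BNot t) x = (\<not> bval t x)"
| "bval (BAnd ts) x = (\<forall>t\<in>set ts. bval t x)"
| "bval (BOr ts) x = (\<exists>t\<in>set ts. bval t x)"

fun bwf :: "nat \<Rightarrow> bform \<Rightarrow> bool" where
  "bwf n (BIn j) = (j < n)"
| "bwf n (BNot t) = bwf n t"
| "bwf n (BAnd ts) = (\<forall>t\<in>set ts. bwf n t)"
| "bwf n (BOr ts) = (\<forall>t\<in>set ts. bwf n t)"

fun bsize :: "bform \<Rightarrow> nat" where
  "bsize (BIn j) = 1"
| "bsize (BNot t) = Suc (bsize t)"
| "bsize (BAnd ts) = Suc (sum_list (map bsize ts))"
| "bsize (BOr ts) = Suc (sum_list (map bsize ts))"

text \<open>A predicate for upper bounds avoids maxima over possibly empty lists.\<close>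

fun bdepth_le :: "nat \<Rightarrow> bform \<Rightarrow> bool" where
  "bdepth_le d (BIn j) = True"
| "bdepth_le d (BNot t) = (0 < d \<and> bdepth_le (d - 1) t)"
| "bdepth_le d (BAnd ts) = (0 < d \<and> (\<forall>t\<in>set ts. bdepth_le (d - 1) t))"
| "bdepth_le d (BOr ts) = (0 < d \<and> (\<forall>t\<in>set ts. bdepth_le (d - 1) t))"

lemma bdepth_le_mono: "bdepth_le d t \<Longrightarrow> d \<le> d' \<Longrightarrow> bdepth_le d' t"
proof (induction d t arbitrary: d' rule: bdepth_le.induct)
  case (2 d t)
  then show ?case by (auto intro: 2)
next
  case (3 d ts)
  then show ?case by (auto intro: 3)
next
  case (4 d ts)
  then show ?case by (auto intro: 4)
qed auto

text \<open>The common form of \<open>gate_vals\<close> and \<open>gate_depths\<close>, with an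
  arbitrary prefix \<open>v\<close> in place of the empty one, so that pieces of a circuit can be
  treated separately.\<close>

definition scan :: "('b list \<Rightarrow> 'a \<Rightarrow> 'b) \<Rightarrow> 'b list \<Rightarrow> 'a list \<Rightarrow> 'b list" where
  "scan F = foldl (\<lambda>v g. v @ [F v g])"

lemma scan_append: "scan F v (c @ c') = scan F (scan F v c) c'"
  by (simp add: scan_def)

lemma scan_Nil [simp]: "scan F v [] = v"
  by (simp add: scan_def)

lemma scan_snoc: "scan F v (c @ [g]) = scan F v c @ [F (scan F v c) g]"
  by (simp add: scan_def)

lemma length_scan [simp]: "length (scan F v c) = length v + length c"
  by (induction c rule: rev_induct) (simp_all add: scan_snoc)

lemma nth_scan: "i < length v \<Longrightarrow> scan F v c ! i = v ! i"
  by (induction c rule: rev_induct) (simp_all add: scan_snoc nth_append)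

text \<open>Here \<open>c\<close> is a piece of a circuit that starts at position \<open>b\<close>.\<close>

definition gates_wf :: "nat \<Rightarrow> nat \<Rightarrow> circuit \<Rightarrow> bool" where
  "gates_wf n b c \<longleftrightarrow> (\<forall>i<length c. wf_gate n (b + i) (c ! i))"

definition gates_depth_le :: "nat \<Rightarrow> nat \<Rightarrow> circuit \<Rightarrow> bool" where
  "gates_depth_le d b c \<longleftrightarrow> (\<forall>v. length v = b \<longrightarrow> (\<forall>i<length c. scan gate_depth v c ! (b + i) \<le> d))"

lemma gates_wf_append: "gates_wf n b c \<Longrightarrow> gates_wf n (b + length c) c' \<Longrightarrow> gates_wf n b (c @ c')"
  unfolding gates_wf_def
proof (intro allI impI)
  fix i assume *: "\<forall>i<length c. wf_gate n (b + i) (c ! i)"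
    "\<forall>i<length c'. wf_gate n (b + length c + i) (c' ! i)" "i < length (c @ c')"
  show "wf_gate n (b + i) ((c @ c') ! i)"
  proof (cases "i < length c")
    case False
    then show ?thesis using * spec[OF *(2), of "i - length c"] by (auto simp: nth_append)
  qed (use * in \<open>auto simp: nth_append\<close>)
qed

lemma gates_depth_le_append:
  "gates_depth_le d b c \<Longrightarrow> gates_depth_le d (b + length c) c' \<Longrightarrow> gates_depth_le d b (c @ c')"
  unfolding gates_depth_le_def
proof (intro allI impI)
  fix i and v :: "nat list"
  assume *: "\<forall>v. length v = b \<longrightarrow> (\<forall>i<length c. scan gate_depth v c ! (b + i) \<le> d)"
    "\<forall>v. length v = b + length c \<longrightarrow> (\<forall>i<length c'. scan gate_depth v c' ! (b + length c + i) \<le> d)"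
    "length v = b" "i < length (c @ c')"
  show "scan gate_depth v (c @ c') ! (b + i) \<le> d"
  proof (cases "i < length c")
    case True
    then show ?thesis using * by (simp add: scan_append nth_scan)
  next
    case False
    then have "b + i = b + length c + (i - length c)" "i - length c < length c'" using *(4) by auto
    moreover have "length (scan gate_depth v c) = b + length c" using *(3) by simp
    ultimately show ?thesis unfolding scan_append using *(2) by metis
  qed
qed

text \<open>Quantification over all prefixes \<open>v\<close> of length \<open>b\<close> expresses
  that the result does not depend on the gates in front of the piece.\<close>

definition computes :: "nat \<Rightarrow> nat \<Rightarrow> nat \<Rightarrow> circuit \<Rightarrow> bform \<Rightarrow> bool" where
  "computes n d b c t \<longleftrightarrow> c \<noteq> [] \<and> length c \<le> bsize t \<and> gates_wf n b c \<and> gates_depth_le d b c \<and>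
    (\<forall>x v. length v = b \<longrightarrow> last (scan (gate_val x) v c) = bval t x)"

definition computes_list :: "nat \<Rightarrow> nat \<Rightarrow> nat \<Rightarrow> circuit \<Rightarrow> nat list \<Rightarrow> bform list \<Rightarrow> bool" where
  "computes_list n d b c js ts \<longleftrightarrow> length c \<le> sum_list (map bsize ts) \<and> gates_wf n b c \<and>
    gates_depth_le d b c \<and> length js = length ts \<and>
    (\<forall>i<length ts. b \<le> js ! i \<and> js ! i < b + length c \<and>
      (\<forall>x v. length v = b \<longrightarrow> scan (gate_val x) v c ! (js ! i) = bval (ts ! i) x))"

lemma computes_list_exists:
  "(\<And>t b. t \<in> set ts \<Longrightarrow> \<exists>c. computes n d b c t) \<Longrightarrow> \<exists>c js. computes_list n d b c js ts"
proof (induction ts arbitrary: b)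
  case Nil
  show ?case
    by (intro exI[of _ "[]"]) (simp add: computes_list_def gates_wf_def gates_depth_le_def)
next
  case (Cons t ts)
  obtain c where c: "computes n d b c t" using Cons.prems by force
  obtain c' js where c': "computes_list n d (b + length c) c' js ts"
    using Cons.IH[of "b + length c"] Cons.prems by force
  have ne: "c \<noteq> []" using c by (simp add: computes_def)
  then have pos: "b \<le> b + length c - Suc 0" "b + length c - Suc 0 < b + (length c + i)" for i
    by (cases c; simp)+
  have "computes_list n d b (c @ c') ((b + length c - 1) # js) (t # ts)"
    unfolding computes_list_def
  proof (intro conjI allI impI)
    show "length (c @ c') \<le> sum_list (map bsize (t # ts))"
      using c c' by (simp add: computes_def computes_list_def)
    show "gates_wf n b (c @ c')"
      using c c' by (simp add: computes_def computes_list_def gates_wf_append)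
    show "gates_depth_le d b (c @ c')"
      using c c' by (simp add: computes_def computes_list_def gates_depth_le_append)
    show "length ((b + length c - 1) # js) = length (t # ts)" using c' by (simp add: computes_list_def)
    fix i assume i: "i < length (t # ts)"
    show "b \<le> ((b + length c - 1) # js) ! i"
      using c' i pos by (cases i) (auto simp: computes_list_def)
    show "((b + length c - 1) # js) ! i < b + length (c @ c')"
      using c' i pos by (cases i) (auto simp: computes_list_def)
    fix x :: "bool list" and v :: "bool list" assume v: "length v = b"
    show "scan (gate_val x) v (c @ c') ! (((b + length c - 1) # js) ! i) = bval ((t # ts) ! i) x"
    proof (cases i)
      case 0
      have "scan (gate_val x) v (c @ c') ! (b + length c - 1) = scan (gate_val x) v c ! (b + length c - 1)"
        unfolding scan_append by (rule nth_scan) (use v ne in auto)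
      also have "\<dots> = last (scan (gate_val x) v c)"
        using v ne by (subst last_conv_nth) (auto dest: arg_cong[where f = length])
      finally show ?thesis using c v 0 by (simp add: computes_def)
    next
      case (Suc i')
      have "length (scan (gate_val x) v c) = b + length c" using v by simp
      then show ?thesis using c' i Suc unfolding scan_append by (simp add: computes_list_def)
    qed
  qed
  then show ?case by blast
qed

lemma computes_gate:
  assumes "computes_list n d b c js ts"
    and g: "(g = GAnd js \<and> t = BAnd ts) \<or> (g = GOr js \<and> t = BOr ts)"
  shows "computes n (Suc d) b (c @ [g]) t"
proof -
  note c = assms(1)[unfolded computes_list_def]
  have js: "b \<le> j \<and> j < b + length c" if "j \<in> set js" for j
    using that c by (auto simp: in_set_conv_nth)
  have dep: "gates_depth_le d b c" using c by blast
  show ?thesis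
    unfolding computes_def
  proof (intro conjI allI impI)
    show "length (c @ [g]) \<le> bsize t" using c g by auto
    have "gates_wf n (b + length c) [g]" using js g by (auto simp: gates_wf_def)
    then show "gates_wf n b (c @ [g])" using c by (simp add: gates_wf_append)
    show "gates_depth_le (Suc d) b (c @ [g])"
      unfolding gates_depth_le_def
    proof (intro allI impI)
      fix v :: "nat list" and i assume v: "length v = b" and i: "i < length (c @ [g])"
      have old: "scan gate_depth v c ! (b + i') \<le> d" if "i' < length c" for i'
        using dep v that by (simp add: gates_depth_le_def)
      have "scan gate_depth v c ! j \<le> d" if "j \<in> set js" for j
      proof -
        have "j - b < length c" "b + (j - b) = j" using js[OF that] by auto
        then show ?thesis using old[of "j - b"] by simp
      qed
      then have "gate_depth (scan gate_depth v c) g \<le> Suc d" using g by auto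
      then show "scan gate_depth v (c @ [g]) ! (b + i) \<le> Suc d"
        using old[of i] i v by (cases "i < length c") (auto simp: scan_snoc nth_append less_Suc_eq)
    qed
    fix x v :: "bool list" assume v: "length v = b"
    have "scan (gate_val x) v c ! (js ! i) = bval (ts ! i) x" if "i < length ts" for i
      using c v that by blast
    moreover have "length js = length ts" using c by blast
    ultimately have "(\<forall>j\<in>set js. scan (gate_val x) v c ! j) \<longleftrightarrow> (\<forall>t\<in>set ts. bval t x)"
      "(\<forall>j\<in>set js. \<not> scan (gate_val x) v c ! j) \<longleftrightarrow> (\<forall>t\<in>set ts. \<not> bval t x)"
      by (simp_all add: all_set_conv_all_nth)
    then show "last (scan (gate_val x) v (c @ [g])) = bval t x"
      using g by (auto simp: scan_snoc)
  qed simp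
qed

lemma computes_exists: "bwf n t \<Longrightarrow> bdepth_le d t \<Longrightarrow> \<exists>c. computes n d b c t"
proof (induction t arbitrary: d b)
  case (BIn j)
  have "computes n d b [GInput j] (BIn j)"
    using BIn unfolding computes_def gates_wf_def gates_depth_le_def
    by (auto simp: scan_def nth_append)
  then show ?case by blast
next
  case (BNot t)
  then obtain c where c: "computes n (d - 1) b c t" by force
  let ?g = "GNot (b + length c - 1)"
  note c' = c[unfolded computes_def]
  have ne: "c \<noteq> []" using c' by blast
  have d: "0 < d" using BNot.prems by simp
  have "computes n d b (c @ [?g]) (BNot t)"
    unfolding computes_def
  proof (intro conjI allI impI)
    show "length (c @ [?g]) \<le> bsize (BNot t)" using c' by simp
    have "gates_wf n (b + length c) [?g]" using ne by (auto simp: gates_wf_def)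
    then show "gates_wf n b (c @ [?g])" using c' by (simp add: gates_wf_append)
    show "gates_depth_le d b (c @ [?g])"
      unfolding gates_depth_le_def
    proof (intro allI impI)
      fix v :: "nat list" and i assume v: "length v = b" and i: "i < length (c @ [?g])"
      have old: "scan gate_depth v c ! (b + i') \<le> d - 1" if "i' < length c" for i'
        using c' v that by (simp add: gates_depth_le_def)
      have "b + length c - 1 = b + (length c - 1)" "length c - 1 < length c" using ne by (auto simp: Suc_le_eq)
      then have "gate_depth (scan gate_depth v c) ?g \<le> d"
        using old[of "length c - 1"] d by simp
      then show "scan gate_depth v (c @ [?g]) ! (b + i) \<le> d"
        using old[of i] i v by (cases "i < length c") (auto simp: scan_snoc nth_append less_Suc_eq)
    qed
    fix x v :: "bool list" assume v: "length v = b"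
    have "scan (gate_val x) v c ! (b + length c - 1) = last (scan (gate_val x) v c)"
      using v ne by (subst last_conv_nth) (auto dest: arg_cong[where f = length])
    then show "last (scan (gate_val x) v (c @ [?g])) = bval (BNot t) x"
      using c' v by (simp add: scan_snoc)
  qed simp
  then show ?case by blast
next
  case (BAnd ts)
  then have "\<exists>c js. computes_list n (d - 1) b c js ts" by (intro computes_list_exists) auto
  then obtain c js where c: "computes_list n (d - 1) b c js ts" by blast
  have "0 < d" using BAnd.prems by simp
  then have "computes n d b (c @ [GAnd js]) (BAnd ts)"
    using computes_gate[OF c, of "GAnd js" "BAnd ts"] by simp
  then show ?case by blast
next
  case (BOr ts)
  then have "\<exists>c js. computes_list n (d - 1) b c js ts" by (intro computes_list_exists) auto
  then obtain c js where c: "computes_list n (d - 1) b c js ts" by blast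
  have "0 < d" using BOr.prems by simp
  then have "computes n d b (c @ [GOr js]) (BOr ts)"
    using computes_gate[OF c, of "GOr js" "BOr ts"] by simp
  then show ?case by blast
qed

text \<open>Families in \<open>para_AC0\<close> are nonuniform, so the circuits may be chosen by
  mere existence; only the bound \<open>f\<close> must be computable.\<close>

lemma para_AC0I:
  assumes "computable f" "\<And>n k. bwf n (F n k)" "\<And>n k. bsize (F n k) \<le> f k * (n + 1) ^ c"
    "\<And>n k. bdepth_le d (F n k)" "\<And>x k. (x, k) \<in> Q \<longleftrightarrow> bval (F (length x) k) x"
  shows "Q \<in> para_AC0"
proof -
  have "\<forall>n k. \<exists>c. computes n d 0 c (F n k)"
    using computes_exists[OF assms(2,4)] by blast
  then obtain C where C: "\<And>n k. computes n d 0 (C n k) (F n k)" by metis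
  have "wf_circuit n (C n k) \<and> length (C n k) \<le> f k * (n + 1) ^ c \<and> depth (C n k) \<le> d" for n k
  proof (intro conjI)
    note c = C[of n k, unfolded computes_def]
    show "wf_circuit n (C n k)" using c by (simp add: wf_circuit_def gates_wf_def)
    show "length (C n k) \<le> f k * (n + 1) ^ c" using c assms(3) le_trans by blast
    have ext: "gate_depths (C n k) = scan gate_depth [] (C n k)"
      by (simp add: gate_depths_def scan_def)
    then have "length (gate_depths (C n k)) = length (C n k)" by simp
    moreover have "gate_depths (C n k) ! i \<le> d" if "i < length (C n k)" for i
      using c that ext by (simp add: gates_depth_le_def)
    ultimately show "depth (C n k) \<le> d"
      unfolding depth_def using c by (subst Max_le_iff) (auto simp: in_set_conv_nth)
  qed
  moreover have "accepts (C n k) x = bval (F n k) x" for n k x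
    using C[of n k] by (simp add: computes_def accepts_def gate_vals_def scan_def)
  ultimately show ?thesis
    unfolding para_AC0_def using assms(1,5) by blast
qed

lemma sum_list_le: "(\<And>t. t \<in> set ts \<Longrightarrow> f t \<le> (b::nat)) \<Longrightarrow> sum_list (map f ts) \<le> length ts * b"
  by (induction ts) (auto intro: add_mono)

section \<open>Threshold formulas\<close>

text \<open>Distinct numbers below \<open>2 ^ L\<close> differ in some bit, hence any \<open>k\<close> of them are separated by \<open>k\<close> bit
  positions. Guessing the positions and the \<open>k\<close> bit patterns costs
  \<open>L ^ k * 2 ^ (k * k) \<le> k ^ k * 2 ^ L * 2 ^ (k * k)\<close>.\<close>

definition hash :: "nat list \<Rightarrow> nat \<Rightarrow> nat list" where
  "hash J u = map (digit 2 u) J"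

lemma bits_differ:
  assumes "u < 2 ^ L" "v < 2 ^ L" "u \<noteq> v"
  shows "\<exists>j<L. digit 2 u j \<noteq> digit 2 v j"
proof (rule ccontr)
  assume "\<not> ?thesis"
  then have "tup 2 L u = tup 2 L v"
    by (intro nth_equalityI) (auto simp: nth_tup digit_def)
  then have "idx 2 (tup 2 L u) = idx 2 (tup 2 L v)" by simp
  then show False using assms by (simp add: idx_tup)
qed

text \<open>The hash is injective on the old set, so a new element collides with at most one old
  element; one bit that tells these two apart repairs the collision.\<close>

lemma separating_positions:
  "finite A \<Longrightarrow> A \<subseteq> {..<2 ^ L} \<Longrightarrow> 0 < L \<Longrightarrow>
    \<exists>J. length J = card A \<and> set J \<subseteq> {..<L} \<and> inj_on (hash J) A"
proof (induction A rule: finite_induct)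
  case empty
  then show ?case by auto
next
  case (insert a A)
  then obtain J where J: "length J = card A" "set J \<subseteq> {..<L}" "inj_on (hash J) A" by auto
  have hd: "hash (j # J) u = digit 2 u j # hash J u" for j u by (simp add: hash_def)
  have "\<exists>j<L. \<forall>b\<in>A. hash (j # J) b \<noteq> hash (j # J) a"
  proof (cases "\<exists>b\<in>A. hash J b = hash J a")
    case True
    then obtain b where b: "b \<in> A" "hash J b = hash J a" by blast
    then have "b \<noteq> a" using insert.hyps by blast
    then obtain j where j: "j < L" "digit 2 b j \<noteq> digit 2 a j"
      using bits_differ[of b L a] b insert.prems by auto
    have "hash (j # J) b' \<noteq> hash (j # J) a" if "b' \<in> A" for b'
    proof
      assume eq: "hash (j # J) b' = hash (j # J) a"
      then have "hash J b' = hash J b" using b by (simp add: hd)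
      then have "b' = b" using inj_onD[OF J(3)] b(1) that by blast
      then show False using eq j by (simp add: hd)
    qed
    then show ?thesis using j by blast
  next
    \<comment> \<open>Without a collision an arbitrary position pads \<open>J\<close> to the
      prescribed length, which uses \<open>0 < L\<close>.\<close>
    case False
    then show ?thesis using insert.prems by (auto simp: hd)
  qed
  then obtain j where j: "j < L" "\<forall>b\<in>A. hash (j # J) b \<noteq> hash (j # J) a" by blast
  have "inj_on (hash (j # J)) A" using J(3) by (auto simp: inj_on_def hd)
  then have "inj_on (hash (j # J)) (insert a A)" using j(2) by (auto simp: inj_on_def)
  then show ?case using J j insert.hyps by (intro exI[of _ "j # J"]) simp
qed

text \<open>Elements with distinct hash values are distinct, so soundness holds for any guessed
  \<open>J\<close>; a separating \<open>J\<close> matters for completeness.\<close>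

definition threshold :: "nat \<Rightarrow> nat \<Rightarrow> nat \<Rightarrow> (nat \<Rightarrow> bform) \<Rightarrow> bform" where
  "threshold k L N g = BOr (map (\<lambda>(J, vs). BAnd (map (\<lambda>v. BOr (map g (filter (\<lambda>u. hash J u = v) [0..<N]))) vs))
    (filter (\<lambda>(J, vs). distinct vs)
      (List.product (List.n_lists k [0..<L]) (List.n_lists k (List.n_lists k [0, 1])))))"

lemma bval_threshold:
  assumes "N \<le> 2 ^ L" "0 < L"
  shows "bval (threshold k L N g) x \<longleftrightarrow> k \<le> card {u. u < N \<and> bval (g u) x}"
proof
  assume "bval (threshold k L N g) x"
  then obtain J vs where vs: "length vs = k" "distinct vs"
    "\<forall>v\<in>set vs. \<exists>u<N. hash J u = v \<and> bval (g u) x"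
    unfolding threshold_def by (auto simp: set_n_lists) 
  then obtain h where h: "\<And>v. v \<in> set vs \<Longrightarrow> h v < N \<and> hash J (h v) = v \<and> bval (g (h v)) x" by metis
  have "inj_on h (set vs)" by (rule inj_on_inverseI[of _ "hash J"]) (use h in blast)
  then have "card (h ` set vs) = k" using vs by (simp add: card_image distinct_card)
  moreover have "card (h ` set vs) \<le> card {u. u < N \<and> bval (g u) x}"
    using h by (intro card_mono) auto
  ultimately show "k \<le> card {u. u < N \<and> bval (g u) x}" by simp
next
  assume "k \<le> card {u. u < N \<and> bval (g u) x}"
  then obtain A where A: "A \<subseteq> {u. u < N \<and> bval (g u) x}" "card A = k" "finite A"
    by (rule obtain_subset_with_card_n) (rule that)
  then have "A \<subseteq> {..<2 ^ L}" using assms(1) by auto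
  then obtain J where J: "length J = k" "set J \<subseteq> {..<L}" "inj_on (hash J) A"
    using separating_positions[OF A(3) _ assms(2)] A(2) by blast
  obtain vs where vs: "set vs = hash J ` A" "distinct vs"
    using finite_distinct_list[of "hash J ` A"] A(3) by blast
  have "length vs = k" using vs J(3) A(2) by (metis card_image distinct_card)
  moreover have "set (hash J u) \<subseteq> {0, 1}" for u
  proof -
    have "digit 2 u j = 0 \<or> digit 2 u j = 1" for j by (auto simp: digit_def)
    then show ?thesis unfolding hash_def by (simp add: image_subset_iff)
  qed
  then have "set vs \<subseteq> set (List.n_lists k [0, 1])"
    unfolding vs(1) set_n_lists using J(1) by (simp add: image_subset_iff hash_def)
  ultimately have "(J, vs) \<in> set (filter (\<lambda>(J, vs). distinct vs)
      (List.product (List.n_lists k [0..<L]) (List.n_lists k (List.n_lists k [0, 1]))))"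
    using J vs(2) by (auto simp: set_n_lists)
  moreover have "bval (BAnd (map (\<lambda>v. BOr (map g (filter (\<lambda>u. hash J u = v) [0..<N]))) vs)) x"
    using vs(1) A(1) by auto
  ultimately show "bval (threshold k L N g) x"
    unfolding threshold_def bval.simps by force
qed

lemma bwf_threshold: "(\<And>u. u < N \<Longrightarrow> bwf n (g u)) \<Longrightarrow> bwf n (threshold k L N g)"
  unfolding threshold_def by auto

lemma bdepth_threshold: "(\<And>u. u < N \<Longrightarrow> bdepth_le d (g u)) \<Longrightarrow> bdepth_le (d + 3) (threshold k L N g)"
  unfolding threshold_def by auto

lemma bsize_threshold:
  assumes "\<And>u. u < N \<Longrightarrow> bsize (g u) \<le> s"
  shows "bsize (threshold k L N g) \<le> 1 + L ^ k * (2 ^ k) ^ k * (1 + k * (1 + N * s))"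
proof -
  let ?P = "List.product (List.n_lists k [0..<L]) (List.n_lists k (List.n_lists k [0, 1 :: nat]))"
  let ?t = "\<lambda>(J, vs). BAnd (map (\<lambda>v. BOr (map g (filter (\<lambda>u. hash J u = v) [0..<N]))) vs)"
  have inner: "bsize (BOr (map g (filter (\<lambda>u. hash J u = v) [0..<N]))) \<le> 1 + N * s" for J v
  proof -
    have "sum_list (map bsize (map g (filter (\<lambda>u. hash J u = v) [0..<N]))) \<le>
        length (map g (filter (\<lambda>u. hash J u = v) [0..<N])) * s"
      by (rule sum_list_le) (use assms in auto)
    also have "\<dots> \<le> N * s"
      using length_filter_le[of "\<lambda>u. hash J u = v" "[0..<N]"] by (intro mult_le_mono1) simp
    finally show ?thesis by simp
  qed
  have "bsize (?t q) \<le> 1 + k * (1 + N * s)" if q_in: "q \<in> set ?P" for q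
  proof -
    obtain J vs where q: "q = (J, vs)" by (cases q)
    then have len: "length vs = k" using q_in by (simp add: set_n_lists)
    have "sum_list (map bsize (map (\<lambda>v. BOr (map g (filter (\<lambda>u. hash J u = v) [0..<N]))) vs)) \<le>
        length (map (\<lambda>v. BOr (map g (filter (\<lambda>u. hash J u = v) [0..<N]))) vs) * (1 + N * s)"
      by (rule sum_list_le) (use inner in \<open>auto simp only: set_map\<close>)
    then show ?thesis using q len by simp
  qed
  then have "sum_list (map bsize (map ?t (filter (\<lambda>(J, vs). distinct vs) ?P))) \<le>
      length (map ?t (filter (\<lambda>(J, vs). distinct vs) ?P)) * (1 + k * (1 + N * s))"
    by (intro sum_list_le) (auto simp only: set_map set_filter)
  also have "\<dots> \<le> L ^ k * (2 ^ k) ^ k * (1 + k * (1 + N * s))"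
    using length_filter_le[of "\<lambda>(J, vs). distinct vs" ?P]
    by (intro mult_le_mono1) (simp add: length_n_lists numeral_2_eq_2)
  finally show ?thesis unfolding threshold_def by simp
qed

text \<open>From \<open>L \<le> k * (L div k + 1)\<close> and \<open>t + 1 \<le> 2 ^ t\<close>
  follows \<open>L \<le> k * 2 ^ (L div k)\<close>, and \<open>k\<close>-th powers give the
  claim.\<close>

lemma power_le_exp: "L ^ k \<le> k ^ k * 2 ^ L" for k L :: nat
proof (cases "k = 0")
  case False
  have "L \<le> k * (L div k + 1)"
    using False by (metis add.commute less_imp_le mult_Suc_right mult.commute Suc_eq_plus1 dividend_less_times_div mult_div_mod_eq neq0_conv)
  also have "\<dots> \<le> k * 2 ^ (L div k)"
    by (intro mult_le_mono2) (simp add: Suc_leI less_exp)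
  finally have "L ^ k \<le> (k * 2 ^ (L div k)) ^ k" by (rule power_mono) simp
  also have "\<dots> = k ^ k * 2 ^ (L div k * k)" by (simp add: power_mult_distrib power_mult)
  also have "\<dots> \<le> k ^ k * 2 ^ L" by (intro mult_le_mono2 power_increasing) auto
  finally show ?thesis .
qed simp

lemma bit_length_exists: "0 < N \<Longrightarrow> \<exists>L>0. N \<le> 2 ^ L \<and> 2 ^ L \<le> 2 * (N::nat)"
proof (cases "N = 1")
  case False
  assume "0 < N"
  then obtain l where "2 ^ l < N" "N \<le> 2 ^ (l + 1)"
    using ex_power_ivl2[of 2 N] False by auto
  then show ?thesis by (intro exI[of _ "l + 1"]) simp
qed (auto intro: exI[of _ 1])

section \<open>Patterns below \<open>e\<^sup>*a\<close>\<close>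

text \<open>The values of the variables and their membership in \<open>X\<close> are fixed
  beforehand, so only atoms of the input structure remain as circuit inputs. \<open>\<beta>\<close>
  is indexed by variables; agreement on variables with equal values is enforced in
  \<open>allowed\<close>.\<close>

fun translate :: "vocabulary \<Rightarrow> nat \<Rightarrow> nat list \<Rightarrow> bool list \<Rightarrow> qf_formula \<Rightarrow> bform" where
  "translate V n env \<beta> Falsum = BOr []"
| "translate V n env \<beta> (Equal i j) = (if env ! i = env ! j then BAnd [] else BOr [])"
| "translate V n env \<beta> (Atom R xs) =
    (if R = length V then (if \<beta> ! hd xs then BAnd [] else BOr [])
     else BIn (offset V n R + idx n (map ((!) env) xs)))"
| "translate V n env \<beta> (Neg a) = BNot (translate V n env \<beta> a)"
| "translate V n env \<beta> (Conj a b) = BAnd [translate V n env \<beta> a, translate V n env \<beta> b]"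
| "translate V n env \<beta> (Disj a b) = BOr [translate V n env \<beta> a, translate V n env \<beta> b]"

primrec qf_size :: "qf_formula \<Rightarrow> nat" where
  "qf_size Falsum = 1"
| "qf_size (Equal i j) = 1"
| "qf_size (Atom R xs) = 1"
| "qf_size (Neg a) = Suc (qf_size a)"
| "qf_size (Conj a b) = Suc (qf_size a + qf_size b)"
| "qf_size (Disj a b) = Suc (qf_size a + qf_size b)"

lemma bsize_translate: "bsize (translate V n env \<beta> a) \<le> qf_size a"
  by (induction a) auto

lemma bdepth_translate: "bdepth_le (qf_size a) (translate V n env \<beta> a)"
  by (induction a) (auto intro: bdepth_le_mono)

lemma map_nth_tuple_set: "set env \<subseteq> {..<n} \<Longrightarrow> \<forall>i\<in>set xs. i < length env \<Longrightarrow> map ((!) env) xs \<in> tuple_set n (length xs)"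
  by (auto simp: tuple_set_def dest!: subsetD)

lemma bwf_translate:
  assumes "set env \<subseteq> {..<n}"
  shows "wf_qf (V @ [1]) (length env) a \<Longrightarrow> bwf (offset V n (length V)) (translate V n env \<beta> a)"
proof (induction a)
  case (Atom R xs)
  show ?case
  proof (cases "R = length V")
    case False
    then have R: "R < length V" "length xs = V ! R" using Atom by (auto simp: nth_append)
    then show ?thesis using map_nth_tuple_set[OF assms, of xs] offset_idx_less[of R V] Atom by simp
  qed auto
qed auto

lemma bval_translate:
  assumes x: "valid_code V x" and env: "set env \<subseteq> {..<code_card x}"
    and \<beta>: "\<And>i. i < length env \<Longrightarrow> \<beta> ! i \<longleftrightarrow> env ! i \<in> I"
  shows "wf_qf (V @ [1]) (length env) a \<Longrightarrow>
    bval (translate V (code_card x) env \<beta> a) x \<longleftrightarrow> holds_qf (expand (decode V x) ((\<lambda>u. [u]) ` I)) env a"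
proof (induction a)
  case (Atom R xs)
  show ?case
  proof (cases "R = length V")
    case True
    then have "length xs = 1" using Atom by simp
    then obtain i where i: "xs = [i]" by (auto simp: length_Suc_conv)
    then have "i < length env" using Atom by simp
    then show ?thesis using True i \<beta> by (auto simp: expand_def decode_def nth_append)
  next
    case False
    then have R: "R < length V" "length xs = V ! R" using Atom by (auto simp: nth_append)
    then show ?thesis using False map_nth_tuple_set[OF env, of xs] Atom
      by (simp add: expand_def decode_def nth_append)
  qed
qed auto

text \<open>\<open>allowed\<close> says that the universally quantified element \<open>u\<close> satisfies the formula if \<open>b\<close> tells whether
  \<open>u\<close> is in \<open>X\<close> and \<open>\<beta>\<close> tells which of the existentially quantified elements \<open>y\<close> are in \<open>X\<close>.\<close>

definition allowed :: "vocabulary \<Rightarrow> nat \<Rightarrow> qf_formula \<Rightarrow> nat list \<Rightarrow> bool list \<Rightarrow> nat \<Rightarrow> bool \<Rightarrow> bform" where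
  "allowed V n a y \<beta> u b = (if \<exists>i<length y. y ! i = u \<and> \<beta> ! i \<noteq> b then BOr []
     else translate V n (y @ [u]) (\<beta> @ [b]) a)"

lemma qf_size_pos: "0 < qf_size a"
  by (induction a) auto

lemma allowed_bounds:
  "bsize (allowed V n a y \<beta> u b) \<le> qf_size a" "bdepth_le (qf_size a) (allowed V n a y \<beta> u b)"
  "y \<in> tuple_set n m \<Longrightarrow> u < n \<Longrightarrow> wf_qf (V @ [1]) (m + 1) a \<Longrightarrow>
    bwf (offset V n (length V)) (allowed V n a y \<beta> u b)"
  using bsize_translate[of V n "y @ [u]" "\<beta> @ [b]" a] bdepth_translate[of a V n "y @ [u]" "\<beta> @ [b]"]
    bwf_translate[of "y @ [u]" n V a] qf_size_pos[of a]
  by (auto simp: allowed_def tuple_set_def Suc_le_eq)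

text \<open>With \<open>y\<close> and \<open>\<beta>\<close> fixed, the condition at
  \<open>u\<close> involves \<open>X\<close> only through \<open>u\<close> itself and the entries of
  \<open>y\<close>, so the elements choose independently. The largest solution contains every
  element that may be in \<open>X\<close>.\<close>

lemma allowed_models:
  assumes x: "valid_code V x" and wf: "wf_qf (V @ [1]) (m + 1) a" and y: "y \<in> tuple_set (code_card x) m"
  shows "(\<exists>I\<subseteq>{..<code_card x}. k \<le> card I \<and>
      (\<forall>u<code_card x. holds_qf (expand (decode V x) ((\<lambda>u. [u]) ` I)) (y @ [u]) a)) \<longleftrightarrow>
    (\<exists>\<beta>. length \<beta> = m \<and>
      (\<forall>u<code_card x. bval (allowed V (code_card x) a y \<beta> u False) x \<or> bval (allowed V (code_card x) a y \<beta> u True) x) \<and>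
      k \<le> card {u. u < code_card x \<and> bval (allowed V (code_card x) a y \<beta> u True) x})"
    (is "?L \<longleftrightarrow> ?R")
proof
  let ?n = "code_card x"
  have y': "length y = m" "set y \<subseteq> {..<?n}" using y by (auto simp: tuple_set_def)
  have tr: "bval (translate V ?n (y @ [u]) (\<beta> @ [b]) a) x \<longleftrightarrow>
      holds_qf (expand (decode V x) ((\<lambda>u. [u]) ` I)) (y @ [u]) a"
    if "u < ?n" "length \<beta> = m" "\<And>i. i < m \<Longrightarrow> \<beta> ! i \<longleftrightarrow> y ! i \<in> I" "b \<longleftrightarrow> u \<in> I" for \<beta> u b I
    by (rule bval_translate[OF x]) (use that y' wf in \<open>auto simp: nth_append less_Suc_eq\<close>)
  {
    assume ?L
    then obtain I where I: "I \<subseteq> {..<?n}" "k \<le> card I"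
      "\<And>u. u < ?n \<Longrightarrow> holds_qf (expand (decode V x) ((\<lambda>u. [u]) ` I)) (y @ [u]) a" by blast
    let ?\<beta> = "map (\<lambda>v. v \<in> I) y"
    have "bval (allowed V ?n a y ?\<beta> u (u \<in> I)) x" if "u < ?n" for u
      using tr[OF that, of ?\<beta> I "u \<in> I"] I(3)[OF that] y' by (auto simp: allowed_def)
    note al = this
    have "card I \<le> card {u. u < ?n \<and> bval (allowed V ?n a y ?\<beta> u True) x}"
    proof (rule card_mono)
      show "I \<subseteq> {u. u < ?n \<and> bval (allowed V ?n a y ?\<beta> u True) x}"
      proof
        fix u assume "u \<in> I"
        then show "u \<in> {u. u < ?n \<and> bval (allowed V ?n a y ?\<beta> u True) x}" using al[of u] I(1) by auto
      qed
    qed simp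
    moreover have "bval (allowed V ?n a y ?\<beta> u False) x \<or> bval (allowed V ?n a y ?\<beta> u True) x" if "u < ?n" for u
      using al[OF that] by (cases "u \<in> I") simp_all
    ultimately show ?R using I(2) y' by (intro exI[of _ ?\<beta>]) simp
  next
    assume ?R
    then obtain \<beta> where \<beta>: "length \<beta> = m"
      "\<And>u. u < ?n \<Longrightarrow> bval (allowed V ?n a y \<beta> u False) x \<or> bval (allowed V ?n a y \<beta> u True) x"
      "k \<le> card {u. u < ?n \<and> bval (allowed V ?n a y \<beta> u True) x}" by blast
    define I where "I = {u. u < ?n \<and> bval (allowed V ?n a y \<beta> u True) x}"
    have memI: "bval (allowed V ?n a y \<beta> u (u \<in> I)) x" if "u < ?n" for u
    proof (cases "u \<in> I")
      case True
      then have "bval (allowed V ?n a y \<beta> u True) x" by (simp add: I_def)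
      then show ?thesis using True by simp
    next
      case False
      then have "\<not> bval (allowed V ?n a y \<beta> u True) x" using that by (simp add: I_def)
      then have "bval (allowed V ?n a y \<beta> u False) x" using \<beta>(2)[OF that] by blast
      then show ?thesis using False by simp
    qed
    \<comment> \<open>At \<open>u = y ! i\<close> the formula \<open>allowed\<close> is false for
      the membership value opposite to \<open>\<beta> ! i\<close>, so \<open>I\<close> has to agree
      with \<open>\<beta>\<close>.\<close>
    have mem: "\<beta> ! i \<longleftrightarrow> y ! i \<in> I" if "i < m" for i
    proof (rule ccontr)
      assume neq: "(\<beta> ! i) \<noteq> (y ! i \<in> I)"
      have "y ! i \<in> set y" using y' that by simp
      then have "y ! i \<in> {..<?n}" using y'(2) by (rule rev_subsetD)
      then have "bval (allowed V ?n a y \<beta> (y ! i) (y ! i \<in> I)) x" by (intro memI) simp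
      moreover have "\<exists>i'<length y. y ! i' = y ! i \<and> \<beta> ! i' \<noteq> (y ! i \<in> I)"
        using that y'(1) neq by (intro exI[of _ i]) simp
      ultimately show False unfolding allowed_def by (simp only: if_True bval.simps) simp
    qed
    have "holds_qf (expand (decode V x) ((\<lambda>u. [u]) ` I)) (y @ [u]) a" if "u < ?n" for u
    proof -
      have "bval (translate V ?n (y @ [u]) (\<beta> @ [u \<in> I]) a) x"
        using memI[OF that] unfolding allowed_def by (simp split: if_splits)
      then show ?thesis using tr[OF that \<beta>(1) mem refl] by blast
    qed
    moreover have "I \<subseteq> {..<?n}" "k \<le> card I" using \<beta>(3) by (auto simp: I_def)
    ultimately show ?L by blast
  }
qed

definition models_formula :: "vocabulary \<Rightarrow> nat \<Rightarrow> qf_formula \<Rightarrow> nat \<Rightarrow> nat \<Rightarrow> nat \<Rightarrow> bform" where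
  "models_formula V m a L n k = BOr (map (\<lambda>(y, \<beta>).
     BAnd [BAnd (map (\<lambda>u. BOr [allowed V n a y \<beta> u False, allowed V n a y \<beta> u True]) [0..<n]),
           threshold k L n (\<lambda>u. allowed V n a y \<beta> u True)])
     (List.product (List.n_lists m [0..<n]) (List.n_lists m [False, True])))"

lemma holds_replicate_Ex:
  "holds S env (replicate m QEx @ q, a) \<longleftrightarrow> (\<exists>t\<in>tuples S m. holds S (env @ t) (q, a))"
proof (induction m arbitrary: env)
  case (Suc m)
  have "tuples S (Suc m) = (\<lambda>(u, t). u # t) ` (univ S \<times> tuples S m)"
    by (auto simp: tuples_def length_Suc_conv image_iff)
  then show ?case using Suc by auto
qed (simp add: tuples_def)

lemma bval_models_formula:
  assumes x: "valid_code V x" and wf: "wf_qf (V @ [1]) (m + 1) a"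
    and L: "code_card x \<le> 2 ^ L" "0 < L"
  shows "bval (models_formula V m a L (code_card x) k) x \<longleftrightarrow>
    so_models (\<ge>) 1 (decode V x) k (replicate m QEx @ [QAll], a)"
proof -
  let ?n = "code_card x"
  have univ: "univ (decode V x) = {..<?n}" "\<And>C. univ (expand (decode V x) C) = {..<?n}"
    "\<And>C. tuples (expand (decode V x) C) m = tuple_set ?n m"
    by (auto simp: univ_def decode_def expand_def tuples_eq)
  have sets: "set (List.n_lists m [0..<?n]) = tuple_set ?n m"
    "set (List.n_lists m [False, True]) = {\<beta>. length \<beta> = m}"
    by (auto simp: set_n_lists tuple_set_def)
  have "so_models (\<ge>) 1 (decode V x) k (replicate m QEx @ [QAll], a) \<longleftrightarrow>
    (\<exists>y\<in>tuple_set ?n m. \<exists>I\<subseteq>{..<?n}. k \<le> card I \<and>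
      (\<forall>u<?n. holds_qf (expand (decode V x) ((\<lambda>u. [u]) ` I)) (y @ [u]) a))"
    unfolding so_models_unary holds_replicate_Ex univ by (auto simp: univ)
  also have "\<dots> \<longleftrightarrow> (\<exists>y\<in>tuple_set ?n m. \<exists>\<beta>. length \<beta> = m \<and>
      (\<forall>u<?n. bval (allowed V ?n a y \<beta> u False) x \<or> bval (allowed V ?n a y \<beta> u True) x) \<and>
      k \<le> card {u. u < ?n \<and> bval (allowed V ?n a y \<beta> u True) x})"
    by (intro bex_cong refl allowed_models[OF x wf])
  also have "\<dots> \<longleftrightarrow> bval (models_formula V m a L ?n k) x"
    unfolding models_formula_def
    by (simp add: bval_threshold[OF L] sets) (simp add: Ball_def conj_assoc)
  finally show ?thesis ..
qed

lemma bdepth_models_formula: "bdepth_le (qf_size a + 5) (models_formula V m a L n k)"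
proof -
  have "bdepth_le (3 + qf_size a) (threshold k L n (\<lambda>u. allowed V n a y \<beta> u True))" for y \<beta>
    unfolding add.commute[of 3] by (rule bdepth_threshold) (rule allowed_bounds)
  moreover have "bdepth_le (qf_size a + 1) (allowed V n a y \<beta> u b)" for y \<beta> u b
    by (rule bdepth_le_mono[OF allowed_bounds(2)]) simp
  ultimately show ?thesis unfolding models_formula_def by auto
qed

lemma bwf_models_formula:
  assumes "wf_qf (V @ [1]) (m + 1) a"
  shows "bwf (offset V n (length V)) (models_formula V m a L n k)"
proof -
  have "bwf (offset V n (length V)) (allowed V n a y \<beta> u b)"
    if "y \<in> set (List.n_lists m [0..<n])" "u < n" for y \<beta> u b
  proof (rule allowed_bounds(3)[OF _ that(2) assms])
    show "y \<in> tuple_set n m" using that(1) by (auto simp: set_n_lists tuple_set_def)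
  qed
  then show ?thesis unfolding models_formula_def by (auto intro!: bwf_threshold)
qed

lemma bsize_models_formula:
  assumes "0 < n" "2 ^ L \<le> 2 * n"
  shows "bsize (models_formula V m a L n k) \<le>
    7 * 2 ^ m * (qf_size a + 1) * ((k + 1) * (2 ^ (k * k) * 2 ^ (k * k))) * (n + 1) ^ (m + 2)"
proof -
  define s where "s = qf_size a"
  define P where "P = (k + 1) * (2 ^ (k * k) * 2 ^ (k * k))"
  let ?X = "n + 1"
  have P1: "1 \<le> P" by (simp add: P_def Suc_le_eq)
  \<comment> \<open>Powers of 2 replace \<open>k ^ k\<close>, because
    \<open>computable_power2\<close> treats base 2. Together with the \<open>(2 ^ k) ^ k\<close>
    lists of patterns this accounts for the two factors \<open>2 ^ (k * k)\<close>.\<close>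
  have "k ^ k \<le> (2 ^ k) ^ k" by (rule power_mono) (auto intro: less_imp_le less_exp)
  then have "k ^ k * 2 ^ L \<le> 2 ^ (k * k) * (2 * n)"
    using assms(2) by (intro mult_le_mono) (simp_all add: power_mult)
  then have Lk: "L ^ k \<le> 2 ^ (k * k) * (2 * n)" using power_le_exp le_trans by blast
  have thr: "bsize (threshold k L n (\<lambda>u. allowed V n a y \<beta> u True)) \<le> 3 * (s + 1) * P * ?X ^ 2" for y \<beta>
  proof -
    have "bsize (threshold k L n (\<lambda>u. allowed V n a y \<beta> u True)) \<le>
        1 + L ^ k * (2 ^ k) ^ k * (1 + k * (1 + n * s))"
      unfolding s_def by (rule bsize_threshold) (rule allowed_bounds)
    also have "\<dots> \<le> 1 + 2 ^ (k * k) * (2 * n) * 2 ^ (k * k) * ((k + 1) * ((s + 1) * ?X))"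
    proof (intro add_mono mult_le_mono Lk)
      show "(2 ^ k) ^ k \<le> (2::nat) ^ (k * k)" by (simp add: power_mult)
      have "1 + n * s \<le> (s + 1) * ?X" by simp
      then have "k * (1 + n * s) \<le> k * ((s + 1) * ?X)" by (rule mult_le_mono2)
      moreover have "1 \<le> (s + 1) * ?X" by simp
      ultimately have "1 + k * (1 + n * s) \<le> (s + 1) * ?X + k * ((s + 1) * ?X)" by (rule add_mono[rotated])
      then show "1 + k * (1 + n * s) \<le> (k + 1) * ((s + 1) * ?X)" by simp
    qed simp
    also have "\<dots> = 1 + 2 * ((s + 1) * P) * (n * ?X)"
      by (simp only: P_def mult.assoc mult.commute mult.left_commute)
    also have "\<dots> \<le> (s + 1) * P * ?X ^ 2 + 2 * ((s + 1) * P) * ?X ^ 2"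
      using P1 by (intro add_mono mult_le_mono) (auto simp: power2_eq_square Suc_le_eq)
    also have "\<dots> = 3 * (s + 1) * P * ?X ^ 2" by (simp add: algebra_simps)
    finally show ?thesis .
  qed
  have body: "bsize (BAnd [BAnd (map (\<lambda>u. BOr [allowed V n a y \<beta> u False, allowed V n a y \<beta> u True]) [0..<n]),
           threshold k L n (\<lambda>u. allowed V n a y \<beta> u True)]) \<le> 6 * (s + 1) * P * ?X ^ 2" for y \<beta>
  proof -
    have "sum_list (map bsize (map (\<lambda>u. BOr [allowed V n a y \<beta> u False, allowed V n a y \<beta> u True]) [0..<n])) \<le>
        length (map (\<lambda>u. BOr [allowed V n a y \<beta> u False, allowed V n a y \<beta> u True]) [0..<n]) * (1 + 2 * s)"
    proof (rule sum_list_le)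
      fix t assume "t \<in> set (map (\<lambda>u. BOr [allowed V n a y \<beta> u False, allowed V n a y \<beta> u True]) [0..<n])"
      then obtain u where t: "t = BOr [allowed V n a y \<beta> u False, allowed V n a y \<beta> u True]" by auto
      show "bsize t \<le> 1 + 2 * s"
        using allowed_bounds(1)[of V n a y \<beta> u False] allowed_bounds(1)[of V n a y \<beta> u True]
        unfolding t s_def by simp
    qed
    then have "sum_list (map bsize (map (\<lambda>u. BOr [allowed V n a y \<beta> u False, allowed V n a y \<beta> u True]) [0..<n]))
        \<le> n * (1 + 2 * s)" by simp
    moreover have "2 + n * (1 + 2 * s) \<le> 3 * (s + 1) * P * ?X ^ 2"
    proof -
      have "2 + n * (1 + 2 * s) \<le> 3 * (s + 1) * ?X" by (simp add: algebra_simps)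
      also have "\<dots> \<le> 3 * (s + 1) * (P * ?X ^ 2)"
        using P1 mult_le_mono[OF P1, of ?X "?X ^ 2"] by (intro mult_le_mono2) (simp add: power2_eq_square)
      finally show ?thesis by (simp only: mult.assoc)
    qed
    moreover have split: "bsize (BAnd [BAnd ts, t]) = 2 + sum_list (map bsize ts) + bsize t" for ts t by simp
    moreover have "6 * (s + 1) * P * ?X ^ 2 = 3 * (s + 1) * P * ?X ^ 2 + 3 * (s + 1) * P * ?X ^ 2"
      by (simp add: algebra_simps)
    ultimately show ?thesis using thr[of y \<beta>] unfolding split by linarith
  qed
  let ?P = "List.product (List.n_lists m [0..<n]) (List.n_lists m [False, True])"
  let ?t = "\<lambda>(y, \<beta>). BAnd [BAnd (map (\<lambda>u. BOr [allowed V n a y \<beta> u False, allowed V n a y \<beta> u True]) [0..<n]),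
           threshold k L n (\<lambda>u. allowed V n a y \<beta> u True)]"
  have "bsize (?t q) \<le> 6 * (s + 1) * P * ?X ^ 2" for q
    using body by (cases q) (simp only: prod.case)
  then have "sum_list (map bsize (map ?t ?P)) \<le> length (map ?t ?P) * (6 * (s + 1) * P * ?X ^ 2)"
    by (intro sum_list_le) (auto simp only: set_map)
  also have "length (map ?t ?P) = n ^ m * 2 ^ m"
    by (simp add: length_n_lists numeral_2_eq_2)
  also have "n ^ m * 2 ^ m * (6 * (s + 1) * P * ?X ^ 2) \<le> ?X ^ m * 2 ^ m * (6 * (s + 1) * P * ?X ^ 2)"
    by (intro mult_le_mono1 power_mono) auto
  also have "\<dots> = 6 * 2 ^ m * (s + 1) * P * ?X ^ (m + 2)"
    by (simp only: power_add mult.assoc mult.commute mult.left_commute)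
  finally have "bsize (models_formula V m a L n k) \<le> 1 + 6 * 2 ^ m * (s + 1) * P * ?X ^ (m + 2)"
    unfolding models_formula_def by simp
  also have "1 + 6 * 2 ^ m * (s + 1) * P * ?X ^ (m + 2) \<le> 7 * 2 ^ m * (s + 1) * P * ?X ^ (m + 2)"
  proof -
    define Y where "Y = 2 ^ m * (s + 1) * P * ?X ^ (m + 2)"
    have "1 \<le> Y" using P1 by (simp add: Y_def Suc_le_eq)
    moreover have "c * 2 ^ m * (s + 1) * P * ?X ^ (m + 2) = c * Y" for c
      by (simp only: Y_def mult.assoc)
    ultimately show ?thesis by simp
  qed
  finally show ?thesis unfolding s_def P_def .
qed

text \<open>The length of a code determines the size of the universe, so the circuit for a given
  input length can be built for a known universe.\<close>

lemma offset_strict_mono: "n < n' \<Longrightarrow> offset V n i < offset V n' i"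
  unfolding offset_def by (intro add_less_le_mono sum_mono power_mono) auto

lemma code_card_eq_iff:
  assumes "n < length x"
  shows "code_card x = n \<longleftrightarrow> (\<forall>i<n. x ! i) \<and> \<not> x ! n"
proof
  assume *: "(\<forall>i<n. x ! i) \<and> \<not> x ! n"
  have "takeWhile id x = take n x" by (rule takeWhile_eq_take_P_nth) (use * in auto)
  then show "code_card x = n" using assms by (simp add: code_card_def)
next
  assume *: "code_card x = n"
  then have "\<not> x ! n" using nth_length_takeWhile[of id x] assms by (simp add: code_card_def)
  moreover have "x ! i" if "i < n" for i
    using less_length_takeWhile[of i id x] that * by (simp add: code_card_def)
  ultimately show "(\<forall>i<n. x ! i) \<and> \<not> x ! n" by blast
qed

text \<open>\<open>test\<close> and \<open>T\<close> stand for an additional property of the input: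
  trivial for arbitrary structures, symmetry for undirected graphs.\<close>

lemma models_in_para_AC0:
  assumes wf: "wf_qf (V @ [1]) (m + 1) a"
    and test: "\<And>n. bwf (offset V n (length V)) (test n)" "\<And>n. bdepth_le 5 (test n)"
      "\<And>n. bsize (test n) \<le> 10 * (n + 1) ^ 2"
      "\<And>x. valid_code V x \<Longrightarrow> bval (test (code_card x)) x \<longleftrightarrow> T x"
    and Q: "\<And>x k. (x, k) \<in> Q \<longleftrightarrow> valid_code V x \<and> T x \<and>
      so_models (\<ge>) 1 (decode V x) k (replicate m QEx @ [QAll], a)"
  shows "Q \<in> para_AC0"
proof -
  \<comment> \<open>The bound \<open>2 ^ L n \<le> 2 * n\<close> turns the factor
    \<open>2 ^ L\<close> of \<open>power_le_exp\<close> into a linear one.\<close>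
  define L where "L n = (SOME L. 0 < L \<and> n \<le> 2 ^ L \<and> 2 ^ L \<le> 2 * n)" for n :: nat
  have L: "0 < L n" "n \<le> 2 ^ L n" "2 ^ L n \<le> 2 * n" if "0 < n" for n
    using someI_ex[OF bit_length_exists[OF that]] unfolding L_def by auto
  \<comment> \<open>The inverse of the length function, by choice. It is meaningful only for lengths
    of codes; all other lengths get a constantly false formula.\<close>
  define card_of where "card_of l = (SOME n. 0 < n \<and> l = offset V n (length V))" for l
  let ?ok = "\<lambda>l. \<exists>n>0. l = offset V n (length V)"
  have card_of: "0 < card_of l" "l = offset V (card_of l) (length V)" if "?ok l" for l
    using someI_ex[OF that] unfolding card_of_def by auto
  define F where "F l k = (let n = card_of l in if ?ok l
    then BAnd [BAnd (map BIn [0..<n]), BNot (BIn n), test n, models_formula V m a (L n) n k]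
    else BOr [])" for l k
  have F_no: "F l k = BOr []" if "\<not> ?ok l" for l k
    unfolding F_def Let_def if_not_P[OF that] ..
  have F_yes: "F l k = BAnd [BAnd (map BIn [0..<card_of l]), BNot (BIn (card_of l)), test (card_of l),
      models_formula V m a (L (card_of l)) (card_of l) k]" if "?ok l" for l k
    unfolding F_def Let_def if_P[OF that] ..
  define f where "f k = (15 + 7 * 2 ^ m * (qf_size a + 1)) * ((k + 1) * (2 ^ (k * k) * 2 ^ (k * k)))" for k :: nat
  show ?thesis
  proof (rule para_AC0I)
    show "computable f"
      unfolding f_def
      by (rule computable_ok, intro ok_mult ok_add ok_const ok_var ok_app[OF computable_power2])
    show "bwf l (F l k)" for l k
    proof (cases "?ok l")
      case True
      note n = card_of[OF True]
      have "card_of l < offset V (card_of l) (length V)" by (simp add: offset_def)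
      then have "card_of l < l" using n(2) by simp
      moreover have "bwf l (test (card_of l))" "bwf l (models_formula V m a (L (card_of l)) (card_of l) k)"
        using test(1)[of "card_of l"] bwf_models_formula[OF wf, of "card_of l"] n(2) by simp_all
      ultimately show ?thesis unfolding F_yes[OF True] by auto
    next
      case False
      show ?thesis unfolding F_no[OF False] by simp
    qed
    show "bdepth_le (qf_size a + 6) (F l k)" for l k
    proof (cases "?ok l")
      case True
      show ?thesis
        using bdepth_le_mono[OF test(2), of "qf_size a + 5"] bdepth_models_formula[of a]
        unfolding F_yes[OF True] by (auto simp: add.commute)
    next
      case False
      show ?thesis unfolding F_no[OF False] by simp
    qed
    show "bsize (F l k) \<le> f k * (l + 1) ^ (m + 2)" for l k
    proof (cases "?ok l")
      case True
      define n where "n = card_of l"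
      have n: "0 < n" "l = offset V n (length V)" using card_of[OF True] by (simp_all add: n_def)
      define P where "P = (k + 1) * (2 ^ (k * k) * 2 ^ (k * k))"
      have P1: "1 \<le> P" by (simp add: P_def Suc_le_eq)
      let ?X = "n + 1"
      let ?c = "7 * 2 ^ m * (qf_size a + 1)"
      have Xm: "?X ^ 2 \<le> ?X ^ (m + 2)" by (rule power_increasing) auto
      have X: "?X \<le> ?X ^ 2" by (simp add: power2_eq_square)
      have "sum_list (map (bsize \<circ> BIn) [0..<n]) \<le> n"
        using sum_list_le[of "[0..<n]" "bsize \<circ> BIn" 1] by simp
      then have "bsize (F l k) \<le> 4 + n + 10 * ?X ^ 2 + ?c * P * ?X ^ (m + 2)"
        using test(3)[of n] bsize_models_formula[OF n(1) L(3)[OF n(1)], of V m a k]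
        unfolding F_yes[OF True] n_def[symmetric] P_def by simp
      also have "\<dots> \<le> 15 * ?X ^ (m + 2) + ?c * P * ?X ^ (m + 2)" using X Xm n(1) by simp
      also have "\<dots> \<le> 15 * P * ?X ^ (m + 2) + ?c * P * ?X ^ (m + 2)"
        using P1 by (intro add_mono mult_le_mono order_refl) simp_all
      also have "\<dots> = f k * ?X ^ (m + 2)" unfolding f_def P_def[symmetric]
        by (simp only: distrib_right)
      also have "\<dots> \<le> f k * (l + 1) ^ (m + 2)"
        using n(2) by (intro mult_le_mono2 power_mono) (auto simp: offset_def)
      finally show ?thesis .
    next
      case False
      have "1 \<le> f k * (l + 1) ^ (m + 2)" by (simp add: f_def Suc_le_eq)
      then show ?thesis unfolding F_no[OF False] by simp
    qed
    fix x k
    show "(x, k) \<in> Q \<longleftrightarrow> bval (F (length x) k) x"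
    proof (cases "?ok (length x)")
      case True
      define n where "n = card_of (length x)"
      have n: "0 < n" "length x = offset V n (length V)" using card_of[OF True] by (simp_all add: n_def)
      then have lt: "n < length x" by (simp add: offset_def)
      have valid: "valid_code V x \<longleftrightarrow> code_card x = n"
        using n offset_strict_mono[of _ _ V "length V"] unfolding valid_code_def by (metis nat_neq_iff)
      show ?thesis
      proof (cases "valid_code V x")
        case v: True
        then have c: "code_card x = n" using valid by simp
        have "bval (test n) x \<longleftrightarrow> T x" using test(4)[OF v] c by simp
        moreover have "bval (models_formula V m a (L n) n k) x \<longleftrightarrow>
            so_models (\<ge>) 1 (decode V x) k (replicate m QEx @ [QAll], a)"
          using bval_models_formula[OF v wf] L(1,2)[OF n(1)] c by simp
        ultimately show ?thesis
          using v code_card_eq_iff[OF lt] c unfolding Q F_yes[OF True] n_def[symmetric] by auto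
      next
        case False
        then show ?thesis
          using valid code_card_eq_iff[OF lt] unfolding Q F_yes[OF True] n_def[symmetric] by auto
      qed
    next
      case False
      then have "\<not> valid_code V x" by (auto simp: valid_code_def)
      then show ?thesis unfolding Q F_no[OF False] by simp
    qed
  qed
qed

lemma subseq_Ex_All:
  "subseq p (replicate m QEx @ [QAll]) \<Longrightarrow> \<exists>j. p = replicate j QEx \<or> p = replicate j QEx @ [QAll]"
proof (induction m arbitrary: p)
  case 0
  show ?case
  proof (cases p)
    case Nil
    then show ?thesis by (intro exI[of _ 0]) simp
  next
    case (Cons q p')
    then have "p = [QAll]" using 0 by (auto split: if_splits)
    then show ?thesis by (intro exI[of _ 0]) simp
  qed
next
  case (Suc m)
  show ?case
  proof (cases p)
    case Nil
    then show ?thesis by (intro exI[of _ 0]) simp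
  next
    case (Cons q p')
    show ?thesis
    proof (cases q)
      case QEx
      then have "subseq p' (replicate m QEx @ [QAll])" using Suc.prems Cons by simp
      then obtain j where "p' = replicate j QEx \<or> p' = replicate j QEx @ [QAll]" using Suc.IH by blast
      then show ?thesis using Cons QEx by (intro exI[of _ "Suc j"]) auto
    next
      case QAll
      then have "subseq p (replicate m QEx @ [QAll])" using Suc.prems Cons by simp
      then show ?thesis by (rule Suc.IH)
    qed
  qed
qed

lemma holds_qf_append: "wf_qf V (length y) a \<Longrightarrow> holds_qf S (y @ z) a \<longleftrightarrow> holds_qf S y a"
proof (induction a)
  case (Atom R xs)
  then have "map ((!) (y @ z)) xs = map ((!) y) xs" by (auto simp: nth_append)
  then show ?case by (simp only: holds_qf.simps)
qed (auto simp: nth_append)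

lemma wf_qf_mono: "wf_qf V i a \<Longrightarrow> i \<le> j \<Longrightarrow> wf_qf V j a"
  by (induction a) (auto intro: less_le_trans)

text \<open>A prefix without universal quantifier gets a vacuous one appended, which is harmless in
  a nonempty universe; thus only prefixes \<open>replicate m QEx @ [QAll]\<close> have to be
  treated.\<close>

lemma easy_pattern:
  assumes "subseq p (replicate j QEx @ [QAll])" "sentence (V @ [1]) (p, a)"
  shows "\<exists>m. wf_qf (V @ [1]) (m + 1) a \<and> (\<forall>S\<in>structures V. \<forall>k.
    so_models (\<ge>) 1 S k (p, a) \<longleftrightarrow> so_models (\<ge>) 1 S k (replicate m QEx @ [QAll], a))"
proof -
  obtain m where "p = replicate m QEx \<or> p = replicate m QEx @ [QAll]"
    using subseq_Ex_All[OF assms(1)] by blast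
  then show ?thesis
  proof
    assume p: "p = replicate m QEx"
    then have wf: "wf_qf (V @ [1]) m a" using assms(2) by (simp add: sentence_def)
    have "so_models (\<ge>) 1 S k (p, a) \<longleftrightarrow> so_models (\<ge>) 1 S k (replicate m QEx @ [QAll], a)"
      if "S \<in> structures V" for S k
    proof -
      have "holds (expand S C) [] (replicate m QEx @ [], a) \<longleftrightarrow>
          holds (expand S C) [] (replicate m QEx @ [QAll], a)" for C
        unfolding holds_replicate_Ex
      proof (intro bex_cong refl)
        fix t assume "t \<in> tuples (expand S C) m"
        then have "length t = m" by (simp add: tuples_def)
        moreover have "univ (expand S C) \<noteq> {}" using that by (auto simp: structures_def univ_def expand_def)
        ultimately show "holds (expand S C) ([] @ t) ([], a) \<longleftrightarrow> holds (expand S C) ([] @ t) ([QAll], a)"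
          using holds_qf_append[of "V @ [1]" t a] wf by auto
      qed
      then show ?thesis unfolding so_models_def p by simp
    qed
    then show ?thesis using wf_qf_mono[OF wf, of "m + 1"] by (intro exI[of _ m]) auto
  next
    assume "p = replicate m QEx @ [QAll]"
    then show ?thesis using assms(2) by (intro exI[of _ m]) (simp add: sentence_def)
  qed
qed

lemma easy_patterns_in_para_AC0:
  assumes "subseq p (replicate j QEx @ [QAll])"
  shows "p_FD (\<ge>) p \<subseteq> para_AC0"
proof
  fix Q assume "Q \<in> p_FD (\<ge>) p"
  then obtain V a where Q: "Q = encode_problem V (p_models (\<ge>) 1 V (p, a))" and s: "sentence (V @ [1]) (p, a)"
    unfolding p_FD_def by blast
  obtain m where wf: "wf_qf (V @ [1]) (m + 1) a" and eq: "\<And>S k. S \<in> structures V \<Longrightarrow>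
    so_models (\<ge>) 1 S k (p, a) \<longleftrightarrow> so_models (\<ge>) 1 S k (replicate m QEx @ [QAll], a)"
    using easy_pattern[OF assms s] by blast
  show "Q \<in> para_AC0"
  proof (rule models_in_para_AC0[OF wf, where test = "\<lambda>_. BAnd []" and T = "\<lambda>_. True"])
    show "(x, k) \<in> Q \<longleftrightarrow> valid_code V x \<and> True \<and>
        so_models (\<ge>) 1 (decode V x) k (replicate m QEx @ [QAll], a)" for x k
      unfolding Q p_models_iff using eq[OF decode_structure] by blast
  qed simp_all
qed

text \<open>Symmetry of the edge relation is a property of the input alone and is checked by a
  separate conjunct over all pairs, the bit of \<open>(u, v)\<close> being at position
  \<open>n + 1 + (u * n + v)\<close>.\<close>

lemma easy_patterns_undirected_in_para_AC0:
  assumes "subseq p (replicate j QEx @ [QAll])"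
  shows "p_FD_undirected (\<ge>) p \<subseteq> para_AC0"
proof
  fix Q assume "Q \<in> p_FD_undirected (\<ge>) p"
  then obtain a where Q: "Q = encode_problem graph_voc (p_models (\<ge>) 1 graph_voc (p, a) \<inter> undirected_graphs \<times> UNIV)"
    and s: "sentence (graph_voc @ [1]) (p, a)"
    unfolding p_FD_undirected_def by blast
  obtain m where wf: "wf_qf (graph_voc @ [1]) (m + 1) a" and eq: "\<And>S k. S \<in> structures graph_voc \<Longrightarrow>
    so_models (\<ge>) 1 S k (p, a) \<longleftrightarrow> so_models (\<ge>) 1 S k (replicate m QEx @ [QAll], a)"
    using easy_pattern[OF assms s] by blast
  let ?e = "\<lambda>n u v. BIn (n + 1 + (u * n + v))"
  let ?test = "\<lambda>n. BAnd (map (\<lambda>(u, v). BOr [BNot (?e n u v), ?e n v u]) (List.product [0..<n] [0..<n]))"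
  show "Q \<in> para_AC0"
  proof (rule models_in_para_AC0[OF wf, where test = ?test and T = "\<lambda>x. decode graph_voc x \<in> undirected_graphs"])
    show "(x, k) \<in> Q \<longleftrightarrow> valid_code graph_voc x \<and> decode graph_voc x \<in> undirected_graphs \<and>
        so_models (\<ge>) 1 (decode graph_voc x) k (replicate m QEx @ [QAll], a)" for x k
      unfolding Q p_models_undirected_iff using eq[OF decode_structure] by blast
    have less: "u * n + v < n * n" if "u < n" "v < n" for u v n :: nat
      using idx_less[of "[u, v]" n 2] that by (simp add: tuple_set_def power2_eq_square)
    show "bwf (offset graph_voc n (length graph_voc)) (?test n)" for n
      using less by (auto simp: offset_def power2_eq_square)
    show "bdepth_le 5 (?test n)" for n by auto
    show "bsize (?test n) \<le> 10 * (n + 1) ^ 2" for n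
    proof -
      let ?l = "map (\<lambda>(u, v). BOr [BNot (?e n u v), ?e n v u]) (List.product [0..<n] [0..<n])"
      have "sum_list (map bsize ?l) \<le> length ?l * 4" by (rule sum_list_le) auto
      then show ?thesis by (simp add: power2_eq_square)
    qed
    show "bval (?test (code_card x)) x \<longleftrightarrow> decode graph_voc x \<in> undirected_graphs"
      if "valid_code graph_voc x" for x
    proof -
      have "[u, v] \<in> rels (decode graph_voc x) ! 0 \<longleftrightarrow> u < code_card x \<and> v < code_card x \<and>
          x ! (code_card x + 1 + (u * code_card x + v))" for u v
        by (auto simp: decode_def tuple_set_def offset_def)
      then show ?thesis
        using decode_structure[OF that] by (auto simp: undirected_graphs_def)
    qed
  qed
qed

theorem mainTheorem2:
  fixes p :: pattern
  shows "((\<exists>m. subseq p (replicate m QEx @ [QAll])) \<longrightarrow>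
            p_FD (\<ge>) p \<subseteq> para_AC0 \<and> p_FD_undirected (\<ge>) p \<subseteq> para_AC0) \<and>
         (subseq [QAll, QAll] p \<or> subseq [QAll, QEx] p \<longrightarrow>
            (\<exists>Q\<in>p_FD (\<ge>) p. W1_hard Q) \<and> (\<exists>Q\<in>p_FD_undirected (\<ge>) p. W1_hard Q))"
  using easy_patterns_in_para_AC0 easy_patterns_undirected_in_para_AC0 hard_all_all hard_all_ex by blast

end
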